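(* Let $\mathscr{V}$ be a symmetric monoidal closed category and let $j:\mathscr{J}\rightarrow\underline{\mathscr{V}}$ be a system of arities. Then $j$ is eleutheric if and only if $j$ presents $\underline{\mathscr{V}}$ as a free cocompletion of $\mathscr{J}$ under left Kan extensions along $j$, i.e. as a free $\Phi_{\mathscr{J}}$-cocompletion of $\mathscr{J}$.
   Context: $\mathscr{V}$ is a symmetric monoidal closed category with unit $I$ and product $\otimes$; no completeness or cocompleteness is assumed. $\underline{\mathscr{V}}$ denotes $\mathscr{V}$ regarded as a $\mathscr{V}$-category. $\mathscr{V}$-categories may be large, and all (co)limits and Kan extensions are $\mathscr{V}$-enriched (Kan extensions are pointwise). $\mathscr{V}\text{-CAT}(\mathscr{A},\mathscr{B})$ is the ordinary category of $\mathscr{V}$-functors $\mathscr{A}\to\mathscr{B}$ and $\mathscr{V}$-natural transformations. System of arities: a fully faithful strong symmetric monoidal $\mathscr{V}$-functor $j:\mathscr{J}\to\underline{\mathscr{V}}$, where $\mathscr{J}$ is a (possibly large) symmetric monoidal $\mathscr{V}$-category (for example the inclusion of a full sub-$\mathscr{V}$-category containing $I$ and closed under $\otimes$). We often write $J$ for the object $j(J)$ of $\mathscr{V}$. Weights: a weight is a $\mathscr{V}$-functor $W:\mathscr{B}^{\mathrm{op}}\to\underline{\mathscr{V}}$; for $D:\mathscr{B}\to\mathscr{C}$, $W\star D$ denotes the weighted colimit. A weight $W$ is $\mathscr{J}$-flat if all $W$-weighted colimits that exist in $\underline{\mathscr{V}}$ are preserved by each $\mathscr{V}$-functor $\underline{\mathscr{V}}(J,-):\underline{\mathscr{V}}\to\underline{\mathscr{V}}$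 with $J\in\mathrm{ob}\,\mathscr{J}$. For each object $V$ of $\mathscr{V}$ let $\mathsf{y}_j(V)=\underline{\mathscr{V}}(j-,V):\mathscr{J}^{\mathrm{op}}\to\underline{\mathscr{V}}$, and let $\Phi_{\mathscr{J}}$ be the class of all weights $\mathsf{y}_j(V)$ with $V\in\mathrm{ob}\,\mathscr{V}$. Since the left Kan extension of $P:\mathscr{J}\to\mathscr{C}$ along $j$ is given by $V\mapsto \mathsf{y}_j(V)\star P$, these are called the weights for left Kan extensions along $j$. Eleutheric: $j$ is eleutheric if $\underline{\mathscr{V}}$ has all weighted colimits with weights in $\Phi_{\mathscr{J}}$ and every weight in $\Phi_{\mathscr{J}}$ is $\mathscr{J}$-flat. For a class of weights $\Phi$, a $\mathscr{V}$-category is $\Phi$-cocomplete if it has all colimits with weights in $\Phi$, and a $\mathscr{V}$-functor is $\Phi$-cocontinuous if it preserves all such colimits. For $\Phi$-cocomplete $\mathscr{B},\mathscr{C}$, $\Phi\text{-Cocts}(\mathscr{B},\mathscr{C})$ is the full subcategory of $\mathscr{V}\text{-CAT}(\mathscr{B},\mathscr{C})$ on the $\Phi$-cocontinuous $\mathscr{V}$-functors. A $\mathscr{V}$-functor $F:\mathscr{A}\to\mathscr{B}$ presents $\mathscr{B}$ as a free $\Phi$-cocompletion of $\mathscr{A}$ if $\mathscr{B}$ is $\Phi$-cocomplete and, for every $\Phi$-cocomplete $\mathscr{V}$-category $\mathscr{C}$, composition with $F$ is an equivalence of categories $\Phi\text{-Cocts}(\mathscr{B},\mathscr{C})\to\mathscr{V}\text{-CAT}(\mathscr{A},\mathscr{C})$.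 A free cocompletion under left Kan extensions along $j$ means a free $\Phi_{\mathscr{J}}$-cocompletion. *)

theory Defs
  imports "HOL-Library.FuncSet"
begin

section \<open>Ordinary categories\<close>

record ('o, 'a) category =
  Ob :: "'o set"
  Ar :: "'a set"
  Dom :: "'a \<Rightarrow> 'o"
  Cod :: "'a \<Rightarrow> 'o"
  Idn :: "'o \<Rightarrow> 'a"  ("\<one>\<index>")
  Cmp :: "'a \<Rightarrow> 'a \<Rightarrow> 'a"  (infixr "\<cdot>\<index>" 55)

definition Hom :: "('o, 'a, 'm) category_scheme \<Rightarrow> 'o \<Rightarrow> 'o \<Rightarrow> 'a set" where
  "Hom C x y = {f \<in> Ar C. Dom C f = x \<and> Cod C f = y}"

locale ord_category =
  fixes C :: "('o, 'a, 'm) category_scheme" (structure)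
  assumes dom_cod: "f \<in> Ar C \<Longrightarrow> Dom C f \<in> Ob C \<and> Cod C f \<in> Ob C"
    and idn: "x \<in> Ob C \<Longrightarrow> \<one> x \<in> Hom C x x"
    and cmp: "\<lbrakk>f \<in> Hom C x y; g \<in> Hom C y z\<rbrakk> \<Longrightarrow> g \<cdot> f \<in> Hom C x z"
    and cmp_assoc: "\<lbrakk>f \<in> Hom C w x; g \<in> Hom C x y; h \<in> Hom C y z\<rbrakk>
                    \<Longrightarrow> (h \<cdot> g) \<cdot> f = h \<cdot> (g \<cdot> f)"
    and idn_left: "f \<in> Hom C x y \<Longrightarrow> \<one> y \<cdot> f = f"
    and idn_right: "f \<in> Hom C x y \<Longrightarrow> f \<cdot> \<one> x = f"

definition inverse_arrows :: "('o, 'a, 'm) category_scheme \<Rightarrow> 'a \<Rightarrow> 'a \<Rightarrow> bool" where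
  "inverse_arrows C f g \<longleftrightarrow>
     f \<in> Ar C \<and> g \<in> Hom C (Cod C f) (Dom C f) \<and>
     Cmp C g f = Idn C (Dom C f) \<and> Cmp C f g = Idn C (Cod C f)"

definition iso_arr :: "('o, 'a, 'm) category_scheme \<Rightarrow> 'a \<Rightarrow> bool" where
  "iso_arr C f \<longleftrightarrow> (\<exists>g. inverse_arrows C f g)"

definition inverse_arr :: "('o, 'a, 'm) category_scheme \<Rightarrow> 'a \<Rightarrow> 'a"  ("inv\<index> _" [81] 80) where
  "inverse_arr C f = (THE g. inverse_arrows C f g)"

definition full_subcategory :: "('o, 'a) category \<Rightarrow> 'o set \<Rightarrow> ('o, 'a) category" where
  "full_subcategory C S =
     C\<lparr>Ob := Ob C \<inter> S, Ar := {f \<in> Ar C. Dom C f \<in> S \<and> Cod C f \<in> S}\<rparr>"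

record ('o, 'a, 'p, 'b) ord_functor =
  FOb :: "'o \<Rightarrow> 'p"
  FAr :: "'a \<Rightarrow> 'b"

definition is_ord_functor ::
  "('o, 'a, 'm) category_scheme \<Rightarrow> ('p, 'b, 'n) category_scheme \<Rightarrow>
   ('o, 'a, 'p, 'b) ord_functor \<Rightarrow> bool" where
  "is_ord_functor C D F \<longleftrightarrow>
     (\<forall>x\<in>Ob C. FOb F x \<in> Ob D) \<and>
     (\<forall>x\<in>Ob C. \<forall>y\<in>Ob C. \<forall>f\<in>Hom C x y. FAr F f \<in> Hom D (FOb F x) (FOb F y)) \<and>
     (\<forall>x\<in>Ob C. FAr F (Idn C x) = Idn D (FOb F x)) \<and>
     (\<forall>x\<in>Ob C. \<forall>y\<in>Ob C. \<forall>z\<in>Ob C. \<forall>f\<in>Hom C x y. \<forall>g\<in>Hom C y z.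
        FAr F (Cmp C g f) = Cmp D (FAr F g) (FAr F f))"

definition ord_functor_id :: "('o, 'a, 'o, 'a) ord_functor" where
  "ord_functor_id = \<lparr>FOb = (\<lambda>x. x), FAr = (\<lambda>f. f)\<rparr>"

definition ord_functor_comp ::
  "('p, 'b, 'q, 'c) ord_functor \<Rightarrow> ('o, 'a, 'p, 'b) ord_functor \<Rightarrow> ('o, 'a, 'q, 'c) ord_functor" where
  "ord_functor_comp G F = \<lparr>FOb = (\<lambda>x. FOb G (FOb F x)), FAr = (\<lambda>f. FAr G (FAr F f))\<rparr>"

definition is_natural_iso ::
  "('o, 'a, 'm) category_scheme \<Rightarrow> ('p, 'b, 'n) category_scheme \<Rightarrow>
   ('o, 'a, 'p, 'b) ord_functor \<Rightarrow> ('o, 'a, 'p, 'b) ord_functor \<Rightarrow> ('o \<Rightarrow> 'b) \<Rightarrow> bool" where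
  "is_natural_iso C D F G t \<longleftrightarrow>
     (\<forall>x\<in>Ob C. t x \<in> Hom D (FOb F x) (FOb G x) \<and> iso_arr D (t x)) \<and>
     (\<forall>x\<in>Ob C. \<forall>y\<in>Ob C. \<forall>f\<in>Hom C x y.
        Cmp D (t y) (FAr F f) = Cmp D (FAr G f) (t x))"

definition is_equivalence ::
  "('o, 'a, 'm) category_scheme \<Rightarrow> ('p, 'b, 'n) category_scheme \<Rightarrow>
   ('o, 'a, 'p, 'b) ord_functor \<Rightarrow> bool" where
  "is_equivalence C D F \<longleftrightarrow>
     is_ord_functor C D F \<and>
     (\<exists>G s t. is_ord_functor D C G \<and>
        is_natural_iso C C (ord_functor_comp G F) ord_functor_id s \<and>
        is_natural_iso D D (ord_functor_comp F G) ord_functor_id t)"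


section \<open>Symmetric monoidal categories and functors\<close>

record ('o, 'a) smc = "('o, 'a) category" +
  Ten :: "'o \<Rightarrow> 'o \<Rightarrow> 'o"  (infixl "\<otimes>\<index>" 70)
  TenA :: "'a \<Rightarrow> 'a \<Rightarrow> 'a"  (infixl "\<oslash>\<index>" 70)
  Unt :: "'o"  ("\<I>\<index>")
  Asc :: "'o \<Rightarrow> 'o \<Rightarrow> 'o \<Rightarrow> 'a"
  LUn :: "'o \<Rightarrow> 'a"
  RUn :: "'o \<Rightarrow> 'a"
  Sym :: "'o \<Rightarrow> 'o \<Rightarrow> 'a"

text \<open>The operation \<open>\<oslash>\<close> is the tensor product of arrows. The axioms are those of Mac Lane, including
  the (redundant) ones relating \<open>LUn\<close> and \<open>RUn\<close>.\<close>

locale symmetric_monoidal_category = ord_category C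
  for C :: "('o, 'a, 'm) smc_scheme" (structure) +
  assumes ten_ob: "\<lbrakk>x \<in> Ob C; y \<in> Ob C\<rbrakk> \<Longrightarrow> x \<otimes> y \<in> Ob C"
    and ten_ar: "\<lbrakk>f \<in> Hom C x x'; g \<in> Hom C y y'\<rbrakk> \<Longrightarrow> f \<oslash> g \<in> Hom C (x \<otimes> y) (x' \<otimes> y')"
    and ten_idn: "\<lbrakk>x \<in> Ob C; y \<in> Ob C\<rbrakk> \<Longrightarrow> \<one> x \<oslash> \<one> y = \<one> (x \<otimes> y)"
    and ten_cmp: "\<lbrakk>f \<in> Hom C x x'; f' \<in> Hom C x' x''; g \<in> Hom C y y'; g' \<in> Hom C y' y''\<rbrakk>
                  \<Longrightarrow> (f' \<cdot> f) \<oslash> (g' \<cdot> g) = (f' \<oslash> g') \<cdot> (f \<oslash> g)"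
    and unt: "\<I> \<in> Ob C"
    and asc: "\<lbrakk>x \<in> Ob C; y \<in> Ob C; z \<in> Ob C\<rbrakk>
              \<Longrightarrow> Asc C x y z \<in> Hom C ((x \<otimes> y) \<otimes> z) (x \<otimes> (y \<otimes> z)) \<and> iso_arr C (Asc C x y z)"
    and lun: "x \<in> Ob C \<Longrightarrow> LUn C x \<in> Hom C (\<I> \<otimes> x) x \<and> iso_arr C (LUn C x)"
    and run: "x \<in> Ob C \<Longrightarrow> RUn C x \<in> Hom C (x \<otimes> \<I>) x \<and> iso_arr C (RUn C x)"
    and sym: "\<lbrakk>x \<in> Ob C; y \<in> Ob C\<rbrakk> \<Longrightarrow> Sym C x y \<in> Hom C (x \<otimes> y) (y \<otimes> x)"
    and asc_nat: "\<lbrakk>f \<in> Hom C x x'; g \<in> Hom C y y'; h \<in> Hom C z z'\<rbrakk>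
                  \<Longrightarrow> Asc C x' y' z' \<cdot> ((f \<oslash> g) \<oslash> h) = (f \<oslash> (g \<oslash> h)) \<cdot> Asc C x y z"
    and lun_nat: "f \<in> Hom C x y \<Longrightarrow> LUn C y \<cdot> (\<one> \<I> \<oslash> f) = f \<cdot> LUn C x"
    and run_nat: "f \<in> Hom C x y \<Longrightarrow> RUn C y \<cdot> (f \<oslash> \<one> \<I>) = f \<cdot> RUn C x"
    and sym_nat: "\<lbrakk>f \<in> Hom C x x'; g \<in> Hom C y y'\<rbrakk>
                  \<Longrightarrow> Sym C x' y' \<cdot> (f \<oslash> g) = (g \<oslash> f) \<cdot> Sym C x y"
    and triangle: "\<lbrakk>x \<in> Ob C; y \<in> Ob C\<rbrakk>
                   \<Longrightarrow> (\<one> x \<oslash> LUn C y) \<cdot> Asc C x \<I> y = RUn C x \<oslash> \<one> y"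
    and pentagon: "\<lbrakk>w \<in> Ob C; x \<in> Ob C; y \<in> Ob C; z \<in> Ob C\<rbrakk>
                   \<Longrightarrow> (\<one> w \<oslash> Asc C x y z) \<cdot> Asc C w (x \<otimes> y) z \<cdot> (Asc C w x y \<oslash> \<one> z)
                       = Asc C w x (y \<otimes> z) \<cdot> Asc C (w \<otimes> x) y z"
    and lun_run: "LUn C \<I> = RUn C \<I>"
    and sym_sym: "\<lbrakk>x \<in> Ob C; y \<in> Ob C\<rbrakk> \<Longrightarrow> Sym C y x \<cdot> Sym C x y = \<one> (x \<otimes> y)"
    and sym_unt: "x \<in> Ob C \<Longrightarrow> LUn C x \<cdot> Sym C x \<I> = RUn C x"
    and hexagon: "\<lbrakk>x \<in> Ob C; y \<in> Ob C; z \<in> Ob C\<rbrakk>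
                  \<Longrightarrow> Asc C y z x \<cdot> Sym C x (y \<otimes> z) \<cdot> Asc C x y z
                      = (\<one> y \<oslash> Sym C x z) \<cdot> Asc C y x z \<cdot> (Sym C x y \<oslash> \<one> z)"

definition is_strong_symmetric_monoidal_functor ::
  "('o, 'a, 'm) smc_scheme \<Rightarrow> ('p, 'b, 'n) smc_scheme \<Rightarrow> ('o, 'a, 'p, 'b) ord_functor \<Rightarrow>
   ('o \<Rightarrow> 'o \<Rightarrow> 'b) \<Rightarrow> 'b \<Rightarrow> bool" where
  "is_strong_symmetric_monoidal_functor C D F m e \<longleftrightarrow>
     is_ord_functor C D F \<and>
     e \<in> Hom D \<I>\<^bsub>D\<^esub> (FOb F \<I>\<^bsub>C\<^esub>) \<and> iso_arr D e \<and>
     (\<forall>x\<in>Ob C. \<forall>y\<in>Ob C.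
        m x y \<in> Hom D (FOb F x \<otimes>\<^bsub>D\<^esub> FOb F y) (FOb F (x \<otimes>\<^bsub>C\<^esub> y)) \<and> iso_arr D (m x y)) \<and>
     (\<forall>x\<in>Ob C. \<forall>x'\<in>Ob C. \<forall>y\<in>Ob C. \<forall>y'\<in>Ob C. \<forall>f\<in>Hom C x x'. \<forall>g\<in>Hom C y y'.
        m x' y' \<cdot>\<^bsub>D\<^esub> (FAr F f \<oslash>\<^bsub>D\<^esub> FAr F g) = FAr F (f \<oslash>\<^bsub>C\<^esub> g) \<cdot>\<^bsub>D\<^esub> m x y) \<and>
     (\<forall>x\<in>Ob C. \<forall>y\<in>Ob C. \<forall>z\<in>Ob C.
        FAr F (Asc C x y z) \<cdot>\<^bsub>D\<^esub> m (x \<otimes>\<^bsub>C\<^esub> y) z \<cdot>\<^bsub>D\<^esub> (m x y \<oslash>\<^bsub>D\<^esub> \<one>\<^bsub>D\<^esub> (FOb F z))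
        = m x (y \<otimes>\<^bsub>C\<^esub> z) \<cdot>\<^bsub>D\<^esub> (\<one>\<^bsub>D\<^esub> (FOb F x) \<oslash>\<^bsub>D\<^esub> m y z)
            \<cdot>\<^bsub>D\<^esub> Asc D (FOb F x) (FOb F y) (FOb F z)) \<and>
     (\<forall>x\<in>Ob C. FAr F (LUn C x) \<cdot>\<^bsub>D\<^esub> m \<I>\<^bsub>C\<^esub> x \<cdot>\<^bsub>D\<^esub> (e \<oslash>\<^bsub>D\<^esub> \<one>\<^bsub>D\<^esub> (FOb F x)) = LUn D (FOb F x)) \<and>
     (\<forall>x\<in>Ob C. FAr F (RUn C x) \<cdot>\<^bsub>D\<^esub> m x \<I>\<^bsub>C\<^esub> \<cdot>\<^bsub>D\<^esub> (\<one>\<^bsub>D\<^esub> (FOb F x) \<oslash>\<^bsub>D\<^esub> e) = RUn D (FOb F x)) \<and>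
     (\<forall>x\<in>Ob C. \<forall>y\<in>Ob C.
        FAr F (Sym C x y) \<cdot>\<^bsub>D\<^esub> m x y = m y x \<cdot>\<^bsub>D\<^esub> Sym D (FOb F x) (FOb F y))"

record ('o, 'a) smcc = "('o, 'a) smc" +
  IHom :: "'o \<Rightarrow> 'o \<Rightarrow> 'o"
  Ev :: "'o \<Rightarrow> 'o \<Rightarrow> 'a"

locale symmetric_monoidal_closed_category = symmetric_monoidal_category V
  for V :: "('o, 'a, 'm) smcc_scheme" (structure) +
  assumes ihom: "\<lbrakk>y \<in> Ob V; z \<in> Ob V\<rbrakk> \<Longrightarrow> IHom V y z \<in> Ob V"
    and ev: "\<lbrakk>y \<in> Ob V; z \<in> Ob V\<rbrakk> \<Longrightarrow> Ev V y z \<in> Hom V (IHom V y z \<otimes> y) z"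
    and ev_universal: "\<lbrakk>x \<in> Ob V; y \<in> Ob V; z \<in> Ob V; f \<in> Hom V (x \<otimes> y) z\<rbrakk>
          \<Longrightarrow> \<exists>!g. g \<in> Hom V x (IHom V y z) \<and> Ev V y z \<cdot> (g \<oslash> \<one> y) = f"


section \<open>Enriched categories\<close>

record ('x, 'o, 'a) vcat =
  VOb :: "'x set"
  VHom :: "'x \<Rightarrow> 'x \<Rightarrow> 'o"
  VId :: "'x \<Rightarrow> 'a"
  VCmp :: "'x \<Rightarrow> 'x \<Rightarrow> 'x \<Rightarrow> 'a"

record ('x, 'y, 'a) vfunctor =
  fob :: "'x \<Rightarrow> 'y"
  far :: "'x \<Rightarrow> 'x \<Rightarrow> 'a"

text \<open>\<open>VCmp A x y z\<close> is the composition arrow from \<open>A(y,z) \<otimes> A(x,y)\<close> to \<open>A(x,z)\<close>, and \<open>far F x y\<close> is the arrow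
  from \<open>A(x,y)\<close> to \<open>B(Fx,Fy)\<close>.

  The data of a symmetric monoidal enriched category beyond the underlying enriched category:\<close>

record ('x, 'a) vmonoidal =
  MTen :: "('x \<times> 'x, 'x, 'a) vfunctor"
  MUnt :: "'x"
  MAsc :: "('x \<times> 'x) \<times> 'x \<Rightarrow> 'a"
  MLUn :: "'x \<Rightarrow> 'a"
  MRUn :: "'x \<Rightarrow> 'a"
  MSym :: "'x \<times> 'x \<Rightarrow> 'a"

text \<open>A class of weights is a set of pairs \<open>(B, W)\<close> with \<open>W\<close> a weight on \<open>B\<close>, that is, an enriched
  functor from the opposite of \<open>B\<close> to the base.\<close>

type_synonym ('b, 'o, 'a) weights = "(('b, 'o, 'a) vcat \<times> ('b, 'o, 'a) vfunctor) set"

text \<open>The following locale carries no assumptions: it only fixes the base of the enrichment, so that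
  the definitions below hold unconditionally.\<close>

locale enriched_over =
  fixes V :: "('o, 'a) smcc" (structure)
begin

definition is_vcat :: "('x, 'o, 'a) vcat \<Rightarrow> bool" where
  "is_vcat A \<longleftrightarrow>
     (\<forall>x\<in>VOb A. \<forall>y\<in>VOb A. VHom A x y \<in> Ob V) \<and>
     (\<forall>x\<in>VOb A. VId A x \<in> Hom V \<I> (VHom A x x)) \<and>
     (\<forall>x\<in>VOb A. \<forall>y\<in>VOb A. \<forall>z\<in>VOb A.
        VCmp A x y z \<in> Hom V (VHom A y z \<otimes> VHom A x y) (VHom A x z)) \<and>
     (\<forall>w\<in>VOb A. \<forall>x\<in>VOb A. \<forall>y\<in>VOb A. \<forall>z\<in>VOb A.
        VCmp A w x z \<cdot> (VCmp A x y z \<oslash> \<one> (VHom A w x))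
        = VCmp A w y z \<cdot> (\<one> (VHom A y z) \<oslash> VCmp A w x y)
            \<cdot> Asc V (VHom A y z) (VHom A x y) (VHom A w x)) \<and>
     (\<forall>x\<in>VOb A. \<forall>y\<in>VOb A.
        VCmp A x y y \<cdot> (VId A y \<oslash> \<one> (VHom A x y)) = LUn V (VHom A x y) \<and>
        VCmp A x x y \<cdot> (\<one> (VHom A x y) \<oslash> VId A x) = RUn V (VHom A x y))"

definition is_vfunctor ::
  "('x, 'o, 'a) vcat \<Rightarrow> ('y, 'o, 'a) vcat \<Rightarrow> ('x, 'y, 'a) vfunctor \<Rightarrow> bool" where
  "is_vfunctor A B F \<longleftrightarrow>
     (\<forall>x\<in>VOb A. fob F x \<in> VOb B) \<and>
     (\<forall>x\<in>VOb A. \<forall>y\<in>VOb A. far F x y \<in> Hom V (VHom A x y) (VHom B (fob F x) (fob F y))) \<and>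
     (\<forall>x\<in>VOb A. far F x x \<cdot> VId A x = VId B (fob F x)) \<and>
     (\<forall>x\<in>VOb A. \<forall>y\<in>VOb A. \<forall>z\<in>VOb A.
        far F x z \<cdot> VCmp A x y z
        = VCmp B (fob F x) (fob F y) (fob F z) \<cdot> (far F y z \<oslash> far F x y))"

definition fully_faithful :: "('x, 'o, 'a) vcat \<Rightarrow> ('x, 'y, 'a) vfunctor \<Rightarrow> bool" where
  "fully_faithful A F \<longleftrightarrow> (\<forall>x\<in>VOb A. \<forall>y\<in>VOb A. iso_arr V (far F x y))"

definition is_vnat ::
  "('x, 'o, 'a) vcat \<Rightarrow> ('y, 'o, 'a) vcat \<Rightarrow> ('x, 'y, 'a) vfunctor \<Rightarrow> ('x, 'y, 'a) vfunctor \<Rightarrow>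
   ('x \<Rightarrow> 'a) \<Rightarrow> bool" where
  "is_vnat A B F G t \<longleftrightarrow>
     (\<forall>x\<in>VOb A. t x \<in> Hom V \<I> (VHom B (fob F x) (fob G x))) \<and>
     (\<forall>x\<in>VOb A. \<forall>y\<in>VOb A.
        VCmp B (fob F x) (fob F y) (fob G y) \<cdot> (t y \<oslash> far F x y) \<cdot> inv (LUn V (VHom A x y))
        = VCmp B (fob F x) (fob G x) (fob G y) \<cdot> (far G x y \<oslash> t x) \<cdot> inv (RUn V (VHom A x y)))"

definition underlying :: "('x, 'o, 'a) vcat \<Rightarrow> ('x, 'x \<times> 'x \<times> 'a) category" where
  "underlying A = \<lparr>
     Ob = VOb A,
     Ar = {(x, y, f). x \<in> VOb A \<and> y \<in> VOb A \<and> f \<in> Hom V \<I> (VHom A x y)},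
     Dom = (\<lambda>(x, y, f). x),
     Cod = (\<lambda>(x, y, f). y),
     Idn = (\<lambda>x. (x, x, VId A x)),
     Cmp = (\<lambda>(y, z, g) (x, y', f). (x, z, VCmp A x y z \<cdot> (g \<oslash> f) \<cdot> inv (LUn V \<I>)))\<rparr>"

definition underlying_functor ::
  "('x, 'y, 'a) vfunctor \<Rightarrow> ('x, 'x \<times> 'x \<times> 'a, 'y, 'y \<times> 'y \<times> 'a) ord_functor" where
  "underlying_functor F = \<lparr>
     FOb = fob F,
     FAr = (\<lambda>(x, y, f). (fob F x, fob F y, far F x y \<cdot> f))\<rparr>"

definition is_vnat_iso ::
  "('x, 'o, 'a) vcat \<Rightarrow> ('y, 'o, 'a) vcat \<Rightarrow> ('x, 'y, 'a) vfunctor \<Rightarrow> ('x, 'y, 'a) vfunctor \<Rightarrow>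
   ('x \<Rightarrow> 'a) \<Rightarrow> bool" where
  "is_vnat_iso A B F G t \<longleftrightarrow>
     is_vnat A B F G t \<and> (\<forall>x\<in>VOb A. iso_arr (underlying B) (fob F x, fob G x, t x))"

definition vfunctor_id :: "('x, 'o, 'a) vcat \<Rightarrow> ('x, 'x, 'a) vfunctor" where
  "vfunctor_id A = \<lparr>fob = (\<lambda>x. x), far = (\<lambda>x y. \<one> (VHom A x y))\<rparr>"

definition vfunctor_comp ::
  "('y, 'z, 'a) vfunctor \<Rightarrow> ('x, 'y, 'a) vfunctor \<Rightarrow> ('x, 'z, 'a) vfunctor"  (infixr "\<circ>\<^sub>V" 60) where
  "G \<circ>\<^sub>V F = \<lparr>
     fob = (\<lambda>x. fob G (fob F x)),
     far = (\<lambda>x y. far G (fob F x) (fob F y) \<cdot> far F x y)\<rparr>"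


subsection \<open>The categories of enriched functors and enriched transformations\<close>

text \<open>In order that equality of functors and of transformations be equality on the objects of \<open>A\<close>, the
  functors and families of components in \<open>VCAT A B\<close> are normalised to be undefined elsewhere.\<close>

definition vrestrict :: "('x, 'o, 'a) vcat \<Rightarrow> ('x, 'y, 'a) vfunctor \<Rightarrow> ('x, 'y, 'a) vfunctor" where
  "vrestrict A F = \<lparr>
     fob = restrict (fob F) (VOb A),
     far = (\<lambda>x\<in>VOb A. \<lambda>y\<in>VOb A. far F x y)\<rparr>"

definition VCAT ::
  "('x, 'o, 'a) vcat \<Rightarrow> ('y, 'o, 'a) vcat \<Rightarrow>
   (('x, 'y, 'a) vfunctor,
    ('x, 'y, 'a) vfunctor \<times> ('x, 'y, 'a) vfunctor \<times> ('x \<Rightarrow> 'a)) category" where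
  "VCAT A B = (let F_ob = {F. is_vfunctor A B F \<and> vrestrict A F = F} in \<lparr>
     Ob = F_ob,
     Ar = {(F, G, t). F \<in> F_ob \<and> G \<in> F_ob \<and> is_vnat A B F G t \<and> t \<in> extensional (VOb A)},
     Dom = (\<lambda>(F, G, t). F),
     Cod = (\<lambda>(F, G, t). G),
     Idn = (\<lambda>F. (F, F, \<lambda>x\<in>VOb A. VId B (fob F x))),
     Cmp = (\<lambda>(G, H, s) (F, G', t).
       (F, H, \<lambda>x\<in>VOb A.
          VCmp B (fob F x) (fob G x) (fob H x) \<cdot> (s x \<oslash> t x) \<cdot> inv (LUn V \<I>)))\<rparr>)"

definition precomposition ::
  "('x, 'o, 'a) vcat \<Rightarrow> ('x, 'y, 'a) vfunctor \<Rightarrow>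
   (('y, 'z, 'a) vfunctor,
    ('y, 'z, 'a) vfunctor \<times> ('y, 'z, 'a) vfunctor \<times> ('y \<Rightarrow> 'a),
    ('x, 'z, 'a) vfunctor,
    ('x, 'z, 'a) vfunctor \<times> ('x, 'z, 'a) vfunctor \<times> ('x \<Rightarrow> 'a)) ord_functor" where
  "precomposition A F = \<lparr>
     FOb = (\<lambda>G. vrestrict A (G \<circ>\<^sub>V F)),
     FAr = (\<lambda>(G, H, t). (vrestrict A (G \<circ>\<^sub>V F), vrestrict A (H \<circ>\<^sub>V F), \<lambda>x\<in>VOb A. t (fob F x)))\<rparr>"


subsection \<open>Opposites, tensor products, and the base as an enriched category\<close>

definition vop :: "('x, 'o, 'a) vcat \<Rightarrow> ('x, 'o, 'a) vcat" where
  "vop A = \<lparr>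
     VOb = VOb A,
     VHom = (\<lambda>x y. VHom A y x),
     VId = VId A,
     VCmp = (\<lambda>x y z. VCmp A z y x \<cdot> Sym V (VHom A z y) (VHom A y x))\<rparr>"

definition vop_functor :: "('x, 'y, 'a) vfunctor \<Rightarrow> ('x, 'y, 'a) vfunctor" where
  "vop_functor F = \<lparr>fob = fob F, far = (\<lambda>x y. far F y x)\<rparr>"

text \<open>The interchange isomorphism from \<open>(w \<otimes> x) \<otimes> (y \<otimes> z)\<close> to \<open>(w \<otimes> y) \<otimes> (x \<otimes> z)\<close>:\<close>

definition interchange :: "'o \<Rightarrow> 'o \<Rightarrow> 'o \<Rightarrow> 'o \<Rightarrow> 'a" where
  "interchange w x y z =
     inv (Asc V w y (x \<otimes> z))
     \<cdot> (\<one> w \<oslash> (Asc V y x z \<cdot> (Sym V x y \<oslash> \<one> z) \<cdot> inv (Asc V x y z)))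
     \<cdot> Asc V w x (y \<otimes> z)"

definition vtensor :: "('x, 'o, 'a) vcat \<Rightarrow> ('y, 'o, 'a) vcat \<Rightarrow> ('x \<times> 'y, 'o, 'a) vcat"
    (infixl "\<otimes>\<^sub>V" 70) where
  "A \<otimes>\<^sub>V B = \<lparr>
     VOb = VOb A \<times> VOb B,
     VHom = (\<lambda>(a, b) (a', b'). VHom A a a' \<otimes> VHom B b b'),
     VId = (\<lambda>(a, b). (VId A a \<oslash> VId B b) \<cdot> inv (LUn V \<I>)),
     VCmp = (\<lambda>(a, b) (a', b') (a'', b'').
       (VCmp A a a' a'' \<oslash> VCmp B b b' b'')
       \<cdot> interchange (VHom A a' a'') (VHom B b' b'') (VHom A a a') (VHom B b b'))\<rparr>"

definition vtensor_functor ::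
  "('x, 'y, 'a) vfunctor \<Rightarrow> ('z, 'w, 'a) vfunctor \<Rightarrow> ('x \<times> 'z, 'y \<times> 'w, 'a) vfunctor" where
  "vtensor_functor F G = \<lparr>
     fob = (\<lambda>(a, b). (fob F a, fob G b)),
     far = (\<lambda>(a, b) (a', b'). far F a a' \<oslash> far G b b')\<rparr>"

definition vassoc_functor ::
  "('x, 'o, 'a) vcat \<Rightarrow> ('y, 'o, 'a) vcat \<Rightarrow> ('z, 'o, 'a) vcat \<Rightarrow>
   (('x \<times> 'y) \<times> 'z, 'x \<times> ('y \<times> 'z), 'a) vfunctor" where
  "vassoc_functor A B C = \<lparr>
     fob = (\<lambda>((a, b), c). (a, (b, c))),
     far = (\<lambda>((a, b), c) ((a', b'), c'). Asc V (VHom A a a') (VHom B b b') (VHom C c c'))\<rparr>"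

definition vswap_functor ::
  "('x, 'o, 'a) vcat \<Rightarrow> ('y, 'o, 'a) vcat \<Rightarrow> ('x \<times> 'y, 'y \<times> 'x, 'a) vfunctor" where
  "vswap_functor A B = \<lparr>
     fob = (\<lambda>(a, b). (b, a)),
     far = (\<lambda>(a, b) (a', b'). Sym V (VHom A a a') (VHom B b b'))\<rparr>"

definition vpair_left ::
  "('x, 'o, 'a) vcat \<Rightarrow> ('y, 'o, 'a) vcat \<Rightarrow> 'x \<Rightarrow> ('y, 'x \<times> 'y, 'a) vfunctor" where
  "vpair_left A B u = \<lparr>
     fob = (\<lambda>b. (u, b)),
     far = (\<lambda>b b'. (VId A u \<oslash> \<one> (VHom B b b')) \<cdot> inv (LUn V (VHom B b b')))\<rparr>"

definition vpair_right ::
  "('x, 'o, 'a) vcat \<Rightarrow> ('y, 'o, 'a) vcat \<Rightarrow> 'y \<Rightarrow> ('x, 'x \<times> 'y, 'a) vfunctor" where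
  "vpair_right A B u = \<lparr>
     fob = (\<lambda>a. (a, u)),
     far = (\<lambda>a a'. (\<one> (VHom A a a') \<oslash> VId B u) \<cdot> inv (RUn V (VHom A a a')))\<rparr>"

text \<open>\<open>Curry x y f\<close> is the transpose \<open>x \<rightarrow> [y,z]\<close> of an arrow \<open>f\<close> from \<open>x \<otimes> y\<close> to \<open>z\<close>, and \<open>name f\<close> is the
  element \<open>I \<rightarrow> [x,y]\<close> corresponding to \<open>f : x \<rightarrow> y\<close>.\<close>

definition Curry :: "'o \<Rightarrow> 'o \<Rightarrow> 'a \<Rightarrow> 'a" where
  "Curry x y f =
     (THE g. g \<in> Hom V x (IHom V y (Cod V f)) \<and> Ev V y (Cod V f) \<cdot> (g \<oslash> \<one> y) = f)"

definition name :: "'a \<Rightarrow> 'a" where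
  "name f = Curry \<I> (Dom V f) (f \<cdot> LUn V (Dom V f))"

definition self :: "('o, 'o, 'a) vcat"  ("\<V>") where
  "\<V> = \<lparr>
     VOb = Ob V,
     VHom = IHom V,
     VId = (\<lambda>x. name (\<one> x)),
     VCmp = (\<lambda>x y z. Curry (IHom V y z \<otimes> IHom V x y) x
               (Ev V y z \<cdot> (\<one> (IHom V y z) \<oslash> Ev V x y) \<cdot> Asc V (IHom V y z) (IHom V x y) x))\<rparr>"

definition self_monoidal :: "('o, 'a) vmonoidal" where
  "self_monoidal = \<lparr>
     MTen = \<lparr>
       fob = (\<lambda>(x, y). x \<otimes> y),
       far = (\<lambda>(x, y) (x', y').
         Curry (IHom V x x' \<otimes> IHom V y y') (x \<otimes> y)
           ((Ev V x x' \<oslash> Ev V y y') \<cdot> interchange (IHom V x x') (IHom V y y') x y))\<rparr>,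
     MUnt = \<I>,
     MAsc = (\<lambda>((x, y), z). name (Asc V x y z)),
     MLUn = (\<lambda>x. name (LUn V x)),
     MRUn = (\<lambda>x. name (RUn V x)),
     MSym = (\<lambda>(x, y). name (Sym V x y))\<rparr>"


subsection \<open>Symmetric monoidal enriched categories and systems of arities\<close>

definition underlying_smc :: "('x, 'o, 'a) vcat \<Rightarrow> ('x, 'a) vmonoidal \<Rightarrow> ('x, 'x \<times> 'x \<times> 'a) smc" where
  "underlying_smc A M = (let ten = (\<lambda>x y. fob (MTen M) (x, y)) in \<lparr>
     Ob = Ob (underlying A), Ar = Ar (underlying A),
     Dom = Dom (underlying A), Cod = Cod (underlying A),
     Idn = Idn (underlying A), Cmp = Cmp (underlying A),
     Ten = ten,
     TenA = (\<lambda>(x, x', f) (y, y', g).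
       (ten x y, ten x' y', far (MTen M) (x, y) (x', y') \<cdot> (f \<oslash> g) \<cdot> inv (LUn V \<I>))),
     Unt = MUnt M,
     Asc = (\<lambda>x y z. (ten (ten x y) z, ten x (ten y z), MAsc M ((x, y), z))),
     LUn = (\<lambda>x. (ten (MUnt M) x, x, MLUn M x)),
     RUn = (\<lambda>x. (ten x (MUnt M), x, MRUn M x)),
     Sym = (\<lambda>x y. (ten x y, ten y x, MSym M (x, y)))\<rparr>)"

text \<open>The coherence diagrams for a symmetric monoidal enriched category and for a strong symmetric
  monoidal enriched functor are diagrams in the underlying ordinary categories.\<close>

definition is_symmetric_monoidal_vcat :: "('x, 'o, 'a) vcat \<Rightarrow> ('x, 'a) vmonoidal \<Rightarrow> bool" where
  "is_symmetric_monoidal_vcat A M \<longleftrightarrow>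
     is_vcat A \<and>
     MUnt M \<in> VOb A \<and>
     is_vfunctor (A \<otimes>\<^sub>V A) A (MTen M) \<and>
     is_vnat_iso ((A \<otimes>\<^sub>V A) \<otimes>\<^sub>V A) A
       (MTen M \<circ>\<^sub>V vtensor_functor (MTen M) (vfunctor_id A))
       (MTen M \<circ>\<^sub>V vtensor_functor (vfunctor_id A) (MTen M) \<circ>\<^sub>V vassoc_functor A A A)
       (MAsc M) \<and>
     is_vnat_iso A A (MTen M \<circ>\<^sub>V vpair_left A A (MUnt M)) (vfunctor_id A) (MLUn M) \<and>
     is_vnat_iso A A (MTen M \<circ>\<^sub>V vpair_right A A (MUnt M)) (vfunctor_id A) (MRUn M) \<and>
     is_vnat_iso (A \<otimes>\<^sub>V A) A (MTen M) (MTen M \<circ>\<^sub>V vswap_functor A A) (MSym M) \<and>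
     symmetric_monoidal_category (underlying_smc A M)"

definition is_strong_symmetric_monoidal_vfunctor ::
  "('x, 'o, 'a) vcat \<Rightarrow> ('x, 'a) vmonoidal \<Rightarrow> ('y, 'o, 'a) vcat \<Rightarrow> ('y, 'a) vmonoidal \<Rightarrow>
   ('x, 'y, 'a) vfunctor \<Rightarrow> ('x \<times> 'x \<Rightarrow> 'a) \<Rightarrow> 'a \<Rightarrow> bool" where
  "is_strong_symmetric_monoidal_vfunctor A M B N F m e \<longleftrightarrow>
     is_vfunctor A B F \<and>
     is_vnat_iso (A \<otimes>\<^sub>V A) B (MTen N \<circ>\<^sub>V vtensor_functor F F) (F \<circ>\<^sub>V MTen M) m \<and>
     is_strong_symmetric_monoidal_functor (underlying_smc A M) (underlying_smc B N)
       (underlying_functor F)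
       (\<lambda>x y. (fob (MTen N) (fob F x, fob F y), fob F (fob (MTen M) (x, y)), m (x, y)))
       (MUnt N, fob F (MUnt M), e)"

text \<open>The monoidal structure of \<open>j\<close> is given by \<open>m\<close>, with components \<open>jx \<otimes> jy \<rightarrow> j(x \<otimes> y)\<close>, and
  by \<open>e : I \<rightarrow> jI\<close>.\<close>

definition system_of_arities ::
  "('x, 'o, 'a) vcat \<Rightarrow> ('x, 'a) vmonoidal \<Rightarrow> ('x, 'o, 'a) vfunctor \<Rightarrow> ('x \<times> 'x \<Rightarrow> 'a) \<Rightarrow> 'a \<Rightarrow> bool"
  where
  "system_of_arities J M j m e \<longleftrightarrow>
     is_symmetric_monoidal_vcat J M \<and>
     is_strong_symmetric_monoidal_vfunctor J M \<V> self_monoidal j m e \<and>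
     fully_faithful J j"


subsection \<open>Weighted colimits\<close>

text \<open>\<open>covariant_hom C c\<close> is \<open>C(c,-)\<close>, and \<open>contravariant_hom C c\<close> is \<open>C(-,c)\<close>, a functor on the opposite of \<open>C\<close>.\<close>

definition covariant_hom :: "('x, 'o, 'a) vcat \<Rightarrow> 'x \<Rightarrow> ('x, 'o, 'a) vfunctor" where
  "covariant_hom C c = \<lparr>
     fob = (\<lambda>x. VHom C c x),
     far = (\<lambda>x y. Curry (VHom C x y) (VHom C c x) (VCmp C c x y))\<rparr>"

definition contravariant_hom :: "('x, 'o, 'a) vcat \<Rightarrow> 'x \<Rightarrow> ('x, 'o, 'a) vfunctor" where
  "contravariant_hom C c = \<lparr>
     fob = (\<lambda>x. VHom C x c),
     far = (\<lambda>x y. Curry (VHom C y x) (VHom C x c)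
                     (VCmp C y x c \<cdot> Sym V (VHom C y x) (VHom C x c)))\<rparr>"

text \<open>\<open>C(D-,c)\<close> for \<open>D : B \<rightarrow> C\<close>:\<close>

definition hom_along :: "('y, 'o, 'a) vcat \<Rightarrow> ('x, 'y, 'a) vfunctor \<Rightarrow> 'y \<Rightarrow> ('x, 'o, 'a) vfunctor" where
  "hom_along C D c = contravariant_hom C c \<circ>\<^sub>V vop_functor D"

text \<open>As the base need not be complete, objects of enriched transformations need not exist. A
  transformation from \<open>F\<close> to \<open>G\<close> indexed by \<open>k\<close> is a family of arrows \<open>E a : k \<rightarrow> B(Fa,Ga)\<close> that is
  extraordinarily natural in \<open>a\<close>; the object of transformations, that is, the end of \<open>B(Fa,Ga)\<close>, is a
  universal such family.\<close>

definition indexed_vnat ::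
  "('x, 'o, 'a) vcat \<Rightarrow> ('y, 'o, 'a) vcat \<Rightarrow> ('x, 'y, 'a) vfunctor \<Rightarrow> ('x, 'y, 'a) vfunctor \<Rightarrow>
   'o \<Rightarrow> ('x \<Rightarrow> 'a) \<Rightarrow> bool" where
  "indexed_vnat A B F G k E \<longleftrightarrow>
     (\<forall>a\<in>VOb A. E a \<in> Hom V k (VHom B (fob F a) (fob G a))) \<and>
     (\<forall>a\<in>VOb A. \<forall>b\<in>VOb A.
        VCmp B (fob F a) (fob G a) (fob G b) \<cdot> (far G a b \<oslash> E a)
        = VCmp B (fob F a) (fob F b) (fob G b) \<cdot> (E b \<oslash> far F a b) \<cdot> Sym V (VHom A a b) k)"

definition is_object_of_vnats ::
  "('x, 'o, 'a) vcat \<Rightarrow> ('y, 'o, 'a) vcat \<Rightarrow> ('x, 'y, 'a) vfunctor \<Rightarrow> ('x, 'y, 'a) vfunctor \<Rightarrow>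
   'o \<Rightarrow> ('x \<Rightarrow> 'a) \<Rightarrow> bool" where
  "is_object_of_vnats A B F G k E \<longleftrightarrow>
     k \<in> Ob V \<and> indexed_vnat A B F G k E \<and>
     (\<forall>l\<in>Ob V. \<forall>T. indexed_vnat A B F G l T \<longrightarrow>
        (\<exists>!f. f \<in> Hom V l k \<and> (\<forall>a\<in>VOb A. E a \<cdot> f = T a)))"

text \<open>The pair \<open>(c, u)\<close> is a colimit of \<open>D : B \<rightarrow> C\<close> weighted by \<open>W\<close> if the cylinder \<open>u : W \<rightarrow> C(D-,c)\<close> induces for
  each \<open>x\<close> an identification of \<open>C(c,x)\<close> with the object of transformations from \<open>W\<close> to \<open>C(D-,x)\<close>.
  The induced arrow from \<open>C(c,x)\<close> to \<open>[Wb, C(Db,x)]\<close> is \<open>C(Db,-)\<close> followed by composition with \<open>u b\<close>.\<close>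

definition is_weighted_colimit ::
  "('x, 'o, 'a) vcat \<Rightarrow> ('x, 'o, 'a) vfunctor \<Rightarrow> ('y, 'o, 'a) vcat \<Rightarrow> ('x, 'y, 'a) vfunctor \<Rightarrow>
   'y \<Rightarrow> ('x \<Rightarrow> 'a) \<Rightarrow> bool" where
  "is_weighted_colimit B W C D c u \<longleftrightarrow>
     c \<in> VOb C \<and>
     is_vnat (vop B) \<V> W (hom_along C D c) u \<and>
     (\<forall>x\<in>VOb C. is_object_of_vnats (vop B) \<V> W (hom_along C D x) (VHom C c x)
        (\<lambda>b. VCmp \<V> (fob W b) (VHom C (fob D b) c) (VHom C (fob D b) x)
              \<cdot> (far (covariant_hom C (fob D b)) c x \<oslash> u b) \<cdot> inv (RUn V (VHom C c x))))"

text \<open>\<open>F\<close> takes a cylinder \<open>u\<close> to the composite of \<open>u b : I \<rightarrow> [Wb, C(Db,c)]\<close> with \<open>[Wb, F]\<close>, where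
  \<open>ihom_map w f = [w, f]\<close>.\<close>

definition ihom_map :: "'o \<Rightarrow> 'a \<Rightarrow> 'a" where
  "ihom_map w f = Curry (IHom V w (Dom V f)) w (f \<cdot> Ev V w (Dom V f))"

definition preserves_colimits ::
  "('x, 'o, 'a) vcat \<Rightarrow> ('x, 'o, 'a) vfunctor \<Rightarrow> ('y, 'o, 'a) vcat \<Rightarrow> ('z, 'o, 'a) vcat \<Rightarrow>
   ('y, 'z, 'a) vfunctor \<Rightarrow> bool" where
  "preserves_colimits B W C E F \<longleftrightarrow>
     (\<forall>D c u. is_vfunctor B C D \<and> is_weighted_colimit B W C D c u \<longrightarrow>
        is_weighted_colimit B W E (F \<circ>\<^sub>V D) (fob F c)
          (\<lambda>b. ihom_map (fob W b) (far F (fob D b) c) \<cdot> u b))"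


subsection \<open>Free cocompletions\<close>

definition has_colimits ::
  "('b, 'o, 'a) weights \<Rightarrow> ('y, 'o, 'a) vcat \<Rightarrow> bool" where
  "has_colimits \<Phi> C \<longleftrightarrow>
     (\<forall>(B, W)\<in>\<Phi>. \<forall>D. is_vfunctor B C D \<longrightarrow> (\<exists>c u. is_weighted_colimit B W C D c u))"

definition cocontinuous ::
  "('b, 'o, 'a) weights \<Rightarrow> ('y, 'o, 'a) vcat \<Rightarrow> ('z, 'o, 'a) vcat \<Rightarrow> ('y, 'z, 'a) vfunctor \<Rightarrow> bool" where
  "cocontinuous \<Phi> C E F \<longleftrightarrow> (\<forall>(B, W)\<in>\<Phi>. preserves_colimits B W C E F)"

definition Cocts ::
  "('b, 'o, 'a) weights \<Rightarrow> ('y, 'o, 'a) vcat \<Rightarrow> ('z, 'o, 'a) vcat \<Rightarrow>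
   (('y, 'z, 'a) vfunctor,
    ('y, 'z, 'a) vfunctor \<times> ('y, 'z, 'a) vfunctor \<times> ('y \<Rightarrow> 'a)) category" where
  "Cocts \<Phi> C E = full_subcategory (VCAT C E) {F. cocontinuous \<Phi> C E F}"

text \<open>The type argument is the type of the objects of the enriched categories against which the
  universal property is tested.\<close>

definition presents_free_cocompletion ::
  "'c itself \<Rightarrow> ('b, 'o, 'a) weights \<Rightarrow> ('x, 'o, 'a) vcat \<Rightarrow> ('y, 'o, 'a) vcat \<Rightarrow>
   ('x, 'y, 'a) vfunctor \<Rightarrow> bool" where
  "presents_free_cocompletion (_ :: 'c itself) \<Phi> A B F \<longleftrightarrow>
     has_colimits \<Phi> B \<and>
     (\<forall>C :: ('c, 'o, 'a) vcat. is_vcat C \<and> has_colimits \<Phi> C \<longrightarrow>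
        is_equivalence (Cocts \<Phi> B C) (VCAT A C) (precomposition A F))"


subsection \<open>Eleutheric systems of arities\<close>

definition Kan_weight :: "('x, 'o, 'a) vfunctor \<Rightarrow> 'o \<Rightarrow> ('x, 'o, 'a) vfunctor" where
  "Kan_weight j v = hom_along \<V> j v"

definition Kan_weights :: "('x, 'o, 'a) vcat \<Rightarrow> ('x, 'o, 'a) vfunctor \<Rightarrow> ('x, 'o, 'a) weights" where
  "Kan_weights J j = {(J, Kan_weight j v) | v. v \<in> Ob V}"

definition flat ::
  "('x, 'o, 'a) vcat \<Rightarrow> ('x, 'o, 'a) vfunctor \<Rightarrow> ('b, 'o, 'a) vcat \<Rightarrow> ('b, 'o, 'a) vfunctor \<Rightarrow> bool" where
  "flat J j B W \<longleftrightarrow>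
     (\<forall>x\<in>VOb J. preserves_colimits B W \<V> \<V> (covariant_hom \<V> (fob j x)))"

definition eleutheric :: "('x, 'o, 'a) vcat \<Rightarrow> ('x, 'o, 'a) vfunctor \<Rightarrow> bool" where
  "eleutheric J j \<longleftrightarrow>
     has_colimits (Kan_weights J j) \<V> \<and> (\<forall>(B, W)\<in>Kan_weights J j. flat J j B W)"

end

end

theory Submission
  imports Defs
begin

text \<open>Write \<open>y v\<close> for the Kan weight \<open>V(j-,v)\<close> and \<open>J\<close> for the domain of \<open>j\<close>. Since \<open>j\<close> is fully faithful and
  its image contains the unit \<open>I\<close> up to isomorphism, every object \<open>v\<close> is the colimit of \<open>j\<close> weighted by
  \<open>y v\<close> (\<open>density\<close>): an element of \<open>v\<close> is the same as an element of \<open>V(jU,v)\<close> when \<open>jU\<close> is isomorphic to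
  \<open>I\<close>, so a cocone on \<open>j\<close> is determined by its component at \<open>U\<close>. A functor \<open>F\<close> on the base that preserves
  these colimits is therefore the left Kan extension of its restriction to \<open>J\<close>, and transformations from
  \<open>F\<close> to any other functor correspond to transformations between the restrictions (\<open>restriction_full\<close>,
  \<open>restriction_faithful\<close>).

  Let \<open>j\<close> be eleutheric and \<open>C\<close> have the colimits in question. For \<open>P : J \<rightarrow> C\<close> the colimits
  \<open>y v \<star> P\<close> are the values of a functor \<open>L\<close> (\<open>Lan_functor\<close>), and \<open>L\<close> extends \<open>P\<close> because \<open>j\<close> is fully
  faithful (\<open>Lan_unit\<close>). Flatness enters when one shows that \<open>L\<close> is cocontinuous
  (\<open>Lan_preserving\<close>): for \<open>d = y v \<star> D\<close> it says that \<open>V(ja,d)\<close> is \<open>y v \<star> V(ja,D-)\<close>, so that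
  \<open>L d = y d \<star> P\<close> is \<open>(y v \<star> V(j-,D)) \<star> P = y v \<star> (V(j-,D) \<star> P) = y v \<star> L D\<close>. Thus restriction along \<open>j\<close> is
  essentially surjective on cocontinuous functors, and it is fully faithful by the first paragraph.

  Conversely, let \<open>j\<close> present the base as a free cocompletion, and apply the universal property with the
  base itself as the target, relabelled so that its objects have the type over which the property
  quantifies. For \<open>a\<close> in \<open>J\<close> and \<open>H = V(ja,-)\<close> it yields a cocontinuous functor \<open>F\<close> whose restriction
  is isomorphic to that of \<open>H\<close>. The isomorphism extends to \<open>t : F \<rightarrow> H\<close> because \<open>F\<close> is a Kan extension.
  Its inverse at \<open>a\<close> sends the identity of \<open>ja\<close> to an element of \<open>F(ja)\<close>, which by the Yoneda lemma
  determines \<open>s : H \<rightarrow> F\<close>. The composite \<open>t s\<close> is the identity by the Yoneda lemma, and \<open>s t\<close> is the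
  identity because it is so on \<open>J\<close>. Hence \<open>H\<close> is isomorphic to \<open>F\<close> and cocontinuous, which is
  flatness (\<open>flat_if_extends\<close>).

  The base is not strict, and the definitions involve associativities, unit isomorphisms and symmetries.
  To keep them out of these arguments, everything is expressed through elements of an object \<open>x\<close> in a
  context, that is, arrows to \<open>x\<close> from a tensor product of a list of objects. Contexts are concatenated
  when elements are composed, so that composition of elements in an enriched category is strictly
  associative and unital. A cocone is then a family of maps of elements \<open>w : jb \<rightarrow> v\<close> to
  elements \<open>r w : Db \<rightarrow> c\<close> with \<open>r (w \<cdot> jf) = r w \<cdot> Df\<close>, in which no symmetry appears
  (\<open>transpose_naturality\<close>, \<open>weighted_colimit_iff\<close>).\<close>

section \<open>Arrows of the base\<close>

locale smcc = symmetric_monoidal_closed_category V + enriched_over V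
  for V :: "('o, 'a) smcc" (structure)
begin

lemma in_Hom: "f \<in> Hom V x y \<longleftrightarrow> f \<in> Ar V \<and> Dom V f = x \<and> Cod V f = y"
  by (auto simp: Hom_def)

lemma ar_ob [simp]: "f \<in> Ar V \<Longrightarrow> Dom V f \<in> Ob V" "f \<in> Ar V \<Longrightarrow> Cod V f \<in> Ob V"
  using dom_cod by auto

lemma Hom_ob: "f \<in> Hom V x y \<Longrightarrow> x \<in> Ob V \<and> y \<in> Ob V"
  by (auto simp: in_Hom)

lemma idn_ar [simp]:
  "x \<in> Ob V \<Longrightarrow> \<one> x \<in> Ar V" "x \<in> Ob V \<Longrightarrow> Dom V (\<one> x) = x" "x \<in> Ob V \<Longrightarrow> Cod V (\<one> x) = x"
  using idn by (auto simp: in_Hom)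

lemma cmp_ar [simp]:
  assumes "f \<in> Ar V" "g \<in> Ar V" "Dom V g = Cod V f"
  shows "g \<cdot> f \<in> Ar V" "Dom V (g \<cdot> f) = Dom V f" "Cod V (g \<cdot> f) = Cod V g"
  using cmp[of f "Dom V f" "Cod V f" g "Cod V g"] assms by (auto simp: in_Hom)

lemma assoc [simp]:
  assumes "f \<in> Ar V" "g \<in> Ar V" "h \<in> Ar V" "Dom V g = Cod V f" "Dom V h = Cod V g"
  shows "(h \<cdot> g) \<cdot> f = h \<cdot> (g \<cdot> f)"
  using cmp_assoc[of f "Dom V f" "Cod V f" g "Cod V g" h "Cod V h"] assms by (auto simp: in_Hom)

lemma idn_cmp [simp]:
  "f \<in> Ar V \<Longrightarrow> Cod V f = y \<Longrightarrow> \<one> y \<cdot> f = f" "f \<in> Ar V \<Longrightarrow> Dom V f = x \<Longrightarrow> f \<cdot> \<one> x = f"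
  using idn_left[of f "Dom V f" "Cod V f"] idn_right[of f "Dom V f" "Cod V f"] by (auto simp: in_Hom)

lemma ten_ob' [simp]: "x \<in> Ob V \<Longrightarrow> y \<in> Ob V \<Longrightarrow> x \<otimes> y \<in> Ob V"
  by (rule ten_ob)

lemma unt' [simp]: "\<I> \<in> Ob V"
  by (rule unt)

lemma ten_ar' [simp]:
  assumes "f \<in> Ar V" "g \<in> Ar V"
  shows "f \<oslash> g \<in> Ar V" "Dom V (f \<oslash> g) = Dom V f \<otimes> Dom V g" "Cod V (f \<oslash> g) = Cod V f \<otimes> Cod V g"
  using ten_ar[of f "Dom V f" "Cod V f" g "Dom V g" "Cod V g"] assms by (auto simp: in_Hom)

lemma ten_idn' [simp]: "x \<in> Ob V \<Longrightarrow> y \<in> Ob V \<Longrightarrow> \<one> x \<oslash> \<one> y = \<one> (x \<otimes> y)"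
  by (rule ten_idn)

lemma ten_merge [simp]:
  assumes "f \<in> Ar V" "g \<in> Ar V" "f' \<in> Ar V" "g' \<in> Ar V" "Dom V f' = Cod V f" "Dom V g' = Cod V g"
  shows "(f' \<oslash> g') \<cdot> (f \<oslash> g) = (f' \<cdot> f) \<oslash> (g' \<cdot> g)"
  using ten_cmp[of f "Dom V f" "Cod V f" f' "Cod V f'" g "Dom V g" "Cod V g" g' "Cod V g'"] assms
  by (auto simp: in_Hom)

text \<open>The form of \<open>ten_merge\<close> that applies inside composites nested to the right.\<close>

lemma ten_merge2 [simp]:
  assumes "f \<in> Ar V" "g \<in> Ar V" "f' \<in> Ar V" "g' \<in> Ar V" "Dom V f' = Cod V f" "Dom V g' = Cod V g"
    and "h \<in> Ar V" "Cod V h = Dom V f \<otimes> Dom V g"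
  shows "(f' \<oslash> g') \<cdot> (f \<oslash> g) \<cdot> h = ((f' \<cdot> f) \<oslash> (g' \<cdot> g)) \<cdot> h"
  using assms by (subst assoc[symmetric]) auto

lemma asc_ar [simp]:
  assumes "x \<in> Ob V" "y \<in> Ob V" "z \<in> Ob V"
  shows "Asc V x y z \<in> Ar V" "Dom V (Asc V x y z) = (x \<otimes> y) \<otimes> z" "Cod V (Asc V x y z) = x \<otimes> (y \<otimes> z)"
    "iso_arr V (Asc V x y z)"
  using asc assms by (auto simp: in_Hom)

lemma lun_ar [simp]:
  assumes "x \<in> Ob V"
  shows "LUn V x \<in> Ar V" "Dom V (LUn V x) = \<I> \<otimes> x" "Cod V (LUn V x) = x" "iso_arr V (LUn V x)"
  using lun assms by (auto simp: in_Hom)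

lemma run_ar [simp]:
  assumes "x \<in> Ob V"
  shows "RUn V x \<in> Ar V" "Dom V (RUn V x) = x \<otimes> \<I>" "Cod V (RUn V x) = x" "iso_arr V (RUn V x)"
  using run assms by (auto simp: in_Hom)

lemma sym_ar [simp]:
  assumes "x \<in> Ob V" "y \<in> Ob V"
  shows "Sym V x y \<in> Ar V" "Dom V (Sym V x y) = x \<otimes> y" "Cod V (Sym V x y) = y \<otimes> x"
  using sym assms by (auto simp: in_Hom)

lemma ihom_ob [simp]: "x \<in> Ob V \<Longrightarrow> y \<in> Ob V \<Longrightarrow> IHom V x y \<in> Ob V"
  by (rule ihom)

lemma ev_ar [simp]:
  assumes "x \<in> Ob V" "y \<in> Ob V"
  shows "Ev V x y \<in> Ar V" "Dom V (Ev V x y) = IHom V x y \<otimes> x" "Cod V (Ev V x y) = y"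
  using ev assms by (auto simp: in_Hom)

lemma inverse_arrows_unique:
  assumes "inverse_arrows V f g" "inverse_arrows V f g'" shows "g = g'"
proof -
  have "g = g \<cdot> (f \<cdot> g')" using assms by (auto simp: inverse_arrows_def in_Hom)
  also have "\<dots> = (g \<cdot> f) \<cdot> g'" using assms by (subst assoc) (auto simp: inverse_arrows_def in_Hom)
  also have "\<dots> = g'" using assms by (auto simp: inverse_arrows_def in_Hom)
  finally show ?thesis .
qed

lemma inverse_arrows_inv:
  assumes "iso_arr V f" shows "inverse_arrows V f (inv f)"
  using assms inverse_arrows_unique unfolding iso_arr_def inverse_arr_def by (metis theI')

lemma inv_ar [simp]:
  assumes "iso_arr V f"
  shows "inv f \<in> Ar V" "Dom V (inv f) = Cod V f" "Cod V (inv f) = Dom V f"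
    "inv f \<cdot> f = \<one> (Dom V f)" "f \<cdot> inv f = \<one> (Cod V f)"
  using inverse_arrows_inv[OF assms] by (auto simp: inverse_arrows_def in_Hom)

lemma iso_arr_ar: "iso_arr V f \<Longrightarrow> f \<in> Ar V"
  by (auto simp: iso_arr_def inverse_arrows_def)

lemma inv_cancel [simp]:
  assumes "iso_arr V f" "h \<in> Ar V"
  shows "Cod V h = Dom V f \<Longrightarrow> inv f \<cdot> f \<cdot> h = h" "Cod V h = Cod V f \<Longrightarrow> f \<cdot> inv f \<cdot> h = h"
  using assms iso_arr_ar[OF assms(1)] by (simp_all add: assoc[symmetric] del: assoc)

lemma iso_cmp [simp]:
  assumes "iso_arr V f" "iso_arr V g" "Dom V g = Cod V f" shows "iso_arr V (g \<cdot> f)"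
  using assms iso_arr_ar[OF assms(1)] iso_arr_ar[OF assms(2)] unfolding iso_arr_def[of _ "g \<cdot> f"] inverse_arrows_def
  by (intro exI[of _ "inv f \<cdot> inv g"]) (simp add: in_Hom)

lemma iso_ten [simp]:
  assumes "iso_arr V f" "iso_arr V g" shows "iso_arr V (f \<oslash> g)"
  using assms iso_arr_ar[OF assms(1)] iso_arr_ar[OF assms(2)] unfolding iso_arr_def[of _ "f \<oslash> g"] inverse_arrows_def
  by (intro exI[of _ "inv f \<oslash> inv g"]) (simp add: in_Hom)

lemma iso_idn [simp]: "x \<in> Ob V \<Longrightarrow> iso_arr V (\<one> x)"
  unfolding iso_arr_def inverse_arrows_def by (intro exI[of _ "\<one> x"]) (simp add: in_Hom)

lemma iso_inv [simp]: "iso_arr V f \<Longrightarrow> iso_arr V (inv f)"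
  using iso_arr_ar[of f] unfolding iso_arr_def[of _ "inv f"] inverse_arrows_def
  by (intro exI[of _ f]) (simp add: in_Hom)

lemma iso_epi:
  assumes "iso_arr V r" "f \<in> Ar V" "g \<in> Ar V" "Dom V f = Cod V r" "Dom V g = Cod V r" "f \<cdot> r = g \<cdot> r"
  shows "f = g"
proof -
  have "(f \<cdot> r) \<cdot> inv r = (g \<cdot> r) \<cdot> inv r" using assms by simp
  then show ?thesis using assms(1-5) iso_arr_ar[OF assms(1)] by simp
qed

lemma iso_mono:
  assumes "iso_arr V r" "f \<in> Ar V" "g \<in> Ar V" "Cod V f = Dom V r" "Cod V g = Dom V r" "r \<cdot> f = r \<cdot> g"
  shows "f = g"
proof -
  have "inv r \<cdot> (r \<cdot> f) = inv r \<cdot> (r \<cdot> g)" using assms by simp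
  then show ?thesis using assms(1-5) iso_arr_ar[OF assms(1)] by simp
qed

lemma iso_sym [simp]: "x \<in> Ob V \<Longrightarrow> y \<in> Ob V \<Longrightarrow> iso_arr V (Sym V x y)"
  unfolding iso_arr_def inverse_arrows_def by (intro exI[of _ "Sym V y x"]) (simp add: in_Hom sym_sym)

lemma nat_asc:
  assumes "f \<in> Ar V" "g \<in> Ar V" "h \<in> Ar V" "x = Cod V f" "y = Cod V g" "z = Cod V h"
  shows "Asc V x y z \<cdot> ((f \<oslash> g) \<oslash> h) = (f \<oslash> (g \<oslash> h)) \<cdot> Asc V (Dom V f) (Dom V g) (Dom V h)"
  using asc_nat[of f "Dom V f" "Cod V f" g "Dom V g" "Cod V g" h "Dom V h" "Cod V h"] assms
  by (auto simp: in_Hom)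

lemma nat_lun: "f \<in> Ar V \<Longrightarrow> LUn V (Cod V f) \<cdot> (\<one> \<I> \<oslash> f) = f \<cdot> LUn V (Dom V f)"
  using lun_nat[of f "Dom V f" "Cod V f"] by (auto simp: in_Hom)

lemma nat_run: "f \<in> Ar V \<Longrightarrow> RUn V (Cod V f) \<cdot> (f \<oslash> \<one> \<I>) = f \<cdot> RUn V (Dom V f)"
  using run_nat[of f "Dom V f" "Cod V f"] by (auto simp: in_Hom)

lemma nat_sym:
  "f \<in> Ar V \<Longrightarrow> g \<in> Ar V \<Longrightarrow> Sym V (Cod V f) (Cod V g) \<cdot> (f \<oslash> g) = (g \<oslash> f) \<cdot> Sym V (Dom V f) (Dom V g)"
  using sym_nat[of f "Dom V f" "Cod V f" g "Dom V g" "Cod V g"] by (auto simp: in_Hom)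

lemma nat_inv_lun:
  assumes "f \<in> Ar V" shows "inv (LUn V (Cod V f)) \<cdot> f = (\<one> \<I> \<oslash> f) \<cdot> inv (LUn V (Dom V f))"
proof (rule iso_mono[of "LUn V (Cod V f)"])
  have "LUn V (Cod V f) \<cdot> (\<one> \<I> \<oslash> f) \<cdot> inv (LUn V (Dom V f)) =
    (LUn V (Cod V f) \<cdot> (\<one> \<I> \<oslash> f)) \<cdot> inv (LUn V (Dom V f))" using assms by simp
  also have "\<dots> = f" using assms by (subst nat_lun) simp_all
  finally show "LUn V (Cod V f) \<cdot> inv (LUn V (Cod V f)) \<cdot> f
    = LUn V (Cod V f) \<cdot> (\<one> \<I> \<oslash> f) \<cdot> inv (LUn V (Dom V f))" using assms by simp
qed (use assms in simp_all)

lemma nat_inv_run: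
  assumes "f \<in> Ar V" shows "inv (RUn V (Cod V f)) \<cdot> f = (f \<oslash> \<one> \<I>) \<cdot> inv (RUn V (Dom V f))"
proof (rule iso_mono[of "RUn V (Cod V f)"])
  have "RUn V (Cod V f) \<cdot> (f \<oslash> \<one> \<I>) \<cdot> inv (RUn V (Dom V f)) =
    (RUn V (Cod V f) \<cdot> (f \<oslash> \<one> \<I>)) \<cdot> inv (RUn V (Dom V f))" using assms by simp
  also have "\<dots> = f" using assms by (subst nat_run) simp_all
  finally show "RUn V (Cod V f) \<cdot> inv (RUn V (Cod V f)) \<cdot> f
    = RUn V (Cod V f) \<cdot> (f \<oslash> \<one> \<I>) \<cdot> inv (RUn V (Dom V f))" using assms by simp
qed (use assms in simp_all)

lemma unit_ten_faithful:
  assumes "f \<in> Ar V" "g \<in> Ar V" "Dom V f = Dom V g" "Cod V f = Cod V g" "\<one> \<I> \<oslash> f = \<one> \<I> \<oslash> g"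
  shows "f = g"
proof (rule iso_epi[of "LUn V (Dom V f)"])
  show "f \<cdot> LUn V (Dom V f) = g \<cdot> LUn V (Dom V f)"
    using nat_lun[of f] nat_lun[of g] assms by simp
qed (use assms in simp_all)

lemma ten_unit_faithful:
  assumes "f \<in> Ar V" "g \<in> Ar V" "Dom V f = Dom V g" "Cod V f = Cod V g" "f \<oslash> \<one> \<I> = g \<oslash> \<one> \<I>"
  shows "f = g"
proof (rule iso_epi[of "RUn V (Dom V f)"])
  show "f \<cdot> RUn V (Dom V f) = g \<cdot> RUn V (Dom V f)"
    using nat_run[of f] nat_run[of g] assms by simp
qed (use assms in simp_all)

text \<open>Kelly's derivation of this law from the pentagon and the triangle. Both sides may be tensored with
  \<open>I\<close> on the left, and then precomposed with the isomorphisms that occur in the pentagon for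
  \<open>I\<close>, \<open>I\<close>, \<open>x\<close>, \<open>y\<close>.\<close>

lemma lun_ten:
  assumes [simp]: "x \<in> Ob V" "y \<in> Ob V"
  shows "LUn V (x \<otimes> y) \<cdot> Asc V \<I> x y = LUn V x \<oslash> \<one> y"
proof (rule unit_ten_faithful)
  let ?p = "Asc V \<I> (\<I> \<otimes> x) y \<cdot> (Asc V \<I> \<I> x \<oslash> \<one> y)"
  have "(\<one> \<I> \<oslash> (LUn V (x \<otimes> y) \<cdot> Asc V \<I> x y)) \<cdot> ?p
    = (\<one> \<I> \<oslash> LUn V (x \<otimes> y)) \<cdot> ((\<one> \<I> \<oslash> Asc V \<I> x y) \<cdot> Asc V \<I> (\<I> \<otimes> x) y \<cdot> (Asc V \<I> \<I> x \<oslash> \<one> y))"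
    by simp
  also have "\<dots> = (\<one> \<I> \<oslash> LUn V (x \<otimes> y)) \<cdot> (Asc V \<I> \<I> (x \<otimes> y) \<cdot> Asc V (\<I> \<otimes> \<I>) x y)"
    by (subst pentagon) simp_all
  also have "\<dots> = ((\<one> \<I> \<oslash> LUn V (x \<otimes> y)) \<cdot> Asc V \<I> \<I> (x \<otimes> y)) \<cdot> Asc V (\<I> \<otimes> \<I>) x y"
    by simp
  also have "\<dots> = (RUn V \<I> \<oslash> (\<one> x \<oslash> \<one> y)) \<cdot> Asc V (\<I> \<otimes> \<I>) x y"
    by (subst triangle) simp_all
  also have "\<dots> = Asc V \<I> x y \<cdot> ((RUn V \<I> \<oslash> \<one> x) \<oslash> \<one> y)"
    by (subst nat_asc) simp_all
  also have "\<dots> = Asc V \<I> x y \<cdot> (((\<one> \<I> \<oslash> LUn V x) \<cdot> Asc V \<I> \<I> x) \<oslash> \<one> y)"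
    by (subst triangle) simp_all
  also have "\<dots> = (Asc V \<I> x y \<cdot> ((\<one> \<I> \<oslash> LUn V x) \<oslash> \<one> y)) \<cdot> (Asc V \<I> \<I> x \<oslash> \<one> y)"
    by simp
  also have "\<dots> = ((\<one> \<I> \<oslash> (LUn V x \<oslash> \<one> y)) \<cdot> Asc V \<I> (\<I> \<otimes> x) y) \<cdot> (Asc V \<I> \<I> x \<oslash> \<one> y)"
    by (subst nat_asc) simp_all
  also have "\<dots> = (\<one> \<I> \<oslash> (LUn V x \<oslash> \<one> y)) \<cdot> ?p" by simp
  finally show "\<one> \<I> \<oslash> (LUn V (x \<otimes> y) \<cdot> Asc V \<I> x y) = \<one> \<I> \<oslash> (LUn V x \<oslash> \<one> y)"
    by (rule iso_epi[rotated -1]) simp_all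
qed simp_all

text \<open>The mirror image of \<open>lun_ten\<close>, with the pentagon for \<open>x\<close>, \<open>y\<close>, \<open>I\<close>, \<open>I\<close>.\<close>

lemma run_ten:
  assumes [simp]: "x \<in> Ob V" "y \<in> Ob V"
  shows "(\<one> x \<oslash> RUn V y) \<cdot> Asc V x y \<I> = RUn V (x \<otimes> y)"
proof (rule ten_unit_faithful)
  have "Asc V x y \<I> \<cdot> (((\<one> x \<oslash> RUn V y) \<cdot> Asc V x y \<I>) \<oslash> \<one> \<I>)
     = (Asc V x y \<I> \<cdot> ((\<one> x \<oslash> RUn V y) \<oslash> \<one> \<I>)) \<cdot> (Asc V x y \<I> \<oslash> \<one> \<I>)" by simp
  also have "\<dots> = ((\<one> x \<oslash> (RUn V y \<oslash> \<one> \<I>)) \<cdot> Asc V x (y \<otimes> \<I>) \<I>) \<cdot> (Asc V x y \<I> \<oslash> \<one> \<I>)"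
    by (subst nat_asc) simp_all
  also have "\<dots> = ((\<one> x \<oslash> ((\<one> y \<oslash> LUn V \<I>) \<cdot> Asc V y \<I> \<I>)) \<cdot> Asc V x (y \<otimes> \<I>) \<I>) \<cdot> (Asc V x y \<I> \<oslash> \<one> \<I>)"
    by (subst triangle) simp_all
  also have "\<dots> = (\<one> x \<oslash> (\<one> y \<oslash> LUn V \<I>)) \<cdot> ((\<one> x \<oslash> Asc V y \<I> \<I>) \<cdot> Asc V x (y \<otimes> \<I>) \<I> \<cdot> (Asc V x y \<I> \<oslash> \<one> \<I>))"
    by simp
  also have "\<dots> = (\<one> x \<oslash> (\<one> y \<oslash> LUn V \<I>)) \<cdot> (Asc V x y (\<I> \<otimes> \<I>) \<cdot> Asc V (x \<otimes> y) \<I> \<I>)"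
    by (subst pentagon) simp_all
  also have "\<dots> = ((\<one> x \<oslash> (\<one> y \<oslash> LUn V \<I>)) \<cdot> Asc V x y (\<I> \<otimes> \<I>)) \<cdot> Asc V (x \<otimes> y) \<I> \<I>"
    by simp
  also have "\<dots> = (Asc V x y \<I> \<cdot> ((\<one> x \<oslash> \<one> y) \<oslash> LUn V \<I>)) \<cdot> Asc V (x \<otimes> y) \<I> \<I>"
    by (subst nat_asc) simp_all
  also have "\<dots> = Asc V x y \<I> \<cdot> ((\<one> (x \<otimes> y) \<oslash> LUn V \<I>) \<cdot> Asc V (x \<otimes> y) \<I> \<I>)" by simp
  also have "\<dots> = Asc V x y \<I> \<cdot> (RUn V (x \<otimes> y) \<oslash> \<one> \<I>)" by (subst triangle) simp_all
  finally show "((\<one> x \<oslash> RUn V y) \<cdot> Asc V x y \<I>) \<oslash> \<one> \<I> = RUn V (x \<otimes> y) \<oslash> \<one> \<I>"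
    by (rule iso_mono[rotated -1]) simp_all
qed simp_all

section \<open>Elements in context\<close>

primrec ctx_ob :: "'o list \<Rightarrow> 'o" where
  "ctx_ob [] = \<I>"
| "ctx_ob (k # ks) = k \<otimes> ctx_ob ks"

text \<open>The isomorphism \<open>ctx_ob ks \<otimes> ctx_ob ls \<rightarrow> ctx_ob (ks @ ls)\<close>. Its coherence
  (\<open>ctx_join_assoc\<close>, \<open>ctx_join_Nil\<close>) is what lets concatenation, which is strict, stand in for the
  tensor product.\<close>

primrec ctx_join :: "'o list \<Rightarrow> 'o list \<Rightarrow> 'a" where
  "ctx_join [] ls = LUn V (ctx_ob ls)"
| "ctx_join (k # ks) ls = (\<one> k \<oslash> ctx_join ks ls) \<cdot> Asc V k (ctx_ob ks) (ctx_ob ls)"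

lemma ctx_ob_ob [simp]: "set ks \<subseteq> Ob V \<Longrightarrow> ctx_ob ks \<in> Ob V"
  by (induction ks) auto

lemma ctx_join_ar [simp]:
  assumes "set ks \<subseteq> Ob V" "set ls \<subseteq> Ob V"
  shows "ctx_join ks ls \<in> Ar V" "Dom V (ctx_join ks ls) = ctx_ob ks \<otimes> ctx_ob ls"
    "Cod V (ctx_join ks ls) = ctx_ob (ks @ ls)" "iso_arr V (ctx_join ks ls)"
proof -
  have "ctx_join ks ls \<in> Ar V \<and> Dom V (ctx_join ks ls) = ctx_ob ks \<otimes> ctx_ob ls \<and>
    Cod V (ctx_join ks ls) = ctx_ob (ks @ ls) \<and> iso_arr V (ctx_join ks ls)"
    using assms by (induction ks) auto
  then show "ctx_join ks ls \<in> Ar V" "Dom V (ctx_join ks ls) = ctx_ob ks \<otimes> ctx_ob ls"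
    "Cod V (ctx_join ks ls) = ctx_ob (ks @ ls)" "iso_arr V (ctx_join ks ls)" by auto
qed

lemma ctx_join_Nil: "set ks \<subseteq> Ob V \<Longrightarrow> ctx_join ks [] = RUn V (ctx_ob ks)"
  by (induction ks) (auto simp: lun_run run_ten)

text \<open>Induction on \<open>ks\<close>: the empty list needs \<open>lun_ten\<close>, and each further object one pentagon.\<close>

lemma ctx_join_assoc:
  assumes "set ks \<subseteq> Ob V" "set ls \<subseteq> Ob V" "set ms \<subseteq> Ob V"
  shows "ctx_join (ks @ ls) ms \<cdot> (ctx_join ks ls \<oslash> \<one> (ctx_ob ms)) =
    ctx_join ks (ls @ ms) \<cdot> (\<one> (ctx_ob ks) \<oslash> ctx_join ls ms) \<cdot> Asc V (ctx_ob ks) (ctx_ob ls) (ctx_ob ms)"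
  using assms
proof (induction ks)
  case Nil
  have "LUn V (ctx_ob (ls @ ms)) \<cdot> (\<one> \<I> \<oslash> ctx_join ls ms) \<cdot> Asc V \<I> (ctx_ob ls) (ctx_ob ms)
    = (LUn V (ctx_ob (ls @ ms)) \<cdot> (\<one> \<I> \<oslash> ctx_join ls ms)) \<cdot> Asc V \<I> (ctx_ob ls) (ctx_ob ms)"
    using Nil by simp
  also have "\<dots> = ctx_join ls ms \<cdot> (LUn V (ctx_ob ls \<otimes> ctx_ob ms) \<cdot> Asc V \<I> (ctx_ob ls) (ctx_ob ms))"
    using nat_lun[of "ctx_join ls ms"] Nil by simp
  finally show ?case using Nil by (simp add: lun_ten)
next
  case (Cons k ks)
  then have o [simp]: "k \<in> Ob V" "set ks \<subseteq> Ob V" "set ls \<subseteq> Ob V" "set ms \<subseteq> Ob V" by auto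
  let ?K = "ctx_ob ks" and ?L = "ctx_ob ls" and ?M = "ctx_ob ms"
  have "ctx_join ((k # ks) @ ls) ms \<cdot> (ctx_join (k # ks) ls \<oslash> \<one> ?M)
    = (\<one> k \<oslash> ctx_join (ks @ ls) ms) \<cdot> (Asc V k (ctx_ob (ks @ ls)) ?M \<cdot> ((\<one> k \<oslash> ctx_join ks ls) \<oslash> \<one> ?M)) \<cdot> (Asc V k ?K ?L \<oslash> \<one> ?M)"
    by simp
  also have "\<dots> = (\<one> k \<oslash> ctx_join (ks @ ls) ms) \<cdot> ((\<one> k \<oslash> (ctx_join ks ls \<oslash> \<one> ?M)) \<cdot> Asc V k (?K \<otimes> ?L) ?M) \<cdot> (Asc V k ?K ?L \<oslash> \<one> ?M)"
    by (subst nat_asc) simp_all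
  also have "\<dots> = (\<one> k \<oslash> (ctx_join (ks @ ls) ms \<cdot> (ctx_join ks ls \<oslash> \<one> ?M))) \<cdot> Asc V k (?K \<otimes> ?L) ?M \<cdot> (Asc V k ?K ?L \<oslash> \<one> ?M)"
    by simp
  also have "\<dots> = (\<one> k \<oslash> (ctx_join ks (ls @ ms) \<cdot> (\<one> ?K \<oslash> ctx_join ls ms))) \<cdot>
    ((\<one> k \<oslash> Asc V ?K ?L ?M) \<cdot> Asc V k (?K \<otimes> ?L) ?M \<cdot> (Asc V k ?K ?L \<oslash> \<one> ?M))"
    using Cons.IH by simp
  also have "\<dots> = (\<one> k \<oslash> (ctx_join ks (ls @ ms) \<cdot> (\<one> ?K \<oslash> ctx_join ls ms))) \<cdot>
    (Asc V k ?K (?L \<otimes> ?M) \<cdot> Asc V (k \<otimes> ?K) ?L ?M)"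
    by (subst pentagon) simp_all
  also have "\<dots> = (\<one> k \<oslash> ctx_join ks (ls @ ms)) \<cdot> ((\<one> k \<oslash> (\<one> ?K \<oslash> ctx_join ls ms)) \<cdot>
    Asc V k ?K (?L \<otimes> ?M)) \<cdot> Asc V (k \<otimes> ?K) ?L ?M"
    by simp
  also have "\<dots> = (\<one> k \<oslash> ctx_join ks (ls @ ms)) \<cdot> (Asc V k ?K (ctx_ob (ls @ ms)) \<cdot> ((\<one> k \<oslash> \<one> ?K) \<oslash> ctx_join ls ms)) \<cdot> Asc V (k \<otimes> ?K) ?L ?M"
    by (subst nat_asc) simp_all
  finally show ?case by simp
qed

text \<open>An element of \<open>x\<close> carries its context, because the composition of elements has to know how to
  concatenate.\<close>

definition El :: "'o \<Rightarrow> ('o list \<times> 'a) set" where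
  "El x = {(ks, f). set ks \<subseteq> Ob V \<and> f \<in> Hom V (ctx_ob ks) x}"

definition lin :: "'a \<Rightarrow> 'o list \<times> 'a \<Rightarrow> 'o list \<times> 'a" where
  "lin r f = (fst f, r \<cdot> snd f)"

text \<open>A map of two variables \<open>y \<otimes> x \<rightarrow> z\<close> acts on a pair of elements, each of which keeps its own
  part of the context. Composition and evaluation are instances.\<close>

definition bil :: "'a \<Rightarrow> 'o list \<times> 'a \<Rightarrow> 'o list \<times> 'a \<Rightarrow> 'o list \<times> 'a" where
  "bil m g f = (fst g @ fst f, m \<cdot> (snd g \<oslash> snd f) \<cdot> inv (ctx_join (fst g) (fst f)))"

text \<open>The generic element: maps out of \<open>x\<close> are determined by their effect on it. Its arrow is
  invertible but not an identity, as a context of length one stands for \<open>x \<otimes> I\<close>.\<close>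

definition gen :: "'o \<Rightarrow> 'o list \<times> 'a" where
  "gen x = ([x], RUn V x)"

lemma El_iff: "f \<in> El x \<longleftrightarrow> set (fst f) \<subseteq> Ob V \<and> snd f \<in> Ar V \<and> Dom V (snd f) = ctx_ob (fst f) \<and> Cod V (snd f) = x"
  by (cases f) (auto simp: El_def in_Hom)

lemma El_ob: "f \<in> El x \<Longrightarrow> x \<in> Ob V"
  by (auto simp: El_iff)

lemma fst_lin [simp]: "fst (lin r f) = fst f" by (simp add: lin_def)
lemma fst_bil [simp]: "fst (bil m g f) = fst g @ fst f" by (simp add: bil_def)

lemma lin_El: "r \<in> Hom V x y \<Longrightarrow> f \<in> El x \<Longrightarrow> lin r f \<in> El y"
  by (auto simp: El_iff in_Hom lin_def)

lemma bil_El: "m \<in> Hom V (y \<otimes> x) z \<Longrightarrow> g \<in> El y \<Longrightarrow> f \<in> El x \<Longrightarrow> bil m g f \<in> El z"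
  by (auto simp: El_iff in_Hom bil_def)

lemma gen_El [simp]: "x \<in> Ob V \<Longrightarrow> gen x \<in> El x"
  by (auto simp: El_iff gen_def)

lemma gen_iso [simp]: "x \<in> Ob V \<Longrightarrow> iso_arr V (snd (gen x))"
  by (auto simp: gen_def)

lemma point_El: "i \<in> Hom V \<I> x \<Longrightarrow> ([], i) \<in> El x"
  by (auto simp: El_iff in_Hom)

lemma El_Nil: "f \<in> El x \<Longrightarrow> fst f = [] \<Longrightarrow> \<exists>i. i \<in> Hom V \<I> x \<and> f = ([], i)"
  by (cases f) (auto simp: El_iff in_Hom)

lemma lin_lin: "r \<in> Hom V x y \<Longrightarrow> s \<in> Hom V y z \<Longrightarrow> f \<in> El x \<Longrightarrow> lin s (lin r f) = lin (s \<cdot> r) f"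
  by (auto simp: El_iff in_Hom lin_def)

lemma lin_one: "f \<in> El x \<Longrightarrow> lin (\<one> x) f = f"
  by (auto simp: El_iff in_Hom lin_def prod_eq_iff)

lemma lin_bil: "m \<in> Hom V (y \<otimes> x) z \<Longrightarrow> r \<in> Hom V z w \<Longrightarrow> g \<in> El y \<Longrightarrow> f \<in> El x \<Longrightarrow>
  lin r (bil m g f) = bil (r \<cdot> m) g f"
  by (auto simp: El_iff in_Hom lin_def bil_def)

lemma bil_lin_lin: "m \<in> Hom V (y' \<otimes> x') z \<Longrightarrow> r \<in> Hom V y y' \<Longrightarrow> s \<in> Hom V x x' \<Longrightarrow> g \<in> El y \<Longrightarrow> f \<in> El x \<Longrightarrow>
  bil m (lin r g) (lin s f) = bil (m \<cdot> (r \<oslash> s)) g f"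
  by (auto simp: El_iff in_Hom lin_def bil_def)

lemma bil_lin_left: "m \<in> Hom V (y' \<otimes> x) z \<Longrightarrow> r \<in> Hom V y y' \<Longrightarrow> g \<in> El y \<Longrightarrow> f \<in> El x \<Longrightarrow>
  bil m (lin r g) f = bil (m \<cdot> (r \<oslash> \<one> x)) g f"
  by (auto simp: El_iff in_Hom lin_def bil_def)

lemma bil_lin_right: "m \<in> Hom V (y \<otimes> x') z \<Longrightarrow> s \<in> Hom V x x' \<Longrightarrow> g \<in> El y \<Longrightarrow> f \<in> El x \<Longrightarrow>
  bil m g (lin s f) = bil (m \<cdot> (\<one> y \<oslash> s)) g f"
  by (auto simp: El_iff in_Hom lin_def bil_def)

lemma bil_point_left:
  assumes "m \<in> Hom V (y \<otimes> x) z" "i \<in> Hom V \<I> y" "f \<in> El x"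
  shows "bil m ([], i) f = lin (m \<cdot> (i \<oslash> \<one> x) \<cdot> inv (LUn V x)) f"
proof -
  have [simp]: "y \<in> Ob V" "x \<in> Ob V" using assms El_ob Hom_ob by auto
  have "inv (LUn V x) \<cdot> snd f = (\<one> \<I> \<oslash> snd f) \<cdot> inv (LUn V (ctx_ob (fst f)))"
    using nat_inv_lun[of "snd f"] assms by (simp add: El_iff)
  then show ?thesis using assms by (auto simp: El_iff in_Hom lin_def bil_def)
qed

lemma bil_point_right:
  assumes "m \<in> Hom V (y \<otimes> x) z" "i \<in> Hom V \<I> x" "g \<in> El y"
  shows "bil m g ([], i) = lin (m \<cdot> (\<one> y \<oslash> i) \<cdot> inv (RUn V y)) g"
proof -
  have [simp]: "y \<in> Ob V" "x \<in> Ob V" using assms El_ob Hom_ob by auto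
  have "inv (RUn V y) \<cdot> snd g = (snd g \<oslash> \<one> \<I>) \<cdot> inv (RUn V (ctx_ob (fst g)))"
    using nat_inv_run[of "snd g"] assms by (simp add: El_iff)
  then show ?thesis using assms by (auto simp: El_iff in_Hom lin_def bil_def ctx_join_Nil)
qed

text \<open>Presents maps such as \<open>w \<mapsto> G w \<cdot> \<tau>\<close>, with \<open>\<tau>\<close> of empty context, as arrows of the base, so that
  they can enter a universal property.\<close>

definition at_point :: "'a \<Rightarrow> 'o \<Rightarrow> 'a \<Rightarrow> 'a" where
  "at_point m y i = m \<cdot> (\<one> y \<oslash> i) \<cdot> inv (RUn V y)"

lemma at_point_lin:
  assumes "m \<in> Hom V (y \<otimes> x) z" "i \<in> Hom V \<I> x" "y \<in> Ob V"
  shows "at_point m y i \<in> Hom V y z" "g \<in> El y \<Longrightarrow> lin (at_point m y i) g = bil m g ([], i)"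
  using assms bil_point_right[OF assms(1,2)] by (simp_all add: at_point_def in_Hom)

lemma ctx_join_assoc_inv:
  assumes [simp]: "set ks \<subseteq> Ob V" "set ls \<subseteq> Ob V" "set ms \<subseteq> Ob V"
  shows "(\<one> (ctx_ob ks) \<oslash> inv (ctx_join ls ms)) \<cdot> inv (ctx_join ks (ls @ ms)) =
    Asc V (ctx_ob ks) (ctx_ob ls) (ctx_ob ms) \<cdot> (inv (ctx_join ks ls) \<oslash> \<one> (ctx_ob ms)) \<cdot> inv (ctx_join (ks @ ls) ms)"
    (is "?B = ?C \<cdot> ?A")
proof -
  let ?M = "ctx_join (ks @ ls) ms \<cdot> (ctx_join ks ls \<oslash> \<one> (ctx_ob ms))"
  have "?M \<cdot> ?A = \<one> (ctx_ob (ks @ ls @ ms))" by simp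
  moreover have "?B \<cdot> ?M = ?C" by (subst ctx_join_assoc) simp_all
  moreover have "(?B \<cdot> ?M) \<cdot> ?A = ?B \<cdot> (?M \<cdot> ?A)" by (subst (1 2) assoc) simp_all
  ultimately show ?thesis by simp
qed

text \<open>The two ways to bracket three elements differ from the arrow forms of the two trilinear maps by one
  and the same arrow \<open>E\<close>, which is invertible if the three elements are. So an equation between arrows,
  associativity included, is equivalent to the strict equation between elements: \<open>bil_assoc\<close> and
  \<open>tri_ext\<close> are the two directions.\<close>

lemma bil_assoc_arrow:
  assumes h: "h \<in> El H" and g: "g \<in> El G" and f: "f \<in> El F"
    and m: "m \<in> Hom V (X \<otimes> F) Z" "n \<in> Hom V (H \<otimes> G) X" "m' \<in> Hom V (H \<otimes> Y) Z" "n' \<in> Hom V (G \<otimes> F) Y"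
  obtains E where "E \<in> Ar V" "Cod V E = (H \<otimes> G) \<otimes> F"
    "snd (bil m (bil n h g) f) = (m \<cdot> (n \<oslash> \<one> F)) \<cdot> E"
    "snd (bil m' h (bil n' g f)) = (m' \<cdot> (\<one> H \<oslash> n') \<cdot> Asc V H G F) \<cdot> E"
    "iso_arr V (snd h) \<Longrightarrow> iso_arr V (snd g) \<Longrightarrow> iso_arr V (snd f) \<Longrightarrow> iso_arr V E"
proof -
  obtain ks h' ls g' ms f' where e: "h = (ks, h')" "g = (ls, g')" "f = (ms, f')" by (metis surj_pair)
  note [simp] = e
  have [simp]: "set ks \<subseteq> Ob V" "set ls \<subseteq> Ob V" "set ms \<subseteq> Ob V"
    "h' \<in> Ar V" "g' \<in> Ar V" "f' \<in> Ar V" "Dom V h' = ctx_ob ks" "Dom V g' = ctx_ob ls" "Dom V f' = ctx_ob ms"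
    "Cod V h' = H" "Cod V g' = G" "Cod V f' = F"
    using h g f by (auto simp: El_iff)
  have [simp]: "H \<in> Ob V" "G \<in> Ob V" "F \<in> Ob V" using h g f El_ob by auto
  note [simp] = m[unfolded in_Hom]
  let ?A = "(inv (ctx_join ks ls) \<oslash> \<one> (ctx_ob ms)) \<cdot> inv (ctx_join (ks @ ls) ms)"
  let ?E = "((h' \<oslash> g') \<oslash> f') \<cdot> ?A"
  show ?thesis
  proof
    show "?E \<in> Ar V" "Cod V ?E = (H \<otimes> G) \<otimes> F" by simp_all
    show "snd (bil m (bil n h g) f) = (m \<cdot> (n \<oslash> \<one> F)) \<cdot> ?E" by (simp add: bil_def)
    have "snd (bil m' h (bil n' g f)) = m' \<cdot> (\<one> H \<oslash> n') \<cdot> (h' \<oslash> (g' \<oslash> f')) \<cdot>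
      ((\<one> (ctx_ob ks) \<oslash> inv (ctx_join ls ms)) \<cdot> inv (ctx_join ks (ls @ ms)))" by (simp add: bil_def)
    also have "\<dots> = m' \<cdot> (\<one> H \<oslash> n') \<cdot> ((h' \<oslash> (g' \<oslash> f')) \<cdot>
       Asc V (ctx_ob ks) (ctx_ob ls) (ctx_ob ms)) \<cdot> ?A" by (subst ctx_join_assoc_inv) (simp_all del: ten_merge ten_merge2)
    also have "\<dots> = m' \<cdot> (\<one> H \<oslash> n') \<cdot> (Asc V H G F \<cdot> ((h' \<oslash> g') \<oslash> f')) \<cdot> ?A"
      by (subst nat_asc) simp_all
    also have "\<dots> = (m' \<cdot> (\<one> H \<oslash> n') \<cdot> Asc V H G F) \<cdot> ?E" by simp
    finally show "snd (bil m' h (bil n' g f)) = (m' \<cdot> (\<one> H \<oslash> n') \<cdot> Asc V H G F) \<cdot> ?E" .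
    show "iso_arr V (snd h) \<Longrightarrow> iso_arr V (snd g) \<Longrightarrow> iso_arr V (snd f) \<Longrightarrow> iso_arr V ?E" by simp
  qed
qed

lemma bil_assoc:
  assumes "m \<cdot> (n \<oslash> \<one> F) = m' \<cdot> (\<one> H \<oslash> n') \<cdot> Asc V H G F"
    and "m \<in> Hom V (X \<otimes> F) Z" "n \<in> Hom V (H \<otimes> G) X" "m' \<in> Hom V (H \<otimes> Y) Z" "n' \<in> Hom V (G \<otimes> F) Y"
    and "h \<in> El H" "g \<in> El G" "f \<in> El F"
  shows "bil m (bil n h g) f = bil m' h (bil n' g f)"
  using bil_assoc_arrow[OF assms(6-8) assms(2-5)] assms(1) by (metis prod_eq_iff fst_bil append_assoc)

lemma lin_ext:
  assumes "r \<in> Hom V x y" "s \<in> Hom V x y" "lin r (gen x) = lin s (gen x)"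
  shows "r = s"
  using assms Hom_ob[OF assms(1)] by - (rule iso_epi[of "RUn V x" r s], auto simp: lin_def gen_def in_Hom)

text \<open>It suffices to test on one pair of invertible elements, for instance on generic ones. For
  an element \<open>(ks, f)\<close> of a hom-object the identity on \<open>ctx_ob ks\<close> serves as the first one, as in
  \<open>ap_ext\<close> and \<open>Kan_colimit_ext\<close>.\<close>

lemma bil_ext:
  assumes "p \<in> Hom V (y \<otimes> x) z" "q \<in> Hom V (y \<otimes> x) z" "g \<in> El y" "f \<in> El x"
    "iso_arr V (snd g)" "iso_arr V (snd f)" "bil p g f = bil q g f"
  shows "p = q"
proof (rule iso_epi[of "(snd g \<oslash> snd f) \<cdot> inv (ctx_join (fst g) (fst f))"])
  show "iso_arr V ((snd g \<oslash> snd f) \<cdot> inv (ctx_join (fst g) (fst f)))"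
    using assms by (auto simp: El_iff in_Hom)
qed (use assms in \<open>auto simp: El_iff in_Hom bil_def\<close>)

lemma tri_ext:
  assumes "m \<in> Hom V (X \<otimes> F) Z" "n \<in> Hom V (H \<otimes> G) X" "m' \<in> Hom V (H \<otimes> Y) Z" "n' \<in> Hom V (G \<otimes> F) Y"
    and "h \<in> El H" "g \<in> El G" "f \<in> El F" "iso_arr V (snd h)" "iso_arr V (snd g)" "iso_arr V (snd f)"
    and "bil m (bil n h g) f = bil m' h (bil n' g f)"
  shows "m \<cdot> (n \<oslash> \<one> F) = m' \<cdot> (\<one> H \<oslash> n') \<cdot> Asc V H G F"
proof -
  obtain E where E: "E \<in> Ar V" "Cod V E = (H \<otimes> G) \<otimes> F"
    "snd (bil m (bil n h g) f) = (m \<cdot> (n \<oslash> \<one> F)) \<cdot> E"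
    "snd (bil m' h (bil n' g f)) = (m' \<cdot> (\<one> H \<oslash> n') \<cdot> Asc V H G F) \<cdot> E"
    "iso_arr V E"
    using bil_assoc_arrow[OF assms(5-7) assms(1-4)] assms(8-10) by metis
  have o: "H \<in> Ob V" "G \<in> Ob V" "F \<in> Ob V" using assms(5-7) El_ob by auto
  have "(m \<cdot> (n \<oslash> \<one> F)) \<cdot> E = (m' \<cdot> (\<one> H \<oslash> n') \<cdot> Asc V H G F) \<cdot> E"
    using E(3,4) assms(11) by metis
  then show ?thesis using E(1,2,5) o assms(1-4) by - (rule iso_epi[of E], simp_all add: in_Hom)
qed

lemma Curry_Hom:
  assumes "p \<in> Hom V (x \<otimes> y) z" "x \<in> Ob V" "y \<in> Ob V"
  shows "Curry x y p \<in> Hom V x (IHom V y z)" "Ev V y z \<cdot> (Curry x y p \<oslash> \<one> y) = p"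
proof -
  have z: "z \<in> Ob V" "Cod V p = z" using assms by (auto simp: in_Hom)
  have "\<exists>!g. g \<in> Hom V x (IHom V y z) \<and> Ev V y z \<cdot> (g \<oslash> \<one> y) = p"
    using ev_universal[OF assms(2,3) z(1) assms(1)] .
  from theI'[OF this] show "Curry x y p \<in> Hom V x (IHom V y z)" "Ev V y z \<cdot> (Curry x y p \<oslash> \<one> y) = p"
    unfolding Curry_def z(2) by auto
qed

lemma Curry_unique:
  assumes "g \<in> Hom V x (IHom V y z)" "h \<in> Hom V x (IHom V y z)" "y \<in> Ob V" "z \<in> Ob V"
    "Ev V y z \<cdot> (g \<oslash> \<one> y) = Ev V y z \<cdot> (h \<oslash> \<one> y)"
  shows "g = h"
proof -
  have "Ev V y z \<cdot> (g \<oslash> \<one> y) \<in> Hom V (x \<otimes> y) z" using assms by (auto simp: in_Hom)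
  from ev_universal[OF _ _ _ this] assms show ?thesis using Hom_ob by metis
qed

definition ap :: "'o \<Rightarrow> 'o \<Rightarrow> 'o list \<times> 'a \<Rightarrow> 'o list \<times> 'a \<Rightarrow> 'o list \<times> 'a" where
  "ap x y \<phi> f = bil (Ev V x y) \<phi> f"

lemma fst_ap [simp]: "fst (ap x y \<phi> f) = fst \<phi> @ fst f"
  by (simp add: ap_def)

lemma ap_El [simp, intro]: "x \<in> Ob V \<Longrightarrow> y \<in> Ob V \<Longrightarrow> \<phi> \<in> El (IHom V x y) \<Longrightarrow> f \<in> El x \<Longrightarrow> ap x y \<phi> f \<in> El y"
  unfolding ap_def using ev by (rule bil_El)

lemma ap_lin: "\<lbrakk>x \<in> Ob V; y \<in> Ob V; r \<in> Hom V z (IHom V x y); \<phi> \<in> El z; f \<in> El x\<rbrakk> \<Longrightarrow>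
  ap x y (lin r \<phi>) f = bil (Ev V x y \<cdot> (r \<oslash> \<one> x)) \<phi> f"
  unfolding ap_def by (rule bil_lin_left[OF ev])

lemma ap_Curry:
  assumes "p \<in> Hom V (x \<otimes> y) z" "\<phi> \<in> El x" "f \<in> El y"
  shows "ap y z (lin (Curry x y p) \<phi>) f = bil p \<phi> f"
  using assms Curry_Hom[OF assms(1)] by (subst ap_lin) (auto simp: El_ob Hom_ob)

text \<open>Uniqueness of transposes, in terms of elements.\<close>

lemma ap_ext:
  assumes "\<phi> \<in> El (IHom V x y)" "\<psi> \<in> El (IHom V x y)" "x \<in> Ob V" "y \<in> Ob V" "fst \<phi> = fst \<psi>"
    and "\<And>f. f \<in> El x \<Longrightarrow> ap x y \<phi> f = ap x y \<psi> f"
  shows "\<phi> = \<psi>"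
proof -
  obtain ks f where f: "\<phi> = (ks, f)" "f \<in> Hom V (ctx_ob ks) (IHom V x y)" and ks [simp]: "set ks \<subseteq> Ob V"
    using assms(1) by (auto simp: El_def)
  obtain g where g: "\<psi> = (ks, g)" "g \<in> Hom V (ctx_ob ks) (IHom V x y)"
    using assms(2,5) f by (auto simp: El_def)
  let ?k = "(ks, \<one> (ctx_ob ks))"
  have k: "?k \<in> El (ctx_ob ks)" by (auto simp: El_iff)
  have e: "\<phi> = lin f ?k" "\<psi> = lin g ?k" using f g by (auto simp: lin_def in_Hom)
  have "Ev V x y \<cdot> (f \<oslash> \<one> x) = Ev V x y \<cdot> (g \<oslash> \<one> x)"
  proof (rule bil_ext[of _ "ctx_ob ks" x y _ ?k "gen x"])
    show "bil (Ev V x y \<cdot> (f \<oslash> \<one> x)) ?k (gen x) = bil (Ev V x y \<cdot> (g \<oslash> \<one> x)) ?k (gen x)"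
      using assms(6)[of "gen x"] ap_lin[OF assms(3,4) f(2) k] ap_lin[OF assms(3,4) g(2) k] e
      by (simp add: assms)
  qed (use f g k assms in \<open>auto simp: in_Hom\<close>)
  then have "f = g" using f g assms Curry_unique by blast
  then show ?thesis using f g by simp
qed

lemma name_Hom:
  assumes "f \<in> Hom V x y"
  shows "name f \<in> Hom V \<I> (IHom V x y)" "\<And>w. w \<in> El x \<Longrightarrow> ap x y ([], name f) w = lin f w"
proof -
  have o [simp]: "x \<in> Ob V" "y \<in> Ob V" using assms Hom_ob by auto
  have D: "Dom V f = x" using assms by (auto simp: in_Hom)
  have p: "f \<cdot> LUn V x \<in> Hom V (\<I> \<otimes> x) y" using assms by (auto simp: in_Hom)
  note c = Curry_Hom[OF p unt o(1)]
  show n: "name f \<in> Hom V \<I> (IHom V x y)" using c(1) by (simp add: name_def D)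
  fix w assume w: "w \<in> El x"
  have "ap x y ([], name f) w = lin (Ev V x y \<cdot> (name f \<oslash> \<one> x) \<cdot> inv (LUn V x)) w"
    unfolding ap_def by (rule bil_point_left[OF ev[OF o] n w])
  also have "Ev V x y \<cdot> (name f \<oslash> \<one> x) \<cdot> inv (LUn V x) = (Ev V x y \<cdot> (name f \<oslash> \<one> x)) \<cdot> inv (LUn V x)"
    using n by (simp add: in_Hom)
  also have "\<dots> = f" using c(2) assms by (simp add: name_def D in_Hom)
  finally show "ap x y ([], name f) w = lin f w" .
qed

text \<open>The inverse of \<open>name\<close>.\<close>

definition unname :: "'o \<Rightarrow> 'o \<Rightarrow> 'a \<Rightarrow> 'a" where
  "unname x y u = Ev V x y \<cdot> (u \<oslash> \<one> x) \<cdot> inv (LUn V x)"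

lemma unname_Hom:
  assumes "u \<in> Hom V \<I> (IHom V x y)" and [simp]: "x \<in> Ob V" "y \<in> Ob V"
  shows "unname x y u \<in> Hom V x y" "\<And>w. w \<in> El x \<Longrightarrow> lin (unname x y u) w = ap x y ([], u) w"
    "name (unname x y u) = u"
proof -
  show n: "unname x y u \<in> Hom V x y" using assms by (auto simp: unname_def in_Hom)
  show l: "lin (unname x y u) w = ap x y ([], u) w" if w: "w \<in> El x" for w
    unfolding ap_def unname_def by (rule bil_point_left[OF ev[OF assms(2,3)] assms(1) w, symmetric])
  have "([] :: 'o list, name (unname x y u)) = ([], u)"
  proof (rule ap_ext[of _ x y])
    show "ap x y ([], name (unname x y u)) w = ap x y ([], u) w" if "w \<in> El x" for w
      using name_Hom(2)[OF n that] l[OF that] by simp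
  qed (use name_Hom(1)[OF n] assms in \<open>auto intro: point_El\<close>)
  then show "name (unname x y u) = u" by simp
qed

lemma unname_name: "f \<in> Hom V x y \<Longrightarrow> unname x y (name f) = f"
  using name_Hom[of f x y] unname_Hom[of "name f" x y] Hom_ob
  by - (rule lin_ext[of _ x y], auto)

end

section \<open>Enriched categories through elements\<close>

text \<open>So that \<open>F x\<close> and \<open>A x y\<close> can be written for the values of a functor on objects and
  for hom-objects.\<close>

declare [[coercion_enabled, coercion fob, coercion VHom]]

context smcc begin

text \<open>Composition of elements of hom-objects. With contexts concatenated, the laws of an enriched category
  become those of an ordinary one (\<open>cmp_el_assoc\<close>, \<open>cmp_el_one_el_left\<close>, \<open>cmp_el_one_el_right\<close>).\<close>

definition cmp_el :: "('x, 'o, 'a) vcat \<Rightarrow> 'x \<Rightarrow> 'x \<Rightarrow> 'x \<Rightarrow> 'o list \<times> 'a \<Rightarrow> 'o list \<times> 'a \<Rightarrow> 'o list \<times> 'a" where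
  "cmp_el A x y z g f = bil (VCmp A x y z) g f"

definition one_el :: "('x, 'o, 'a) vcat \<Rightarrow> 'x \<Rightarrow> 'o list \<times> 'a" where
  "one_el A x = ([], VId A x)"

lemma fst_cmp_el [simp]: "fst (cmp_el A x y z g f) = fst g @ fst f"
  by (simp add: cmp_el_def)

lemma fst_one_el [simp]: "fst (one_el A x) = []"
  by (simp add: one_el_def)

lemma vcat_ob [simp]: "is_vcat A \<Longrightarrow> x \<in> VOb A \<Longrightarrow> y \<in> VOb A \<Longrightarrow> A x y \<in> Ob V"
  by (auto simp: is_vcat_def)

lemma vcat_cmp:
  "is_vcat A \<Longrightarrow> x \<in> VOb A \<Longrightarrow> y \<in> VOb A \<Longrightarrow> z \<in> VOb A \<Longrightarrow>
    VCmp A x y z \<in> Hom V (A y z \<otimes> A x y) (A x z)"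
  by (auto simp: is_vcat_def)

lemma vcat_id: "is_vcat A \<Longrightarrow> x \<in> VOb A \<Longrightarrow> VId A x \<in> Hom V \<I> (A x x)"
  by (auto simp: is_vcat_def)

lemma one_el_El [simp]: "is_vcat A \<Longrightarrow> x \<in> VOb A \<Longrightarrow> one_el A x \<in> El (A x x)"
  unfolding one_el_def by (intro point_El vcat_id)

lemma cmp_el_El [simp]:
  assumes "is_vcat A" "x \<in> VOb A" "y \<in> VOb A" "z \<in> VOb A" "g \<in> El (A y z)" "f \<in> El (A x y)"
  shows "cmp_el A x y z g f \<in> El (A x z)"
  unfolding cmp_el_def using vcat_cmp[OF assms(1-4)] assms(5,6) by (rule bil_El)

lemma cmp_el_assoc:
  assumes "is_vcat A" "w \<in> VOb A" "x \<in> VOb A" "y \<in> VOb A" "z \<in> VOb A"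
    "h \<in> El (A y z)" "g \<in> El (A x y)" "f \<in> El (A w x)"
  shows "cmp_el A w x z (cmp_el A x y z h g) f = cmp_el A w y z h (cmp_el A w x y g f)"
  unfolding cmp_el_def using assms vcat_cmp[OF assms(1)]
  by (intro bil_assoc) (auto simp: is_vcat_def)

lemma cmp_el_one_el_left [simp]:
  assumes "is_vcat A" "x \<in> VOb A" "y \<in> VOb A" "f \<in> El (A x y)"
  shows "cmp_el A x y y (one_el A y) f = f"
proof -
  note c [simp] = vcat_cmp[OF assms(1,2,3,3), unfolded in_Hom] vcat_id[OF assms(1,3), unfolded in_Hom]
  have [simp]: "A x y \<in> Ob V" using assms by simp
  have "VCmp A x y y \<cdot> (VId A y \<oslash> \<one> (A x y)) \<cdot> inv (LUn V (A x y))
    = (VCmp A x y y \<cdot> (VId A y \<oslash> \<one> (A x y))) \<cdot> inv (LUn V (A x y))" by simp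
  also have "\<dots> = \<one> (A x y)" using assms by (simp add: is_vcat_def del: assoc)
  finally have *: "VCmp A x y y \<cdot> (VId A y \<oslash> \<one> (A x y)) \<cdot> inv (LUn V (A x y)) = \<one> (A x y)" .
  show ?thesis unfolding cmp_el_def one_el_def
    by (subst bil_point_left[OF vcat_cmp[OF assms(1,2,3,3)] vcat_id[OF assms(1,3)] assms(4)])
      (simp only: * lin_one[OF assms(4)])
qed

lemma cmp_el_one_el_right [simp]:
  assumes "is_vcat A" "x \<in> VOb A" "y \<in> VOb A" "f \<in> El (A x y)"
  shows "cmp_el A x x y f (one_el A x) = f"
proof -
  note c [simp] = vcat_cmp[OF assms(1,2,2,3), unfolded in_Hom] vcat_id[OF assms(1,2), unfolded in_Hom]
  have [simp]: "A x y \<in> Ob V" using assms by simp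
  have "VCmp A x x y \<cdot> (\<one> (A x y) \<oslash> VId A x) \<cdot> inv (RUn V (A x y))
    = (VCmp A x x y \<cdot> (\<one> (A x y) \<oslash> VId A x)) \<cdot> inv (RUn V (A x y))" by simp
  also have "\<dots> = \<one> (A x y)" using assms by (simp add: is_vcat_def del: assoc)
  finally have *: "VCmp A x x y \<cdot> (\<one> (A x y) \<oslash> VId A x) \<cdot> inv (RUn V (A x y)) = \<one> (A x y)" .
  show ?thesis unfolding cmp_el_def one_el_def
    by (subst bil_point_right[OF vcat_cmp[OF assms(1,2,2,3)] vcat_id[OF assms(1,2)] assms(4)])
      (simp only: * lin_one[OF assms(4)])
qed

lemma is_vcatI:
  assumes ob: "\<And>x y. x \<in> VOb A \<Longrightarrow> y \<in> VOb A \<Longrightarrow> A x y \<in> Ob V"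
    and id: "\<And>x. x \<in> VOb A \<Longrightarrow> VId A x \<in> Hom V \<I> (A x x)"
    and c: "\<And>x y z. x \<in> VOb A \<Longrightarrow> y \<in> VOb A \<Longrightarrow> z \<in> VOb A \<Longrightarrow>
      VCmp A x y z \<in> Hom V (A y z \<otimes> A x y) (A x z)"
    and ass: "\<And>w x y z h g f. \<lbrakk>w \<in> VOb A; x \<in> VOb A; y \<in> VOb A; z \<in> VOb A;
      h \<in> El (A y z); g \<in> El (A x y); f \<in> El (A w x)\<rbrakk> \<Longrightarrow>
      cmp_el A w x z (cmp_el A x y z h g) f = cmp_el A w y z h (cmp_el A w x y g f)"
    and left: "\<And>x y f. \<lbrakk>x \<in> VOb A; y \<in> VOb A; f \<in> El (A x y)\<rbrakk> \<Longrightarrow> cmp_el A x y y (one_el A y) f = f"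
    and right: "\<And>x y f. \<lbrakk>x \<in> VOb A; y \<in> VOb A; f \<in> El (A x y)\<rbrakk> \<Longrightarrow> cmp_el A x x y f (one_el A x) = f"
  shows "is_vcat A"
  unfolding is_vcat_def
proof (intro conjI ballI)
  fix w x y z assume o: "w \<in> VOb A" "x \<in> VOb A" "y \<in> VOb A" "z \<in> VOb A"
  show "VCmp A w x z \<cdot> (VCmp A x y z \<oslash> \<one> (A w x)) =
    VCmp A w y z \<cdot> (\<one> (A y z) \<oslash> VCmp A w x y) \<cdot> Asc V (A y z) (A x y) (A w x)"
    using ass[OF o gen_El gen_El gen_El, unfolded cmp_el_def] o
    by - (rule tri_ext[OF c c c c gen_El gen_El gen_El gen_iso gen_iso gen_iso], simp_all add: ob)
next
  fix x y assume o: "x \<in> VOb A" "y \<in> VOb A"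
  note [simp] = ob[OF o] c[OF o(1) o(2) o(2), unfolded in_Hom] c[OF o(1) o(1) o(2), unfolded in_Hom]
    id[OF o(1), unfolded in_Hom] id[OF o(2), unfolded in_Hom]
  have "VCmp A x y y \<cdot> (VId A y \<oslash> \<one> (A x y)) \<cdot> inv (LUn V (A x y)) = \<one> (A x y)"
    using left[OF o gen_El] bil_point_left[OF c[OF o(1) o(2) o(2)] id[OF o(2)] gen_El]
    by - (rule lin_ext[of _ "A x y" "A x y"], simp_all add: cmp_el_def one_el_def lin_one in_Hom)
  then have "(VCmp A x y y \<cdot> (VId A y \<oslash> \<one> (A x y)) \<cdot> inv (LUn V (A x y))) \<cdot> LUn V (A x y)
    = LUn V (A x y)" by (simp del: assoc)
  then show "VCmp A x y y \<cdot> (VId A y \<oslash> \<one> (A x y)) = LUn V (A x y)" by simp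
  have "VCmp A x x y \<cdot> (\<one> (A x y) \<oslash> VId A x) \<cdot> inv (RUn V (A x y)) = \<one> (A x y)"
    using right[OF o gen_El] bil_point_right[OF c[OF o(1) o(1) o(2)] id[OF o(1)] gen_El]
    by - (rule lin_ext[of _ "A x y" "A x y"], simp_all add: cmp_el_def one_el_def lin_one in_Hom)
  then have "(VCmp A x x y \<cdot> (\<one> (A x y) \<oslash> VId A x) \<cdot> inv (RUn V (A x y))) \<cdot> RUn V (A x y)
    = RUn V (A x y)" by (simp del: assoc)
  then show "VCmp A x x y \<cdot> (\<one> (A x y) \<oslash> VId A x) = RUn V (A x y)" by simp
qed (simp_all add: ob id c)

lemma vfunctor_ob [simp]: "is_vfunctor A B F \<Longrightarrow> x \<in> VOb A \<Longrightarrow> F x \<in> VOb B"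
  by (auto simp: is_vfunctor_def)

lemma vfunctor_far: "is_vfunctor A B F \<Longrightarrow> x \<in> VOb A \<Longrightarrow> y \<in> VOb A \<Longrightarrow>
    far F x y \<in> Hom V (A x y) (B (F x) (F y))"
  by (auto simp: is_vfunctor_def)

lemma vfunctor_El [simp]: "is_vfunctor A B F \<Longrightarrow> x \<in> VOb A \<Longrightarrow> y \<in> VOb A \<Longrightarrow> f \<in> El (A x y) \<Longrightarrow>
    lin (far F x y) f \<in> El (B (F x) (F y))"
  by (rule lin_El[OF vfunctor_far])

lemma vfunctor_one_el [simp]:
  "is_vfunctor A B F \<Longrightarrow> x \<in> VOb A \<Longrightarrow> lin (far F x x) (one_el A x) = one_el B (F x)"
  by (auto simp: is_vfunctor_def one_el_def lin_def)

lemma vfunctor_cmp_el: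
  assumes "is_vcat A" "is_vcat B" "is_vfunctor A B F" "x \<in> VOb A" "y \<in> VOb A" "z \<in> VOb A"
    "g \<in> El (A y z)" "f \<in> El (A x y)"
  shows "lin (far F x z) (cmp_el A x y z g f) =
    cmp_el B (F x) (F y) (F z) (lin (far F y z) g) (lin (far F x y) f)"
proof -
  have "far F x z \<cdot> VCmp A x y z = VCmp B (F x) (F y) (F z) \<cdot> (far F y z \<oslash> far F x y)"
    using assms by (simp add: is_vfunctor_def)
  then show ?thesis unfolding cmp_el_def using assms
    by (simp add: lin_bil[OF vcat_cmp vfunctor_far] bil_lin_lin[OF vcat_cmp vfunctor_far vfunctor_far])
qed

lemmas vfunctor_simps = vfunctor_ob vfunctor_El

lemma is_vfunctorI:
  fixes F :: "('x, 'y, 'a) vfunctor"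
  assumes A: "is_vcat A" and B: "is_vcat B"
    and o: "\<And>x. x \<in> VOb A \<Longrightarrow> F x \<in> VOb B"
    and a: "\<And>x y. x \<in> VOb A \<Longrightarrow> y \<in> VOb A \<Longrightarrow> far F x y \<in> Hom V (A x y) (B (F x) (F y))"
    and i: "\<And>x. x \<in> VOb A \<Longrightarrow> lin (far F x x) (one_el A x) = one_el B (F x)"
    and c: "\<And>x y z g f. \<lbrakk>x \<in> VOb A; y \<in> VOb A; z \<in> VOb A; g \<in> El (A y z); f \<in> El (A x y)\<rbrakk> \<Longrightarrow>
      lin (far F x z) (cmp_el A x y z g f) = cmp_el B (F x) (F y) (F z) (lin (far F y z) g) (lin (far F x y) f)"
  shows "is_vfunctor A B F"
  unfolding is_vfunctor_def
proof (intro conjI ballI)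
  fix x assume "x \<in> VOb A"
  then show "far F x x \<cdot> VId A x = VId B (F x)" using i[of x] by (simp add: one_el_def lin_def)
next
  fix x y z assume xyz: "x \<in> VOb A" "y \<in> VOb A" "z \<in> VOb A"
  let ?g = "gen (A y z)" and ?f = "gen (A x y)"
  have g: "?g \<in> El (A y z)" and f: "?f \<in> El (A x y)" using A xyz by simp_all
  show "far F x z \<cdot> VCmp A x y z = VCmp B (F x) (F y) (F z) \<cdot> (far F y z \<oslash> far F x y)"
  proof (rule bil_ext[OF _ _ g f])
    show "bil (far F x z \<cdot> VCmp A x y z) ?g ?f
      = bil (VCmp B (F x) (F y) (F z) \<cdot> (far F y z \<oslash> far F x y)) ?g ?f"
      using c[OF xyz g f] A B xyz f g unfolding cmp_el_def
      by (simp add: lin_bil[OF vcat_cmp a] bil_lin_lin[OF vcat_cmp a a] o)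
  qed (use A B xyz a o vcat_cmp[OF A xyz] vcat_cmp[OF B o o o] in \<open>simp_all add: in_Hom\<close>)
qed (use o a in auto)

lemma comp_simps [simp]: "(G \<circ>\<^sub>V F) x = G (F x)"
    "far (G \<circ>\<^sub>V F) x y = far G (F x) (F y) \<cdot> far F x y"
  by (simp_all add: vfunctor_comp_def)

lemma lin_comp:
  assumes "is_vfunctor A B F" "is_vfunctor B C G" "x \<in> VOb A" "y \<in> VOb A" "f \<in> El (A x y)"
  shows "lin (far G (F x) (F y) \<cdot> far F x y) f = lin (far G (F x) (F y)) (lin (far F x y) f)"
  using assms by (subst lin_lin[OF vfunctor_far vfunctor_far]) auto

lemma vfunctor_comp:
  assumes "is_vcat A" "is_vcat B" "is_vcat C" "is_vfunctor A B F" "is_vfunctor B C G"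
  shows "is_vfunctor A C (G \<circ>\<^sub>V F)"
proof (rule is_vfunctorI)
  fix x y assume "x \<in> VOb A" "y \<in> VOb A"
  then show "far (G \<circ>\<^sub>V F) x y \<in> Hom V (A x y) (C ((G \<circ>\<^sub>V F) x) ((G \<circ>\<^sub>V F) y))"
    using assms vfunctor_far[OF assms(4), of x y] vfunctor_far[OF assms(5), of "F x" "F y"]
    by (simp add: in_Hom)
qed (use assms in \<open>simp_all add: lin_comp[OF assms(4,5)] vfunctor_cmp_el[OF assms(1,2,4)] vfunctor_cmp_el[OF assms(2,3,5)]\<close>)

text \<open>A point has empty context, so that the unit isomorphisms of the definition disappear.\<close>

lemma is_vnat_iff:
  assumes A: "is_vcat A" and B: "is_vcat B" and F: "is_vfunctor A B F" and G: "is_vfunctor A B G"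
  shows "is_vnat A B F G t \<longleftrightarrow>
    (\<forall>x\<in>VOb A. t x \<in> Hom V \<I> (B (F x) (G x))) \<and>
    (\<forall>x\<in>VOb A. \<forall>y\<in>VOb A. \<forall>f\<in>El (A x y).
      cmp_el B (F x) (F y) (G y) ([], t y) (lin (far F x y) f) =
      cmp_el B (F x) (G x) (G y) (lin (far G x y) f) ([], t x))"
proof -
  { assume t: "\<forall>x\<in>VOb A. t x \<in> Hom V \<I> (B (F x) (G x))"
    fix x y assume o: "x \<in> VOb A" "y \<in> VOb A"
    note ty = t[rule_format, OF o(2)] and tx = t[rule_format, OF o(1)]
    note fx = vfunctor_far[OF F o] and gx = vfunctor_far[OF G o]
    have o': "F x \<in> VOb B" "F y \<in> VOb B" "G x \<in> VOb B" "G y \<in> VOb B"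
      using o F G by auto
    note c1 = vcat_cmp[OF B o'(1,2,4)] and c2 = vcat_cmp[OF B o'(1,3,4)]
    let ?L = "VCmp B (F x) (F y) (G y) \<cdot> (t y \<oslash> far F x y) \<cdot> inv (LUn V (A x y))"
    let ?R = "VCmp B (F x) (G x) (G y) \<cdot> (far G x y \<oslash> t x) \<cdot> inv (RUn V (A x y))"
    have l: "cmp_el B (F x) (F y) (G y) ([], t y) (lin (far F x y) f) = lin ?L f"
      and r: "cmp_el B (F x) (G x) (G y) (lin (far G x y) f) ([], t x) = lin ?R f"
      if f: "f \<in> El (A x y)" for f
    proof -
      have ob: "A x y \<in> Ob V" "B (F y) (G y) \<in> Ob V" "B (F x) (G x) \<in> Ob V"
        using A B o o' by simp_all
      have m1: "VCmp B (F x) (F y) (G y) \<cdot> (\<one> (B (F y) (G y)) \<oslash> far F x y)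
        \<in> Hom V (B (F y) (G y) \<otimes> A x y) (B (F x) (G y))"
        using c1 fx ob by (simp add: in_Hom)
      show "cmp_el B (F x) (F y) (G y) ([], t y) (lin (far F x y) f) = lin ?L f"
        unfolding cmp_el_def using ty fx c1 ob
        by (subst bil_lin_right[OF c1 fx point_El[OF ty] f], subst bil_point_left[OF m1 ty f])
          (simp add: in_Hom)
      have m2: "VCmp B (F x) (G x) (G y) \<cdot> (far G x y \<oslash> \<one> (B (F x) (G x)))
        \<in> Hom V (A x y \<otimes> B (F x) (G x)) (B (F x) (G y))"
        using c2 gx ob by (simp add: in_Hom)
      show "cmp_el B (F x) (G x) (G y) (lin (far G x y) f) ([], t x) = lin ?R f"
        unfolding cmp_el_def using tx gx c2 ob
        by (subst bil_lin_left[OF c2 gx f point_El[OF tx]], subst bil_point_right[OF m2 tx f])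
          (simp add: in_Hom)
    qed
    have h: "?L \<in> Hom V (A x y) (B (F x) (G y))" "?R \<in> Hom V (A x y) (B (F x) (G y))"
      using c1 c2 fx gx tx ty A o by (simp_all add: in_Hom)
    have "?L = ?R \<longleftrightarrow> (\<forall>f\<in>El (A x y).
      cmp_el B (F x) (F y) (G y) ([], t y) (lin (far F x y) f) =
      cmp_el B (F x) (G x) (G y) (lin (far G x y) f) ([], t x))"
    proof
      assume r': "\<forall>f\<in>El (A x y).
        cmp_el B (F x) (F y) (G y) ([], t y) (lin (far F x y) f) =
        cmp_el B (F x) (G x) (G y) (lin (far G x y) f) ([], t x)"
      have g: "gen (A x y) \<in> El (A x y)" using A o by simp
      from r'[rule_format, OF g] have "lin ?L (gen (A x y)) = lin ?R (gen (A x y))"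
        unfolding l[OF g] r[OF g] .
      then show "?L = ?R" by (rule lin_ext[OF h])
    qed (simp add: l r) }
  then show ?thesis unfolding is_vnat_def by (intro conj_cong refl ball_cong) auto
qed

lemma vnatD:
  assumes A: "is_vcat A" and B: "is_vcat B" and F: "is_vfunctor A B F" and G: "is_vfunctor A B G" and t: "is_vnat A B F G t"
  shows "x \<in> VOb A \<Longrightarrow> t x \<in> Hom V \<I> (B (F x) (G x))"
    "x \<in> VOb A \<Longrightarrow> ([], t x) \<in> El (B (F x) (G x))"
    "x \<in> VOb A \<Longrightarrow> y \<in> VOb A \<Longrightarrow> f \<in> El (A x y) \<Longrightarrow>
      cmp_el B (F x) (F y) (G y) ([], t y) (lin (far F x y) f) =
      cmp_el B (F x) (G x) (G y) (lin (far G x y) f) ([], t x)"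
  using t point_El unfolding is_vnat_iff[OF A B F G] by blast+

lemma self_simps [simp]: "VOb \<V> = Ob V" "VHom \<V> = IHom V"
  by (simp_all add: self_def)

lemma self_cmp:
  assumes [simp]: "x \<in> Ob V" "y \<in> Ob V" "z \<in> Ob V"
  shows "VCmp \<V> x y z \<in> Hom V (IHom V y z \<otimes> IHom V x y) (IHom V x z)"
    "Ev V x z \<cdot> (VCmp \<V> x y z \<oslash> \<one> x) =
      Ev V y z \<cdot> (\<one> (IHom V y z) \<oslash> Ev V x y) \<cdot> Asc V (IHom V y z) (IHom V x y) x"
proof -
  have "Ev V y z \<cdot> (\<one> (IHom V y z) \<oslash> Ev V x y) \<cdot> Asc V (IHom V y z) (IHom V x y) x
    \<in> Hom V ((IHom V y z \<otimes> IHom V x y) \<otimes> x) z" by (simp add: in_Hom)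
  from Curry_Hom[OF this]
  show "VCmp \<V> x y z \<in> Hom V (IHom V y z \<otimes> IHom V x y) (IHom V x z)"
    "Ev V x z \<cdot> (VCmp \<V> x y z \<oslash> \<one> x) =
      Ev V y z \<cdot> (\<one> (IHom V y z) \<oslash> Ev V x y) \<cdot> Asc V (IHom V y z) (IHom V x y) x"
    by (simp_all add: self_def)
qed

text \<open>Composition in the base is composition of functions. With \<open>ap_ext\<close> this reduces every equation in the
  enriched category \<open>\<V>\<close> to one between applications.\<close>

lemma ap_self_cmp:
  assumes [simp]: "x \<in> Ob V" "y \<in> Ob V" "z \<in> Ob V" and "g \<in> El (IHom V y z)" "f \<in> El (IHom V x y)" "w \<in> El x"
  shows "ap x z (cmp_el \<V> x y z g f) w = ap y z g (ap x y f w)"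
  unfolding ap_def cmp_el_def
  by (rule bil_assoc[OF self_cmp(2)[OF assms(1-3)] ev[OF assms(1,3)] self_cmp(1)[OF assms(1-3)]
        ev[OF assms(2,3)] ev[OF assms(1,2)] assms(4-6)])

lemma ap_self_one: "w \<in> El x \<Longrightarrow> ap x x (one_el \<V> x) w = w"
  using name_Hom(2)[of "\<one> x" x x w] El_ob[of w x] by (simp add: one_el_def self_def lin_one in_Hom)

lemma self_id: "x \<in> Ob V \<Longrightarrow> VId \<V> x \<in> Hom V \<I> (IHom V x x)"
  using name_Hom(1)[of "\<one> x" x x] by (simp add: self_def in_Hom)

lemma self_one_el_El [simp]: "x \<in> Ob V \<Longrightarrow> one_el \<V> x \<in> El (IHom V x x)"
  unfolding one_el_def by (intro point_El self_id)

lemma self_cmp_el_El [simp]: "\<lbrakk>x \<in> Ob V; y \<in> Ob V; z \<in> Ob V; g \<in> El (IHom V y z); f \<in> El (IHom V x y)\<rbrakk> \<Longrightarrow>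
  cmp_el \<V> x y z g f \<in> El (IHom V x z)"
  unfolding cmp_el_def by (rule bil_El[OF self_cmp(1)])

lemma is_vcat_self [simp]: "is_vcat \<V>"
proof (rule is_vcatI)
  fix w x y z h g f
  assume a: "w \<in> VOb \<V>" "x \<in> VOb \<V>" "y \<in> VOb \<V>" "z \<in> VOb \<V>"
    "h \<in> El (\<V> y z)" "g \<in> El (\<V> x y)" "f \<in> El (\<V> w x)"
  show "cmp_el \<V> w x z (cmp_el \<V> x y z h g) f = cmp_el \<V> w y z h (cmp_el \<V> w x y g f)"
    using a by - (rule ap_ext[of _ w z], simp_all add: self_cmp_el_El ap_self_cmp ap_El)
next
  fix x y f assume a: "x \<in> VOb \<V>" "y \<in> VOb \<V>" "f \<in> El (\<V> x y)"
  show "cmp_el \<V> x y y (one_el \<V> y) f = f"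
    using a by - (rule ap_ext[of _ x y], simp_all add: self_cmp_el_El ap_self_cmp ap_El self_one_el_El ap_self_one)
  show "cmp_el \<V> x x y f (one_el \<V> x) = f"
    using a by - (rule ap_ext[of _ x y], simp_all add: self_cmp_el_El ap_self_cmp ap_El self_one_el_El ap_self_one)
qed (simp_all add: self_id self_cmp)

lemma covariant_fob [simp]: "(covariant_hom A c) x = A c x"
  by (simp add: covariant_hom_def)

lemma covariant_far:
  assumes "is_vcat A" "c \<in> VOb A" "x \<in> VOb A" "y \<in> VOb A"
  shows "far (covariant_hom A c) x y \<in> Hom V (A x y) (IHom V (A c x) (A c y))"
  using Curry_Hom[OF vcat_cmp[OF assms]] assms by (simp add: covariant_hom_def)

lemma ap_covariant:
  assumes "is_vcat A" "c \<in> VOb A" "x \<in> VOb A" "y \<in> VOb A" "g \<in> El (A x y)" "w \<in> El (A c x)"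
  shows "ap (A c x) (A c y) (lin (far (covariant_hom A c) x y) g) w = cmp_el A c x y g w"
  using ap_Curry[OF vcat_cmp[OF assms(1-4)] assms(5,6)] by (simp add: covariant_hom_def cmp_el_def)

lemma vfunctor_covariant:
  assumes A: "is_vcat A" "c \<in> VOb A"
  shows "is_vfunctor A \<V> (covariant_hom A c)"
proof (rule is_vfunctorI)
  fix x assume x: "x \<in> VOb A"
  show "lin (far (covariant_hom A c) x x) (one_el A x) = one_el \<V> ((covariant_hom A c) x)"
    using x assms lin_El[OF covariant_far[OF A x x] one_el_El[OF A(1) x]]
    by - (rule ap_ext[of _ "A c x" "A c x"], simp_all add: ap_covariant self_one_el_El ap_self_one)
next
  fix x y z g f assume x: "x \<in> VOb A" "y \<in> VOb A" "z \<in> VOb A" and g: "g \<in> El (A y z)" "f \<in> El (A x y)"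
  show "lin (far (covariant_hom A c) x z) (cmp_el A x y z g f) =
    cmp_el \<V> ((covariant_hom A c) x) ((covariant_hom A c) y) ((covariant_hom A c) z)
      (lin (far (covariant_hom A c) y z) g) (lin (far (covariant_hom A c) x y) f)"
    using x assms g lin_El[OF covariant_far[OF A x(1,3)] cmp_el_El[OF A(1) x g]]
      lin_El[OF covariant_far[OF A x(2,3)] g(1)] lin_El[OF covariant_far[OF A x(1,2)] g(2)]
    by - (rule ap_ext[of _ "A c x" "A c z"],
        simp_all add: ap_covariant self_cmp_el_El ap_self_cmp cmp_el_assoc)
qed (use assms covariant_far[OF A] in simp_all)

lemma contravariant_far:
  assumes "is_vcat C" "c \<in> VOb C" "x \<in> VOb C" "y \<in> VOb C"
  shows "far (contravariant_hom C c) x y \<in> Hom V (C y x) (IHom V (C x c) (C y c))"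
    "Ev V (C x c) (C y c) \<cdot> (far (contravariant_hom C c) x y \<oslash> \<one> (C x c)) =
      VCmp C y x c \<cdot> Sym V (C y x) (C x c)"
proof -
  have "VCmp C y x c \<cdot> Sym V (C y x) (C x c) \<in> Hom V (C y x \<otimes> C x c) (C y c)"
    using assms vcat_cmp[of C y x c] by (simp add: in_Hom)
  from Curry_Hom[OF this] assms
  show "far (contravariant_hom C c) x y \<in> Hom V (C y x) (IHom V (C x c) (C y c))"
    "Ev V (C x c) (C y c) \<cdot> (far (contravariant_hom C c) x y \<oslash> \<one> (C x c)) =
      VCmp C y x c \<cdot> Sym V (C y x) (C x c)"
    by (simp_all add: contravariant_hom_def)
qed

lemma hom_along_fob [simp]: "(hom_along C D c) b = C (D b) c"
  by (simp add: hom_along_def contravariant_hom_def vop_functor_def)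

lemma hom_along_far:
  assumes "is_vcat B" "is_vcat C" "is_vfunctor B C D" "c \<in> VOb C" "a \<in> VOb B" "b \<in> VOb B"
  shows "far (hom_along C D c) a b \<in> Hom V (B b a) (IHom V (C (D a) c) (C (D b) c))"
    "Ev V (C (D a) c) (C (D b) c) \<cdot> (far (hom_along C D c) a b \<oslash> \<one> (C (D a) c)) =
      (VCmp C (D b) (D a) c \<cdot> (\<one> (C (D a) c) \<oslash> far D b a)) \<cdot> Sym V (B b a) (C (D a) c)"
proof -
  let ?x = "D a" and ?y = "D b"
  have o [simp]: "?x \<in> VOb C" "?y \<in> VOb C" "C ?x c \<in> Ob V" "C ?y c \<in> Ob V" "C ?y ?x \<in> Ob V" using assms by auto
  note c = contravariant_far[OF assms(2,4) o(1,2)]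
  note [simp] = c(1)[unfolded in_Hom] vfunctor_far[OF assms(3,6,5), unfolded in_Hom]
    vcat_cmp[OF assms(2) o(2,1) assms(4), unfolded in_Hom]
  have e: "far (hom_along C D c) a b = far (contravariant_hom C c) ?x ?y \<cdot> far D b a"
    by (simp add: hom_along_def vop_functor_def)
  show "far (hom_along C D c) a b \<in> Hom V (B b a) (IHom V (C ?x c) (C ?y c))"
    unfolding e by (simp add: in_Hom)
  have "Ev V (C ?x c) (C ?y c) \<cdot> (far (hom_along C D c) a b \<oslash> \<one> (C ?x c))
    = (Ev V (C ?x c) (C ?y c) \<cdot> (far (contravariant_hom C c) ?x ?y \<oslash> \<one> (C ?x c))) \<cdot> (far D b a \<oslash> \<one> (C ?x c))"
    unfolding e by simp
  also have "\<dots> = VCmp C ?y ?x c \<cdot> (Sym V (C ?y ?x) (C ?x c) \<cdot> (far D b a \<oslash> \<one> (C ?x c)))"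
    unfolding c(2) by simp
  also have "\<dots> = VCmp C ?y ?x c \<cdot> ((\<one> (C ?x c) \<oslash> far D b a) \<cdot> Sym V (B b a) (C ?x c))"
    using nat_sym[of "far D b a" "\<one> (C ?x c)"] by simp
  finally show "Ev V (C ?x c) (C ?y c) \<cdot> (far (hom_along C D c) a b \<oslash> \<one> (C ?x c)) =
    (VCmp C ?y ?x c \<cdot> (\<one> (C ?x c) \<oslash> far D b a)) \<cdot> Sym V (B b a) (C ?x c)"
    using assms by simp
qed

definition uncurry :: "'o \<Rightarrow> 'o \<Rightarrow> 'a \<Rightarrow> 'a" where
  "uncurry y z t = Ev V y z \<cdot> (t \<oslash> \<one> y)"

lemma uncurry_Hom:
  assumes "t \<in> Hom V x (IHom V y z)" "y \<in> Ob V" "z \<in> Ob V"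
  shows "uncurry y z t \<in> Hom V (x \<otimes> y) z"
  using assms by (simp add: uncurry_def in_Hom)

lemma bil_uncurry:
  assumes "t \<in> Hom V x (IHom V y z)" "y \<in> Ob V" "z \<in> Ob V" "k \<in> El x" "w \<in> El y"
  shows "bil (uncurry y z t) k w = ap y z (lin t k) w"
  unfolding uncurry_def by (rule ap_lin[symmetric, OF assms(2,3,1,4,5)])

lemma uncurry_Curry: "p \<in> Hom V (x \<otimes> y) z \<Longrightarrow> x \<in> Ob V \<Longrightarrow> y \<in> Ob V \<Longrightarrow> uncurry y z (Curry x y p) = p"
  unfolding uncurry_def by (rule Curry_Hom(2))

text \<open>The symmetries in the naturality condition of the definitions come from the opposite category and
  from contravariant hom-functors, where \<open>g\<close> and \<open>w\<close> are the actions of \<open>P\<close> transposed with a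
  symmetry. After transposition both sides end in the same isomorphism, by the hexagon, and what remains
  is a condition without symmetries.\<close>

lemma transpose_naturality:
  assumes [simp]: "K \<in> Ob V" "M \<in> Ob V" "N \<in> Ob V" "A \<in> Ob V" "B \<in> Ob V" "P \<in> Ob V"
    and "Ea \<in> Hom V K (IHom V M A)" "Eb \<in> Hom V K (IHom V N B)"
    and "ga \<in> Hom V P (IHom V A B)" "wa \<in> Hom V P (IHom V M N)"
    and "p \<in> Hom V (A \<otimes> P) B" "q \<in> Hom V (M \<otimes> P) N"
    and g: "Ev V A B \<cdot> (ga \<oslash> \<one> A) = p \<cdot> Sym V P A"
    and w: "Ev V M N \<cdot> (wa \<oslash> \<one> M) = q \<cdot> Sym V P M"
  shows "VCmp \<V> M A B \<cdot> (ga \<oslash> Ea) = VCmp \<V> M N B \<cdot> (Eb \<oslash> wa) \<cdot> Sym V P K \<longleftrightarrow>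
    p \<cdot> (uncurry M A Ea \<oslash> \<one> P) = uncurry N B Eb \<cdot> (\<one> K \<oslash> q) \<cdot> Asc V K M P"
    (is "?L = ?R \<longleftrightarrow> ?l = ?r")
proof -
  note [simp] = assms(7-12)[unfolded in_Hom] self_cmp(1)[OF assms(2,4,5), unfolded in_Hom]
    self_cmp(1)[OF assms(2,3,5), unfolded in_Hom]
  \<comment> \<open>The isomorphism in which the transposes of both sides end.\<close>
  let ?S = "Sym V P (K \<otimes> M) \<cdot> Asc V P K M"
  have "Ev V M B \<cdot> (?L \<oslash> \<one> M) = (Ev V M B \<cdot> (VCmp \<V> M A B \<oslash> \<one> M)) \<cdot> ((ga \<oslash> Ea) \<oslash> \<one> M)"
    by simp
  also have "\<dots> = Ev V A B \<cdot> (\<one> (IHom V A B) \<oslash> Ev V M A) \<cdot> (Asc V (IHom V A B) (IHom V M A) M \<cdot> ((ga \<oslash> Ea) \<oslash> \<one> M))"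
    by (simp add: self_cmp(2))
  also have "\<dots> = Ev V A B \<cdot> (\<one> (IHom V A B) \<oslash> Ev V M A) \<cdot> ((ga \<oslash> (Ea \<oslash> \<one> M)) \<cdot> Asc V P K M)"
    by (subst nat_asc) simp_all
  also have "\<dots> = (Ev V A B \<cdot> (ga \<oslash> \<one> A)) \<cdot> (\<one> P \<oslash> uncurry M A Ea) \<cdot> Asc V P K M"
    by (simp add: uncurry_def)
  also have "\<dots> = p \<cdot> (Sym V P A \<cdot> (\<one> P \<oslash> uncurry M A Ea)) \<cdot> Asc V P K M"
    unfolding g by (simp add: uncurry_def)
  also have "\<dots> = p \<cdot> ((uncurry M A Ea \<oslash> \<one> P) \<cdot> Sym V P (K \<otimes> M)) \<cdot> Asc V P K M"
    using nat_sym[of "\<one> P" "uncurry M A Ea"] by (simp add: uncurry_def)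
  also have "\<dots> = ?l \<cdot> ?S" by (simp add: uncurry_def)
  finally have L: "Ev V M B \<cdot> (?L \<oslash> \<one> M) = ?l \<cdot> ?S" .
  have "Ev V M B \<cdot> (?R \<oslash> \<one> M) = (Ev V M B \<cdot> (VCmp \<V> M N B \<oslash> \<one> M)) \<cdot> ((Eb \<oslash> wa) \<oslash> \<one> M) \<cdot> (Sym V P K \<oslash> \<one> M)"
    by simp
  also have "\<dots> = Ev V N B \<cdot> (\<one> (IHom V N B) \<oslash> Ev V M N) \<cdot> (Asc V (IHom V N B) (IHom V M N) M \<cdot> ((Eb \<oslash> wa) \<oslash> \<one> M)) \<cdot> (Sym V P K \<oslash> \<one> M)"
    by (simp add: self_cmp(2) del: ten_merge)
  also have "\<dots> = Ev V N B \<cdot> (\<one> (IHom V N B) \<oslash> Ev V M N) \<cdot> ((Eb \<oslash> (wa \<oslash> \<one> M)) \<cdot> Asc V K P M) \<cdot> (Sym V P K \<oslash> \<one> M)"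
    by (subst nat_asc) simp_all
  also have "\<dots> = uncurry N B Eb \<cdot> (\<one> K \<oslash> (Ev V M N \<cdot> (wa \<oslash> \<one> M))) \<cdot> Asc V K P M \<cdot> (Sym V P K \<oslash> \<one> M)"
    by (simp add: uncurry_def)
  also have "\<dots> = uncurry N B Eb \<cdot> (\<one> K \<oslash> q) \<cdot> ((\<one> K \<oslash> Sym V P M) \<cdot> Asc V K P M \<cdot> (Sym V P K \<oslash> \<one> M))"
    unfolding w by (simp add: uncurry_def)
  also have "\<dots> = uncurry N B Eb \<cdot> (\<one> K \<oslash> q) \<cdot> (Asc V K M P \<cdot> ?S)"
    by (subst hexagon) simp_all
  also have "\<dots> = ?r \<cdot> ?S" by (simp add: uncurry_def)
  finally have R: "Ev V M B \<cdot> (?R \<oslash> \<one> M) = ?r \<cdot> ?S" .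
  show ?thesis
  proof
    assume "?L = ?R"
    then have "?l \<cdot> ?S = ?r \<cdot> ?S" using L R by simp
    then show "?l = ?r" by (rule iso_epi[rotated -1]) (simp_all add: uncurry_def)
  next
    assume "?l = ?r"
    then have "Ev V M B \<cdot> (?L \<oslash> \<one> M) = Ev V M B \<cdot> (?R \<oslash> \<one> M)" unfolding L R by simp
    then show "?L = ?R" by - (rule Curry_unique[of _ "P \<otimes> K" M B], simp_all add: in_Hom)
  qed
qed

text \<open>Transformations are the case \<open>k = I\<close> of indexed ones; the two definitions differ by a symmetry with
  \<open>I\<close>, which is a composite of unit isomorphisms.\<close>

lemma is_vnat_indexed:
  fixes F G :: "('x, 'y, 'a) vfunctor" and B :: "('y, 'o, 'a) vcat"
  assumes "\<And>a. a \<in> VOb A \<Longrightarrow> t a \<in> Hom V \<I> (B (F a) (G a))"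
    and "\<And>a b. a \<in> VOb A \<Longrightarrow> b \<in> VOb A \<Longrightarrow> A a b \<in> Ob V"
    and "\<And>a b. a \<in> VOb A \<Longrightarrow> b \<in> VOb A \<Longrightarrow> far F a b \<in> Hom V (A a b) (B (F a) (F b))"
    and "\<And>a b. a \<in> VOb A \<Longrightarrow> b \<in> VOb A \<Longrightarrow> far G a b \<in> Hom V (A a b) (B (G a) (G b))"
    and "\<And>a b. a \<in> VOb A \<Longrightarrow> F a \<in> VOb B" "\<And>a b. a \<in> VOb A \<Longrightarrow> G a \<in> VOb B"
    and B: "is_vcat B"
  shows "is_vnat A B F G t \<longleftrightarrow> indexed_vnat A B F G \<I> t"
proof -
  { fix x y assume o: "x \<in> VOb A" "y \<in> VOb A"
    note [simp] = assms(2)[OF o] assms(3,4)[OF o, unfolded in_Hom] assms(1)[OF o(1), unfolded in_Hom] assms(1)[OF o(2), unfolded in_Hom]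
      vcat_cmp[OF B assms(5)[OF o(1)] assms(5)[OF o(2)] assms(6)[OF o(2)], unfolded in_Hom]
      vcat_cmp[OF B assms(5)[OF o(1)] assms(6)[OF o(1)] assms(6)[OF o(2)], unfolded in_Hom]
    let ?P = "A x y"
    let ?l = "VCmp B (F x) (F y) (G y) \<cdot> (t y \<oslash> far F x y)"
      and ?r = "VCmp B (F x) (G x) (G y) \<cdot> (far G x y \<oslash> t x)"
    have "inv (LUn V ?P) \<cdot> RUn V ?P = inv (LUn V ?P) \<cdot> (LUn V ?P \<cdot> Sym V ?P \<I>)"
      by (simp add: sym_unt)
    then have s: "inv (LUn V ?P) \<cdot> RUn V ?P = Sym V ?P \<I>" by simp
    have "(?l \<cdot> inv (LUn V ?P) = ?r \<cdot> inv (RUn V ?P)) = (?r = ?l \<cdot> Sym V ?P \<I>)"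
    proof
      assume "?l \<cdot> inv (LUn V ?P) = ?r \<cdot> inv (RUn V ?P)"
      then have "(?l \<cdot> inv (LUn V ?P)) \<cdot> RUn V ?P = (?r \<cdot> inv (RUn V ?P)) \<cdot> RUn V ?P" by (simp del: assoc)
      then show "?r = ?l \<cdot> Sym V ?P \<I>" by (simp add: s)
    next
      assume *: "?r = ?l \<cdot> Sym V ?P \<I>"
      have "?r \<cdot> inv (RUn V ?P) = (?l \<cdot> (inv (LUn V ?P) \<cdot> RUn V ?P)) \<cdot> inv (RUn V ?P)"
        unfolding s by (subst *) simp
      also have "\<dots> = ?l \<cdot> inv (LUn V ?P)" by simp
      finally show "?l \<cdot> inv (LUn V ?P) = ?r \<cdot> inv (RUn V ?P)" by simp
    qed
    then have "(VCmp B (F x) (F y) (G y) \<cdot> (t y \<oslash> far F x y) \<cdot> inv (LUn V ?P)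
        = VCmp B (F x) (G x) (G y) \<cdot> (far G x y \<oslash> t x) \<cdot> inv (RUn V ?P))
      = (?r = VCmp B (F x) (F y) (G y) \<cdot> (t y \<oslash> far F x y) \<cdot> Sym V ?P \<I>)" by simp }
  then show ?thesis unfolding is_vnat_def indexed_vnat_def
    by (intro conj_cong ball_cong refl) auto
qed

end

section \<open>Colimits weighted by Kan weights\<close>

text \<open>The monoidal structure of \<open>j\<close> enters through an object \<open>U\<close> with \<open>jU\<close> isomorphic to \<open>I\<close>.\<close>

locale arity_system = smcc V for V :: "('o, 'a) smcc" (structure) +
  fixes J :: "('x, 'o, 'a) vcat" and j :: "('x, 'o, 'a) vfunctor"
  assumes J [simp]: "is_vcat J" and j [simp]: "is_vfunctor J \<V> j"
    and ff: "fully_faithful J j"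
    and unit_arity: "\<exists>U\<in>VOb J. \<exists>i. i \<in> Hom V \<I> (j U) \<and> iso_arr V i"
begin

abbreviation W :: "'o \<Rightarrow> 'x \<Rightarrow> 'o" where
  "W v b \<equiv> IHom V (j b) v"

text \<open>The action \<open>w \<cdot> jf\<close> of an element \<open>f\<close> of \<open>J(a,b)\<close> on an element \<open>w\<close> of the weight at
  \<open>b\<close>.\<close>

abbreviation act :: "'x \<Rightarrow> 'x \<Rightarrow> 'o \<Rightarrow> 'o list \<times> 'a \<Rightarrow> 'o list \<times> 'a \<Rightarrow> 'o list \<times> 'a" where
  "act a b v w f \<equiv> cmp_el \<V> (j a) (j b) v w (lin (far j a b) f)"

lemma j_ob [simp]: "b \<in> VOb J \<Longrightarrow> j b \<in> Ob V"
  using vfunctor_ob[OF j] by simp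

lemma j_El [simp]: "a \<in> VOb J \<Longrightarrow> b \<in> VOb J \<Longrightarrow> f \<in> El (J a b) \<Longrightarrow>
    lin (far j a b) f \<in> El (IHom V (j a) (j b))"
  using vfunctor_El[OF j] by simp

definition cone :: "'o \<Rightarrow> ('y, 'o, 'a) vcat \<Rightarrow> ('x, 'y, 'a) vfunctor \<Rightarrow> 'y \<Rightarrow> ('x \<Rightarrow> 'a) \<Rightarrow> bool" where
  "cone v C D c r \<longleftrightarrow>
    (\<forall>b\<in>VOb J. r b \<in> Hom V (W v b) (C (D b) c)) \<and>
    (\<forall>a\<in>VOb J. \<forall>b\<in>VOb J. \<forall>w\<in>El (W v b). \<forall>f\<in>El (J a b).
      lin (r a) (act a b v w f) = cmp_el C (D a) (D b) c (lin (r b) w) (lin (far D a b) f))"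

text \<open>A cocone with a parameter in \<open>k\<close>, that is, a transformation indexed by \<open>k\<close> in uncurried form. Unlike
  transposes, this form mentions no internal hom with values in \<open>C\<close>.\<close>

definition indexed_cone :: "'o \<Rightarrow> ('y, 'o, 'a) vcat \<Rightarrow> ('x, 'y, 'a) vfunctor \<Rightarrow> 'y \<Rightarrow> 'o \<Rightarrow> ('x \<Rightarrow> 'a) \<Rightarrow> bool" where
  "indexed_cone v C D c k T \<longleftrightarrow>
    (\<forall>b\<in>VOb J. T b \<in> Hom V (k \<otimes> W v b) (C (D b) c)) \<and>
    (\<forall>a\<in>VOb J. \<forall>b\<in>VOb J. \<forall>\<kappa>\<in>El k. \<forall>w\<in>El (W v b). \<forall>f\<in>El (J a b).
      bil (T a) \<kappa> (act a b v w f) = cmp_el C (D a) (D b) c (bil (T b) \<kappa> w) (lin (far D a b) f))"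

text \<open>The colimit of \<open>D\<close> weighted by the Kan weight of \<open>v\<close>; the equivalence with the given definition is
  \<open>weighted_colimit_iff\<close>.\<close>

definition Kan_colimit :: "'o \<Rightarrow> ('y, 'o, 'a) vcat \<Rightarrow> ('x, 'y, 'a) vfunctor \<Rightarrow> 'y \<Rightarrow> ('x \<Rightarrow> 'a) \<Rightarrow> bool" where
  "Kan_colimit v C D c r \<longleftrightarrow> c \<in> VOb C \<and> cone v C D c r \<and>
    (\<forall>x\<in>VOb C. \<forall>k\<in>Ob V. \<forall>T. indexed_cone v C D x k T \<longrightarrow>
      (\<exists>!h. h \<in> Hom V k (C c x) \<and> (\<forall>b\<in>VOb J. VCmp C (D b) c x \<cdot> (h \<oslash> r b) = T b)))"

lemma act_arrow:
  assumes "a \<in> VOb J" "b \<in> VOb J" "v \<in> Ob V" "w \<in> El (W v b)" "f \<in> El (J a b)"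
  shows "act a b v w f = bil (VCmp \<V> (j a) (j b) v \<cdot> (\<one> (W v b) \<oslash> far j a b)) w f"
  unfolding cmp_el_def using assms
  by (intro bil_lin_right[OF self_cmp(1) vfunctor_far[OF j, simplified]]) simp_all

lemma cmp_el_arrow:
  assumes "is_vcat C" "is_vfunctor J C D" "a \<in> VOb J" "b \<in> VOb J" "x \<in> VOb C"
    "g \<in> El (C (D b) x)" "f \<in> El (J a b)"
  shows "cmp_el C (D a) (D b) x g (lin (far D a b) f) =
    bil (VCmp C (D a) (D b) x \<cdot> (\<one> (C (D b) x) \<oslash> far D a b)) g f"
  unfolding cmp_el_def using assms
  by (intro bil_lin_right[OF vcat_cmp vfunctor_far[OF assms(2)]]) simp_all

text \<open>Naturality at all elements is an equation between arrows, which in turn follows from naturality at one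
  invertible parameter \<open>\<kappa>\<^sub>0\<close>.\<close>

lemma indexed_cone_arrow_iff:
  assumes C: "is_vcat C" and D: "is_vfunctor J C D" and o: "v \<in> Ob V" "x \<in> VOb C" "k \<in> Ob V"
    and T: "\<And>b. b \<in> VOb J \<Longrightarrow> T b \<in> Hom V (k \<otimes> W v b) (C (D b) x)"
    and k0: "\<kappa>\<^sub>0 \<in> El k" "iso_arr V (snd \<kappa>\<^sub>0)" and ab: "a \<in> VOb J" "b \<in> VOb J"
  defines "E \<equiv> (VCmp C (D a) (D b) x \<cdot> (\<one> (C (D b) x) \<oslash> far D a b)) \<cdot> (T b \<oslash> \<one> (J a b)) =
      T a \<cdot> (\<one> k \<oslash> (VCmp \<V> (j a) (j b) v \<cdot> (\<one> (W v b) \<oslash> far j a b))) \<cdot> Asc V k (W v b) (J a b)"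
    and "N \<equiv> \<lambda>\<kappa> w f. bil (T a) \<kappa> (act a b v w f) = cmp_el C (D a) (D b) x (bil (T b) \<kappa> w) (lin (far D a b) f)"
  shows "E \<Longrightarrow> \<kappa> \<in> El k \<Longrightarrow> w \<in> El (W v b) \<Longrightarrow> f \<in> El (J a b) \<Longrightarrow> N \<kappa> w f"
    "(\<And>w f. w \<in> El (W v b) \<Longrightarrow> f \<in> El (J a b) \<Longrightarrow> N \<kappa>\<^sub>0 w f) \<Longrightarrow> E"
proof -
  have o': "D a \<in> VOb C" "D b \<in> VOb C" "j a \<in> Ob V" "j b \<in> Ob V"
    "J a b \<in> Ob V" "W v b \<in> Ob V" "C (D b) x \<in> Ob V"
    using ab D o C by auto
  let ?p = "VCmp C (D a) (D b) x \<cdot> (\<one> (C (D b) x) \<oslash> far D a b)"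
  let ?q = "VCmp \<V> (j a) (j b) v \<cdot> (\<one> (W v b) \<oslash> far j a b)"
  have p: "?p \<in> Hom V (C (D b) x \<otimes> J a b) (C (D a) x)"
    using vcat_cmp[OF C o'(1,2) o(2)] vfunctor_far[OF D ab] o' by (simp add: in_Hom)
  have q: "?q \<in> Hom V (W v b \<otimes> J a b) (W v a)"
    using self_cmp(1)[OF o'(3,4) o(1)] vfunctor_far[OF j ab] o' by (simp add: in_Hom)
  have N: "N \<kappa> w f \<longleftrightarrow> bil ?p (bil (T b) \<kappa> w) f = bil (T a) \<kappa> (bil ?q w f)"
    if "\<kappa> \<in> El k" "w \<in> El (W v b)" "f \<in> El (J a b)" for \<kappa> w f
    unfolding N_def act_arrow[OF ab o(1) that(2,3)]
      cmp_el_arrow[OF C D ab o(2) bil_El[OF T[OF ab(2)] that(1,2)] that(3)] by auto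
  show "E \<Longrightarrow> \<kappa> \<in> El k \<Longrightarrow> w \<in> El (W v b) \<Longrightarrow> f \<in> El (J a b) \<Longrightarrow> N \<kappa> w f"
    unfolding E_def by (subst N) (simp_all add: bil_assoc[OF _ p T[OF ab(2)] T[OF ab(1)] q])
  assume n: "\<And>w f. w \<in> El (W v b) \<Longrightarrow> f \<in> El (J a b) \<Longrightarrow> N \<kappa>\<^sub>0 w f"
  show E unfolding E_def
    by (rule tri_ext[OF p T[OF ab(2)] T[OF ab(1)] q k0(1) gen_El gen_El k0(2) gen_iso gen_iso])
      (use n N[OF k0(1)] o' in simp_all)
qed

lemma indexed_coneI:
  assumes "is_vcat C" "is_vfunctor J C D" "v \<in> Ob V" "x \<in> VOb C" "k \<in> Ob V"
    and "\<And>b. b \<in> VOb J \<Longrightarrow> T b \<in> Hom V (k \<otimes> W v b) (C (D b) x)"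
    and "\<kappa>\<^sub>0 \<in> El k" "iso_arr V (snd \<kappa>\<^sub>0)"
    and "\<And>a b w f. a \<in> VOb J \<Longrightarrow> b \<in> VOb J \<Longrightarrow> w \<in> El (W v b) \<Longrightarrow> f \<in> El (J a b) \<Longrightarrow>
       bil (T a) \<kappa>\<^sub>0 (act a b v w f) = cmp_el C (D a) (D b) x (bil (T b) \<kappa>\<^sub>0 w) (lin (far D a b) f)"
  shows "indexed_cone v C D x k T"
  unfolding indexed_cone_def
  using assms(6) indexed_cone_arrow_iff[OF assms(1-8)] assms(9) by blast

lemma Kan_weight_fob [simp]: "(Kan_weight j v) b = W v b"
  by (simp add: Kan_weight_def)

lemma vop_simps [simp]: "VOb (vop A) = VOb A" "(vop A) a b = A b a"
  by (simp_all add: vop_def)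

text \<open>An instance of \<open>transpose_naturality\<close> for each pair of objects of \<open>J\<close>.\<close>

lemma indexed_iff:
  assumes C: "is_vcat C" and D: "is_vfunctor J C D" and o: "v \<in> Ob V" "x \<in> VOb C" "k \<in> Ob V"
    and T: "\<And>b. b \<in> VOb J \<Longrightarrow> T b \<in> Hom V k (IHom V (W v b) (C (D b) x))"
  shows "indexed_vnat (vop J) \<V> (Kan_weight j v) (hom_along C D x) k T \<longleftrightarrow>
    indexed_cone v C D x k (\<lambda>b. uncurry (W v b) (C (D b) x) (T b))" (is "_ \<longleftrightarrow> indexed_cone v C D x k ?T")
proof -
  have o': "D b \<in> VOb C" "C (D b) x \<in> Ob V" "W v b \<in> Ob V" if "b \<in> VOb J" for b
    using that C D o by auto
  have UT: "\<And>b. b \<in> VOb J \<Longrightarrow> ?T b \<in> Hom V (k \<otimes> W v b) (C (D b) x)"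
    using T o' by (intro uncurry_Hom) auto
  have k0: "gen k \<in> El k" "iso_arr V (snd (gen k))" using o by auto
  { fix b a assume ba: "b \<in> VOb J" "a \<in> VOb J"
    let ?G = "\<lambda>b. C (D b) x"
    let ?p = "VCmp C (D a) (D b) x \<cdot> (\<one> (?G b) \<oslash> far D a b)"
    let ?q = "VCmp \<V> (j a) (j b) v \<cdot> (\<one> (W v b) \<oslash> far j a b)"
    have p: "?p \<in> Hom V (?G b \<otimes> J a b) (?G a)"
      using vcat_cmp[OF C o'(1)[OF ba(2)] o'(1)[OF ba(1)] o(2)] vfunctor_far[OF D ba(2,1)] o'(2)[OF ba(1)] by (simp add: in_Hom)
    have q: "?q \<in> Hom V (W v b \<otimes> J a b) (W v a)"
      using self_cmp(1)[of "j a" "j b" v] o vfunctor_far[OF j ba(2,1)] o'(3)[OF ba(1)] ba by (simp add: in_Hom)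
    have "VCmp \<V> (W v b) (?G b) (?G a) \<cdot> (far (hom_along C D x) b a \<oslash> T b)
        = VCmp \<V> (W v b) (W v a) (?G a) \<cdot> (T a \<oslash> far (Kan_weight j v) b a) \<cdot> Sym V (J a b) k
      \<longleftrightarrow> ?p \<cdot> (?T b \<oslash> \<one> (J a b)) = ?T a \<cdot> (\<one> k \<oslash> ?q) \<cdot> Asc V k (W v b) (J a b)"
    proof (rule transpose_naturality)
      show "far (Kan_weight j v) b a \<in> Hom V (J a b) (IHom V (W v b) (W v a))"
        using hom_along_far(1)[OF J is_vcat_self j _ ba, of v] o by (simp add: Kan_weight_def)
      show "far (hom_along C D x) b a \<in> Hom V (J a b) (IHom V (?G b) (?G a))"
        using hom_along_far(1)[OF J C D o(2) ba] by simp
      show "Ev V (W v b) (W v a) \<cdot> (far (Kan_weight j v) b a \<oslash> \<one> (W v b)) = ?q \<cdot> Sym V (J a b) (W v b)"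
        using hom_along_far(2)[OF J is_vcat_self j _ ba, of v] o by (simp add: Kan_weight_def)
      show "Ev V (?G b) (?G a) \<cdot> (far (hom_along C D x) b a \<oslash> \<one> (?G b)) = ?p \<cdot> Sym V (J a b) (?G b)"
        using hom_along_far(2)[OF J C D o(2) ba] by simp
    qed (use T ba o o' p q in auto)
    also have "\<dots> \<longleftrightarrow> (\<forall>\<kappa>\<in>El k. \<forall>w\<in>El (W v b). \<forall>f\<in>El (J a b).
      bil (?T a) \<kappa> (act a b v w f) = cmp_el C (D a) (D b) x (bil (?T b) \<kappa> w) (lin (far D a b) f))"
      using indexed_cone_arrow_iff[OF C D o UT k0 ba(2,1)] k0 by blast
    finally have "VCmp \<V> (W v b) (?G b) (?G a) \<cdot> (far (hom_along C D x) b a \<oslash> T b)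
        = VCmp \<V> (W v b) (W v a) (?G a) \<cdot> (T a \<oslash> far (Kan_weight j v) b a) \<cdot> Sym V (J a b) k
      \<longleftrightarrow> (\<forall>\<kappa>\<in>El k. \<forall>w\<in>El (W v b). \<forall>f\<in>El (J a b).
      bil (?T a) \<kappa> (act a b v w f) = cmp_el C (D a) (D b) x (bil (?T b) \<kappa> w) (lin (far D a b) f))" . }
  note * = this
  show ?thesis
    unfolding indexed_vnat_def indexed_cone_def using T UT * by simp blast
qed

lemma indexed_cone_cong:
  "(\<And>b. b \<in> VOb J \<Longrightarrow> T b = T' b) \<Longrightarrow> indexed_cone v C D x k T = indexed_cone v C D x k T'"
  unfolding indexed_cone_def by (simp cong: ball_cong)

lemma cone_cong:
  "(\<And>b. b \<in> VOb J \<Longrightarrow> r b = r' b) \<Longrightarrow> cone v C D x r = cone v C D x r'"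
  unfolding cone_def by (simp cong: ball_cong)

lemma Kan_colimit_cong:
  assumes "\<And>b. b \<in> VOb J \<Longrightarrow> r b = r' b"
  shows "Kan_colimit v C D c r = Kan_colimit v C D c r'"
proof -
  have "cone v C D c r = cone v C D c r'" by (rule cone_cong) (rule assms)
  then show ?thesis unfolding Kan_colimit_def using assms by (simp cong: ball_cong)
qed

lemma coneD:
  assumes "cone v C D c r"
  shows "b \<in> VOb J \<Longrightarrow> r b \<in> Hom V (W v b) (C (D b) c)"
    "a \<in> VOb J \<Longrightarrow> b \<in> VOb J \<Longrightarrow> w \<in> El (W v b) \<Longrightarrow> f \<in> El (J a b) \<Longrightarrow>
      lin (r a) (act a b v w f) = cmp_el C (D a) (D b) c (lin (r b) w) (lin (far D a b) f)"
    "b \<in> VOb J \<Longrightarrow> w \<in> El (W v b) \<Longrightarrow> lin (r b) w \<in> El (C (D b) c)"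
  using assms lin_El unfolding cone_def by blast+

lemma indexed_coneD:
  assumes "indexed_cone v C D c k T"
  shows "b \<in> VOb J \<Longrightarrow> T b \<in> Hom V (k \<otimes> W v b) (C (D b) c)"
    "a \<in> VOb J \<Longrightarrow> b \<in> VOb J \<Longrightarrow> \<kappa> \<in> El k \<Longrightarrow> w \<in> El (W v b) \<Longrightarrow> f \<in> El (J a b) \<Longrightarrow>
      bil (T a) \<kappa> (act a b v w f) = cmp_el C (D a) (D b) c (bil (T b) \<kappa> w) (lin (far D a b) f)"
    "b \<in> VOb J \<Longrightarrow> \<kappa> \<in> El k \<Longrightarrow> w \<in> El (W v b) \<Longrightarrow> bil (T b) \<kappa> w \<in> El (C (D b) c)"
  using assms bil_El unfolding indexed_cone_def by blast+

lemma Kan_colimitD: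
  assumes "Kan_colimit v C D c r"
  shows "c \<in> VOb C" "cone v C D c r"
  using assms by (auto simp: Kan_colimit_def)

lemma cone_cmp_arrow:
  assumes C: "is_vcat C" and D: "is_vfunctor J C D" and v: "v \<in> Ob V" and c: "c \<in> VOb C" and r: "cone v C D c r"
    and x: "x \<in> VOb C" and h: "h \<in> Hom V k (C c x)" and b: "b \<in> VOb J"
  shows "VCmp C (D b) c x \<cdot> (h \<oslash> r b) \<in> Hom V (k \<otimes> W v b) (C (D b) x)"
    "\<kappa> \<in> El k \<Longrightarrow> w \<in> El (W v b) \<Longrightarrow>
      bil (VCmp C (D b) c x \<cdot> (h \<oslash> r b)) \<kappa> w = cmp_el C (D b) c x (lin h \<kappa>) (lin (r b) w)"
proof -
  have m: "VCmp C (D b) c x \<in> Hom V (C c x \<otimes> C (D b) c) (C (D b) x)"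
    using vcat_cmp[OF C _ c x] D b by simp
  note rb = coneD(1)[OF r b]
  show "VCmp C (D b) c x \<cdot> (h \<oslash> r b) \<in> Hom V (k \<otimes> W v b) (C (D b) x)"
    using m rb h by (simp add: in_Hom)
  show "\<kappa> \<in> El k \<Longrightarrow> w \<in> El (W v b) \<Longrightarrow>
      bil (VCmp C (D b) c x \<cdot> (h \<oslash> r b)) \<kappa> w = cmp_el C (D b) c x (lin h \<kappa>) (lin (r b) w)"
    unfolding cmp_el_def by (rule bil_lin_lin[symmetric, OF m h rb])
qed

lemma factor_iff:
  assumes C: "is_vcat C" and D: "is_vfunctor J C D" and v: "v \<in> Ob V" and c: "c \<in> VOb C" and r: "cone v C D c r"
    and x: "x \<in> VOb C" and h: "h \<in> Hom V k (C c x)" and b: "b \<in> VOb J"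
    and T: "T \<in> Hom V (k \<otimes> W v b) (C (D b) x)"
  shows "VCmp C (D b) c x \<cdot> (h \<oslash> r b) = T \<longleftrightarrow>
    (\<forall>\<kappa>\<in>El k. \<forall>w\<in>El (W v b). cmp_el C (D b) c x (lin h \<kappa>) (lin (r b) w) = bil T \<kappa> w)" (is "?l \<longleftrightarrow> ?r")
proof
  note * = cone_cmp_arrow[OF C D v c r x h b]
  have k: "k \<in> Ob V" "W v b \<in> Ob V" using h v b Hom_ob by auto
  show "?l \<Longrightarrow> ?r" using *(2) by auto
  assume ?r
  then show ?l using *(2)[OF gen_El gen_El] k
    by - (rule bil_ext[OF *(1) T gen_El gen_El gen_iso gen_iso], simp_all)
qed

lemma Kan_colimit_factor:
  assumes C: "is_vcat C" and D: "is_vfunctor J C D" and v: "v \<in> Ob V" and g: "Kan_colimit v C D c r"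
    and x: "x \<in> VOb C" and k: "k \<in> Ob V" and T: "indexed_cone v C D x k T"
  obtains h where "h \<in> Hom V k (C c x)"
    "\<And>b \<kappa> w. b \<in> VOb J \<Longrightarrow> \<kappa> \<in> El k \<Longrightarrow> w \<in> El (W v b) \<Longrightarrow>
      cmp_el C (D b) c x (lin h \<kappa>) (lin (r b) w) = bil (T b) \<kappa> w"
proof -
  obtain h where h: "h \<in> Hom V k (C c x)" "\<And>b. b \<in> VOb J \<Longrightarrow> VCmp C (D b) c x \<cdot> (h \<oslash> r b) = T b"
    using g x k T unfolding Kan_colimit_def by blast
  show ?thesis
    using factor_iff[OF C D v Kan_colimitD[OF g] x h(1) _ indexed_coneD(1)[OF T]] h by (intro that[of h]) auto
qed

text \<open>Uniqueness for elements in an arbitrary context \<open>ks\<close>, from uniqueness for the parameter object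
  \<open>ctx_ob ks\<close>.\<close>

lemma Kan_colimit_ext:
  assumes C: "is_vcat C" and D: "is_vfunctor J C D" and v: "v \<in> Ob V" and g: "Kan_colimit v C D c r"
    and x: "x \<in> VOb C" and h: "h \<in> El (C c x)" "h' \<in> El (C c x)" "fst h = fst h'"
    and e: "\<And>b w. b \<in> VOb J \<Longrightarrow> w \<in> El (W v b) \<Longrightarrow>
      cmp_el C (D b) c x h (lin (r b) w) = cmp_el C (D b) c x h' (lin (r b) w)"
  shows "h = h'"
proof -
  define k where "k = ctx_ob (fst h)"
  \<comment> \<open>Regarded as an element of its own context object, the identity is an invertible parameter.\<close>
  define \<kappa>\<^sub>0 where "\<kappa>\<^sub>0 = (fst h, \<one> k)"
  have hk: "snd h \<in> Hom V k (C c x)" "snd h' \<in> Hom V k (C c x)" and k: "k \<in> Ob V"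
    using h by (auto simp: El_iff in_Hom k_def)
  have k0: "\<kappa>\<^sub>0 \<in> El k" "iso_arr V (snd \<kappa>\<^sub>0)" "lin (snd h) \<kappa>\<^sub>0 = h" "lin (snd h') \<kappa>\<^sub>0 = h'"
    using h k by (auto simp: El_iff in_Hom k_def \<kappa>\<^sub>0_def lin_def prod_eq_iff)
  note c = Kan_colimitD[OF g]
  let ?T = "\<lambda>b. VCmp C (D b) c x \<cdot> (snd h \<oslash> r b)"
  have T: "indexed_cone v C D x k ?T"
  proof (rule indexed_coneI[OF C D v x k])
    show "b \<in> VOb J \<Longrightarrow> ?T b \<in> Hom V (k \<otimes> W v b) (C (D b) x)" for b
      using cone_cmp_arrow(1)[OF C D v c x hk(1)] .
    fix a b w f assume a: "a \<in> VOb J" "b \<in> VOb J" "w \<in> El (W v b)" "f \<in> El (J a b)"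
    then show "bil (?T a) \<kappa>\<^sub>0 (act a b v w f) = cmp_el C (D a) (D b) x (bil (?T b) \<kappa>\<^sub>0 w) (lin (far D a b) f)"
      using cone_cmp_arrow(2)[OF C D v c x hk(1) _ k0(1)] k0 c C D v x h(1) coneD(3)[OF c(2)]
      by (simp add: coneD(2)[OF c(2)] cmp_el_assoc)
  qed (use k0 in auto)
  have "VCmp C (D b) c x \<cdot> (snd h' \<oslash> r b) = ?T b" if b: "b \<in> VOb J" for b
    using cone_cmp_arrow[OF C D v c x hk(1) b] cone_cmp_arrow[OF C D v c x hk(2) b]
      bil_ext[OF _ _ k0(1) gen_El k0(2) gen_iso] e[OF b] v b k0 by simp
  moreover have "\<exists>!h. h \<in> Hom V k (C c x) \<and> (\<forall>b\<in>VOb J. VCmp C (D b) c x \<cdot> (h \<oslash> r b) = ?T b)"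
    using g x k T unfolding Kan_colimit_def by blast
  ultimately have "snd h = snd h'" using hk by blast
  then show ?thesis using h(3) by (simp add: prod_eq_iff)
qed

lemma Kan_colimitI:
  assumes C: "is_vcat C" and D: "is_vfunctor J C D" and v: "v \<in> Ob V" and c: "c \<in> VOb C" and r: "cone v C D c r"
    and ex: "\<And>x k T. x \<in> VOb C \<Longrightarrow> k \<in> Ob V \<Longrightarrow> indexed_cone v C D x k T \<Longrightarrow> \<exists>h\<in>Hom V k (C c x).
      \<forall>b\<in>VOb J. \<forall>\<kappa>\<in>El k. \<forall>w\<in>El (W v b). cmp_el C (D b) c x (lin h \<kappa>) (lin (r b) w) = bil (T b) \<kappa> w"
    and uniq: "\<And>x h h'. x \<in> VOb C \<Longrightarrow> h \<in> El (C c x) \<Longrightarrow> h' \<in> El (C c x) \<Longrightarrow> fst h = fst h' \<Longrightarrow>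
      (\<And>b w. b \<in> VOb J \<Longrightarrow> w \<in> El (W v b) \<Longrightarrow>
      cmp_el C (D b) c x h (lin (r b) w) = cmp_el C (D b) c x h' (lin (r b) w)) \<Longrightarrow> h = h'"
  shows "Kan_colimit v C D c r"
  unfolding Kan_colimit_def
proof (intro conjI ballI allI impI c r)
  fix x k T assume a: "x \<in> VOb C" "k \<in> Ob V" "indexed_cone v C D x k T"
  obtain h where h: "h \<in> Hom V k (C c x)" "\<And>b \<kappa> w. b \<in> VOb J \<Longrightarrow> \<kappa> \<in> El k \<Longrightarrow> w \<in> El (W v b) \<Longrightarrow>
     cmp_el C (D b) c x (lin h \<kappa>) (lin (r b) w) = bil (T b) \<kappa> w"
    using ex[OF a] by blast
  show "\<exists>!h. h \<in> Hom V k (C c x) \<and> (\<forall>b\<in>VOb J. VCmp C (D b) c x \<cdot> (h \<oslash> r b) = T b)"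
  proof (rule ex1I[of _ h])
    show "h \<in> Hom V k (C c x) \<and> (\<forall>b\<in>VOb J. VCmp C (D b) c x \<cdot> (h \<oslash> r b) = T b)"
      using factor_iff[OF C D v c r a(1) h(1) _ indexed_coneD(1)[OF a(3)]] h by blast
    fix h' assume h': "h' \<in> Hom V k (C c x) \<and> (\<forall>b\<in>VOb J. VCmp C (D b) c x \<cdot> (h' \<oslash> r b) = T b)"
    show "h' = h"
    proof (rule lin_ext)
      show "lin h' (gen k) = lin h (gen k)"
      proof (rule uniq[OF a(1)])
        fix b w assume b: "b \<in> VOb J" and w: "w \<in> El (W v b)"
        show "cmp_el C (D b) c x (lin h' (gen k)) (lin (r b) w) = cmp_el C (D b) c x (lin h (gen k)) (lin (r b) w)"
          using factor_iff[OF C D v c r a(1) conjunct1[OF h'] b indexed_coneD(1)[OF a(3) b]] h' b h(2) w a(2) by simp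
      qed (use h h' a in \<open>auto intro: lin_El\<close>)
    qed (use h h' in auto)
  qed
qed

text \<open>The case of an empty context: a cocone without a parameter induces a point. The parameter object is
  \<open>I\<close>, hence the unit isomorphism in the proof.\<close>

lemma Kan_colimit_point:
  assumes C: "is_vcat C" and D: "is_vfunctor J C D" and v: "v \<in> Ob V" and g: "Kan_colimit v C D c r"
    and x: "x \<in> VOb C" and T: "cone v C D x T"
  obtains t where "t \<in> Hom V \<I> (C c x)"
    "\<And>b w. b \<in> VOb J \<Longrightarrow> w \<in> El (W v b) \<Longrightarrow> cmp_el C (D b) c x ([], t) (lin (r b) w) = lin (T b) w"
proof -
  let ?T = "\<lambda>b. T b \<cdot> LUn V (W v b)"
  have k0: "([], \<one> \<I>) \<in> El \<I>" by (rule point_El) (simp add: in_Hom)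
  have TH: "?T b \<in> Hom V (\<I> \<otimes> W v b) (C (D b) x)" if "b \<in> VOb J" for b
    using coneD(1)[OF T that] v that by (simp add: in_Hom)
  have e: "bil (?T b) ([], \<one> \<I>) w = lin (T b) w" if "b \<in> VOb J" "w \<in> El (W v b)" for b w
    using bil_point_left[OF TH[OF that(1)] _ that(2), of "\<one> \<I>"] coneD(1)[OF T that(1)] v that by (simp add: in_Hom)
  have K: "indexed_cone v C D x \<I> ?T"
    by (rule indexed_coneI[OF C D v x unt TH k0]) (use v in \<open>simp_all add: e coneD(2)[OF T]\<close>)
  obtain t where t: "t \<in> Hom V \<I> (C c x)"
    "\<And>b \<kappa> w. b \<in> VOb J \<Longrightarrow> \<kappa> \<in> El \<I> \<Longrightarrow> w \<in> El (W v b) \<Longrightarrow>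
      cmp_el C (D b) c x (lin t \<kappa>) (lin (r b) w) = bil (?T b) \<kappa> w"
    using Kan_colimit_factor[OF C D v g x unt K] by blast
  have "lin t ([], \<one> \<I>) = ([], t)" using t(1) by (simp add: lin_def in_Hom)
  then show ?thesis using t(2)[OF _ k0] e by (intro that[OF t(1)]) auto
qed

text \<open>Transposition matches the indexed transformations of the definition with indexed cocones. It turns the
  universal family \<open>?E\<close> on \<open>C(c,x)\<close> into \<open>(h, w) \<mapsto> h \<cdot> r w\<close>, so that the factorizations correspond.\<close>

lemma weighted_colimit_iff:
  assumes C: "is_vcat C" and D: "is_vfunctor J C D" and v: "v \<in> Ob V"
  shows "is_weighted_colimit J (Kan_weight j v) C D c u \<longleftrightarrow>
    (\<forall>b\<in>VOb J. u b \<in> Hom V \<I> (IHom V (W v b) (C (D b) c))) \<and>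
    Kan_colimit v C D c (\<lambda>b. unname (W v b) (C (D b) c) (u b))"
proof (cases "c \<in> VOb C \<and> (\<forall>b\<in>VOb J. u b \<in> Hom V \<I> (IHom V (W v b) (C (D b) c)))")
  case False
  then show ?thesis by (auto simp: is_weighted_colimit_def Kan_colimit_def is_vnat_def)
next
  case True
  then have c: "c \<in> VOb C" and u: "\<And>b. b \<in> VOb J \<Longrightarrow> u b \<in> Hom V \<I> (IHom V (W v b) (C (D b) c))" by auto
  let ?r = "\<lambda>b. unname (W v b) (C (D b) c) (u b)"
  have o: "D b \<in> VOb C" "W v b \<in> Ob V" if "b \<in> VOb J" for b
    using that C D v by auto
  have o2: "C (D b) x \<in> Ob V" if "b \<in> VOb J" "x \<in> VOb C" for b x
    using that C D v by auto
  note r = unname_Hom[OF u o(2) o2[OF _ c]]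
  have k0: "([], \<one> \<I>) \<in> El \<I>" "iso_arr V (snd ([], \<one> \<I>))" by (auto intro: point_El simp: in_Hom)
  have UH: "uncurry (W v b) (C (D b) c) (u b) \<in> Hom V (\<I> \<otimes> W v b) (C (D b) c)" if "b \<in> VOb J" for b
    using uncurry_Hom[OF u[OF that] o(2) o2] that c by simp
  have e: "bil (uncurry (W v b) (C (D b) c) (u b)) ([], \<one> \<I>) w = lin (?r b) w"
    if b: "b \<in> VOb J" and w: "w \<in> El (W v b)" for b w
    using bil_uncurry[OF u[OF b] o(2)[OF b] o2[OF b c] k0(1) w] r(2)[OF b b b w] u[OF b]
    by (simp add: lin_def in_Hom)
  have "is_vnat (vop J) \<V> (Kan_weight j v) (hom_along C D c) u \<longleftrightarrow>
    indexed_vnat (vop J) \<V> (Kan_weight j v) (hom_along C D c) \<I> u"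
  proof (rule is_vnat_indexed)
    fix a b assume "a \<in> VOb (vop J)" "b \<in> VOb (vop J)"
    then show "far (Kan_weight j v) a b \<in> Hom V ((vop J) a b) (\<V> ((Kan_weight j v) a) ((Kan_weight j v) b))"
      "far (hom_along C D c) a b \<in> Hom V ((vop J) a b) (\<V> ((hom_along C D c) a) ((hom_along C D c) b))"
      using hom_along_far(1)[OF J is_vcat_self j _ _, of v a b] hom_along_far(1)[OF J C D c, of a b] v
      by (simp_all add: Kan_weight_def)
  qed (use u o o2 c in auto)
  also have "\<dots> \<longleftrightarrow> indexed_cone v C D c \<I> (\<lambda>b. uncurry (W v b) (C (D b) c) (u b))"
    by (rule indexed_iff[OF C D v c unt u])
  also have "\<dots> \<longleftrightarrow> cone v C D c ?r"
  proof
    assume k: "indexed_cone v C D c \<I> (\<lambda>b. uncurry (W v b) (C (D b) c) (u b))"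
    show "cone v C D c ?r"
      unfolding cone_def using r(1) indexed_coneD(2)[OF k _ _ k0(1)] v by (simp add: e)
  next
    assume k: "cone v C D c ?r"
    show "indexed_cone v C D c \<I> (\<lambda>b. uncurry (W v b) (C (D b) c) (u b))"
      by (rule indexed_coneI[OF C D v c unt UH k0]) (use v in \<open>simp_all add: e coneD(2)[OF k]\<close>)
  qed
  finally have nat: "is_vnat (vop J) \<V> (Kan_weight j v) (hom_along C D c) u \<longleftrightarrow> cone v C D c ?r" .
  { fix x assume rc: "cone v C D c ?r" and x: "x \<in> VOb C"
    let ?E = "\<lambda>b. VCmp \<V> ((Kan_weight j v) b) (C (D b) c) (C (D b) x)
              \<cdot> (far (covariant_hom C (D b)) c x \<oslash> u b) \<cdot> inv (RUn V (C c x))"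
    have cx: "C c x \<in> Ob V" using C c x by simp
    have E: "?E b \<in> Hom V (C c x) (IHom V (W v b) (C (D b) x))"
      and lE: "\<And>h w. h \<in> El (C c x) \<Longrightarrow> w \<in> El (W v b) \<Longrightarrow> ap (W v b) (C (D b) x) (lin (?E b) h) w
          = cmp_el C (D b) c x h (lin (?r b) w)" if b: "b \<in> VOb J" for b
    proof -
      note cov = covariant_far[OF C o(1)[OF b] c x]
      note sc = self_cmp(1)[OF o(2)[OF b] o2[OF b c] o2[OF b x]]
      note ub = u[OF b]
      show "?E b \<in> Hom V (C c x) (IHom V (W v b) (C (D b) x))"
        using cov sc ub cx by (simp add: in_Hom)
      fix h w assume h: "h \<in> El (C c x)" and w: "w \<in> El (W v b)"
      have m: "VCmp \<V> (W v b) (C (D b) c) (C (D b) x) \<cdot>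
        (far (covariant_hom C (D b)) c x \<oslash> \<one> (IHom V (W v b) (C (D b) c)))
        \<in> Hom V (C c x \<otimes> IHom V (W v b) (C (D b) c)) (IHom V (W v b) (C (D b) x))"
        using sc cov o[OF b] o2[OF b] c x by (simp add: in_Hom)
      have "lin (?E b) h = cmp_el \<V> (W v b) (C (D b) c) (C (D b) x)
         (lin (far (covariant_hom C (D b)) c x) h) ([], u b)"
        unfolding cmp_el_def using o[OF b] o2[OF b] c x cov sc ub cx
        by (subst bil_lin_left[OF sc cov h point_El[OF ub]], subst bil_point_right[OF m ub h]) (simp add: in_Hom)
      then have "ap (W v b) (C (D b) x) (lin (?E b) h) w =
        ap (C (D b) c) (C (D b) x) (lin (far (covariant_hom C (D b)) c x) h)
          (ap (W v b) (C (D b) c) ([], u b) w)"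
        using ap_self_cmp[OF o(2)[OF b] o2[OF b c] o2[OF b x] lin_El[OF cov h] point_El[OF ub] w] by simp
      also have "ap (W v b) (C (D b) c) ([], u b) w = lin (?r b) w" using r(2)[OF b b b w] by simp
      finally show "ap (W v b) (C (D b) x) (lin (?E b) h) w = cmp_el C (D b) c x h (lin (?r b) w)"
        using ap_covariant[OF C o(1)[OF b] c x h coneD(3)[OF rc b w]] by simp
    qed
    have fac: "uncurry (W v b) (C (D b) x) (?E b \<cdot> f) = VCmp C (D b) c x \<cdot> (f \<oslash> ?r b)"
      if b: "b \<in> VOb J" and f: "f \<in> Hom V k (C c x)" for b k f
    proof -
      have k: "k \<in> Ob V" using f Hom_ob by auto
      have Ef: "?E b \<cdot> f \<in> Hom V k (IHom V (W v b) (C (D b) x))"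
        using E[OF b] f by (simp add: in_Hom)
      have gf: "gen k \<in> El k" and gw: "gen (W v b) \<in> El (W v b)" using k o[OF b] by auto
      have "lin (?E b \<cdot> f) (gen k) = lin (?E b) (lin f (gen k))"
        using lin_lin[OF f E[OF b] gf] by simp
      then have "bil (uncurry (W v b) (C (D b) x) (?E b \<cdot> f)) (gen k) (gen (W v b)) =
        bil (VCmp C (D b) c x \<cdot> (f \<oslash> ?r b)) (gen k) (gen (W v b))"
        using bil_uncurry[OF Ef o(2)[OF b] o2[OF b x] gf gw] lE[OF b lin_El[OF f gf] gw]
          cone_cmp_arrow(2)[OF C D v c rc x f b gf gw] by simp
      then show ?thesis
        by - (rule bil_ext[OF uncurry_Hom[OF Ef o(2)[OF b] o2[OF b x]] cone_cmp_arrow(1)[OF C D v c rc x f b] gf gw],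
            use k o[OF b] in simp_all)
    qed
    have Eidx: "indexed_vnat (vop J) \<V> (Kan_weight j v) (hom_along C D x) (C c x) ?E"
    proof (subst indexed_iff[OF C D v x cx E])
      let ?T = "\<lambda>b. uncurry (W v b) (C (D b) x) (?E b)"
      have bT: "bil (?T b) h w = cmp_el C (D b) c x h (lin (?r b) w)"
        if "b \<in> VOb J" "h \<in> El (C c x)" "w \<in> El (W v b)" for b h w
        using bil_uncurry[OF E[OF that(1)] o(2)[OF that(1)] o2[OF that(1) x] that(2,3)] lE[OF that] by simp
      show "indexed_cone v C D x (C c x) ?T"
      proof (rule indexed_coneI[OF C D v x cx])
        fix a b w f assume a: "a \<in> VOb J" "b \<in> VOb J" "w \<in> El (W v b)" "f \<in> El (J a b)"
        then show "bil (?T a) (gen (C c x)) (act a b v w f) =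
          cmp_el C (D a) (D b) x (bil (?T b) (gen (C c x)) w) (lin (far D a b) f)"
          using cx v C D o c x coneD(3)[OF rc] by (simp add: bT coneD(2)[OF rc] cmp_el_assoc del: Kan_weight_fob)
      qed (use E o o2 x cx in \<open>auto intro: uncurry_Hom\<close>)
    qed
    have "is_object_of_vnats (vop J) \<V> (Kan_weight j v) (hom_along C D x) (C c x) ?E \<longleftrightarrow>
      (\<forall>k\<in>Ob V. \<forall>T. indexed_cone v C D x k T \<longrightarrow>
      (\<exists>!h. h \<in> Hom V k (C c x) \<and> (\<forall>b\<in>VOb J. VCmp C (D b) c x \<cdot> (h \<oslash> ?r b) = T b)))"
      (is "?L \<longleftrightarrow> ?R")
    proof
      assume L: ?L
      show ?R
      proof (intro ballI allI impI)
        fix k T assume k: "k \<in> Ob V" and T: "indexed_cone v C D x k T"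
        let ?C = "\<lambda>b. Curry k (W v b) (T b)"
        have CT: "?C b \<in> Hom V k (IHom V (W v b) (C (D b) x))" if "b \<in> VOb J" for b
          using Curry_Hom(1)[OF indexed_coneD(1)[OF T that] k o(2)[OF that]] .
        have UC: "uncurry (W v b) (C (D b) x) (?C b) = T b" if "b \<in> VOb J" for b
          using uncurry_Curry[OF indexed_coneD(1)[OF T that] k o(2)[OF that]] .
        have "indexed_vnat (vop J) \<V> (Kan_weight j v) (hom_along C D x) k ?C"
        proof (subst indexed_iff[OF C D v x k])
          have "indexed_cone v C D x k (\<lambda>b. uncurry (W v b) (C (D b) x) (?C b)) = indexed_cone v C D x k T"
            by (rule indexed_cone_cong) (rule UC)
          then show "indexed_cone v C D x k (\<lambda>b. uncurry (W v b) (C (D b) x) (?C b))" using T by simp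
        qed (rule CT)
        then have "\<exists>!f. f \<in> Hom V k (C c x) \<and> (\<forall>b\<in>VOb J. ?E b \<cdot> f = ?C b)"
          using L k unfolding is_object_of_vnats_def by (simp only: vop_simps)
        moreover have "?E b \<cdot> f = ?C b \<longleftrightarrow> VCmp C (D b) c x \<cdot> (f \<oslash> ?r b) = T b"
          if b: "b \<in> VOb J" and f: "f \<in> Hom V k (C c x)" for b f
        proof
          assume "?E b \<cdot> f = ?C b"
          then show "VCmp C (D b) c x \<cdot> (f \<oslash> ?r b) = T b" using fac[OF b f] UC[OF b] by simp
        next
          assume "VCmp C (D b) c x \<cdot> (f \<oslash> ?r b) = T b"
          then have "uncurry (W v b) (C (D b) x) (?E b \<cdot> f) = uncurry (W v b) (C (D b) x) (?C b)"
            using fac[OF b f] UC[OF b] by simp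
          moreover have "?E b \<cdot> f \<in> Hom V k (IHom V (W v b) (C (D b) x))"
            using E[OF b] f by (simp add: in_Hom)
          ultimately show "?E b \<cdot> f = ?C b"
            using Curry_unique[OF _ CT[OF b] o(2)[OF b] o2[OF b x]] by (simp add: uncurry_def)
        qed
        ultimately show "\<exists>!h. h \<in> Hom V k (C c x) \<and> (\<forall>b\<in>VOb J. VCmp C (D b) c x \<cdot> (h \<oslash> ?r b) = T b)"
          by (smt (verit, best))
      qed
    next
      assume R: ?R
      show ?L unfolding is_object_of_vnats_def vop_simps
      proof (intro conjI cx Eidx ballI allI impI)
        fix k T assume k: "k \<in> Ob V" and T: "indexed_vnat (vop J) \<V> (Kan_weight j v) (hom_along C D x) k T"
        have TH: "T b \<in> Hom V k (IHom V (W v b) (C (D b) x))" if "b \<in> VOb J" for b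
          using T that unfolding indexed_vnat_def by simp
        let ?U = "\<lambda>b. uncurry (W v b) (C (D b) x) (T b)"
        have "indexed_cone v C D x k ?U" by (rule iffD1[OF indexed_iff[OF C D v x k] T]) (rule TH)
        then have "\<exists>!h. h \<in> Hom V k (C c x) \<and> (\<forall>b\<in>VOb J. VCmp C (D b) c x \<cdot> (h \<oslash> ?r b) = ?U b)"
          using R k by blast
        moreover have "?E b \<cdot> f = T b \<longleftrightarrow> VCmp C (D b) c x \<cdot> (f \<oslash> ?r b) = ?U b"
          if b: "b \<in> VOb J" and f: "f \<in> Hom V k (C c x)" for b f
        proof
          assume "?E b \<cdot> f = T b"
          then show "VCmp C (D b) c x \<cdot> (f \<oslash> ?r b) = ?U b" using fac[OF b f] by simp
        next
          assume "VCmp C (D b) c x \<cdot> (f \<oslash> ?r b) = ?U b"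
          then have "uncurry (W v b) (C (D b) x) (?E b \<cdot> f) = ?U b"
            using fac[OF b f] by simp
          moreover have "?E b \<cdot> f \<in> Hom V k (IHom V (W v b) (C (D b) x))"
            using E[OF b] f by (simp add: in_Hom)
          ultimately show "?E b \<cdot> f = T b"
            using Curry_unique[OF _ TH[OF b] o(2)[OF b] o2[OF b x]] by (simp add: uncurry_def)
        qed
        ultimately show "\<exists>!f. f \<in> Hom V k (C c x) \<and> (\<forall>b\<in>VOb J. ?E b \<cdot> f = T b)"
          by (smt (verit, best))
      qed
    qed }
  note univ = this
  have conj: "(c' \<and> K \<and> (\<forall>x\<in>S. P x)) = (u' \<and> c' \<and> K \<and> (\<forall>x\<in>S. Q x))"
    if "c' \<Longrightarrow> u'" "\<And>x. K \<Longrightarrow> x \<in> S \<Longrightarrow> P x = Q x" for c' u' K :: bool and S :: "'b set" and P Q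
    using that by blast
  show ?thesis
    unfolding is_weighted_colimit_def Kan_colimit_def nat
  proof (rule conj)
    show "\<forall>b\<in>VOb J. u b \<in> Hom V \<I> (IHom V (W v b) (C (D b) c))" using u by blast
  qed (rule univ)
qed

lemma weighted_colimit_name:
  assumes C: "is_vcat C" and D: "is_vfunctor J C D" and v: "v \<in> Ob V" and g: "Kan_colimit v C D c r"
  shows "is_weighted_colimit J (Kan_weight j v) C D c (\<lambda>b. name (r b))"
proof -
  note r = coneD(1)[OF Kan_colimitD(2)[OF g]]
  have "Kan_colimit v C D c (\<lambda>b. unname (W v b) (C (D b) c) (name (r b))) = Kan_colimit v C D c r"
    by (rule Kan_colimit_cong) (rule unname_name[OF r])
  then show ?thesis
    unfolding weighted_colimit_iff[OF C D v] using name_Hom(1)[OF r] g by simp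
qed

lemma has_colimits_iff:
  assumes C: "is_vcat C"
  shows "has_colimits (Kan_weights J j) C \<longleftrightarrow>
    (\<forall>v\<in>Ob V. \<forall>D. is_vfunctor J C D \<longrightarrow> (\<exists>c r. Kan_colimit v C D c r))"
proof -
  have "(\<exists>c u. is_weighted_colimit J (Kan_weight j v) C D c u) \<longleftrightarrow> (\<exists>c r. Kan_colimit v C D c r)"
    if "v \<in> Ob V" "is_vfunctor J C D" for v D
    using weighted_colimit_iff[OF C that(2,1)] weighted_colimit_name[OF C that(2,1)] by blast
  then show ?thesis unfolding has_colimits_def Kan_weights_def by auto
qed

lemma preserves_iff:
  assumes C: "is_vcat C" and E: "is_vcat E" and F: "is_vfunctor C E F" and v: "v \<in> Ob V"
  shows "preserves_colimits J (Kan_weight j v) C E F \<longleftrightarrow>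
    (\<forall>D c r. is_vfunctor J C D \<longrightarrow> Kan_colimit v C D c r \<longrightarrow>
      Kan_colimit v E (F \<circ>\<^sub>V D) (F c) (\<lambda>b. far F (D b) c \<cdot> r b))" (is "?L \<longleftrightarrow> ?R")
proof -
  { fix D c u assume D: "is_vfunctor J C D" and c: "c \<in> VOb C"
      and u: "\<And>b. b \<in> VOb J \<Longrightarrow> u b \<in> Hom V \<I> (IHom V (W v b) (C (D b) c))"
    let ?r = "\<lambda>b. unname (W v b) (C (D b) c) (u b)"
    let ?u = "\<lambda>b. ihom_map ((Kan_weight j v) b) (far F (D b) c) \<cdot> u b"
    have FD: "is_vfunctor J E (F \<circ>\<^sub>V D)" by (rule vfunctor_comp[OF J C E D F])
    have *: "?u b \<in> Hom V \<I> (IHom V (W v b) (E ((F \<circ>\<^sub>V D) b) (F c)))"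
      "unname (W v b) (E ((F \<circ>\<^sub>V D) b) (F c)) (?u b) = far F (D b) c \<cdot> ?r b"
      if b: "b \<in> VOb J" for b
    proof -
      have o: "W v b \<in> Ob V" "C (D b) c \<in> Ob V" "E (F (D b)) (F c) \<in> Ob V"
        using v b c C D E F by auto
      have f: "far F (D b) c \<in> Hom V (C (D b) c) (E (F (D b)) (F c))"
        using vfunctor_far[OF F _ c] D b by simp
      have d: "Dom V (far F (D b) c) = C (D b) c" using f by (simp add: in_Hom)
      let ?p = "far F (D b) c \<cdot> Ev V (W v b) (C (D b) c)"
      let ?i = "ihom_map ((Kan_weight j v) b) (far F (D b) c)"
      have p: "?p \<in> Hom V (IHom V (W v b) (C (D b) c) \<otimes> W v b) (E (F (D b)) (F c))"
        using f o by (simp add: in_Hom)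
      have i: "?i \<in> Hom V (IHom V (W v b) (C (D b) c)) (IHom V (W v b) (E (F (D b)) (F c)))"
        using Curry_Hom(1)[OF p] o by (simp add: ihom_map_def d)
      show ub: "?u b \<in> Hom V \<I> (IHom V (W v b) (E ((F \<circ>\<^sub>V D) b) (F c)))"
        using i u[OF b] by (simp add: in_Hom)
      note r = unname_Hom[OF u[OF b] o(1,2)]
      have ub': "?u b \<in> Hom V \<I> (IHom V (W v b) (E (F (D b)) (F c)))" using ub by simp
      show "unname (W v b) (E ((F \<circ>\<^sub>V D) b) (F c)) (?u b) = far F (D b) c \<cdot> ?r b"
      proof (rule lin_ext)
        show "unname (W v b) (E ((F \<circ>\<^sub>V D) b) (F c)) (?u b) \<in> Hom V (W v b) (E (F (D b)) (F c))"
          using unname_Hom(1)[OF ub' o(1,3)] by simp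
        show "far F (D b) c \<cdot> ?r b \<in> Hom V (W v b) (E (F (D b)) (F c))"
          using r(1) f by (simp add: in_Hom)
        let ?w = "gen (W v b)"
        have w: "?w \<in> El (W v b)" using o by simp
        have "lin (unname (W v b) (E ((F \<circ>\<^sub>V D) b) (F c)) (?u b)) ?w =
          ap (W v b) (E (F (D b)) (F c)) (lin ?i ([], u b)) ?w"
          using unname_Hom(2)[OF ub' o(1,3) w] by (simp add: lin_def)
        also have "\<dots> = bil ?p ([], u b) ?w"
          using ap_Curry[OF p point_El[OF u[OF b]] w] by (simp add: ihom_map_def d)
        also have "\<dots> = lin (far F (D b) c) (ap (W v b) (C (D b) c) ([], u b) ?w)"
          unfolding ap_def by (rule lin_bil[symmetric, OF ev[OF o(1,2)] f point_El[OF u[OF b]] w])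
        also have "\<dots> = lin (far F (D b) c \<cdot> ?r b) ?w"
          using lin_lin[OF r(1) f w] r(2)[OF w] by simp
        finally show "lin (unname (W v b) (E ((F \<circ>\<^sub>V D) b) (F c)) (?u b)) ?w
          = lin (far F (D b) c \<cdot> ?r b) ?w" .
      qed
    qed
    have "is_weighted_colimit J (Kan_weight j v) E (F \<circ>\<^sub>V D) (F c) ?u \<longleftrightarrow>
      Kan_colimit v E (F \<circ>\<^sub>V D) (F c) (\<lambda>b. far F (D b) c \<cdot> ?r b)"
      unfolding weighted_colimit_iff[OF E FD v] using *(1) Kan_colimit_cong[OF *(2)] by simp }
  note key = this
  show ?thesis
  proof
    assume L: ?L
    show ?R
    proof (intro allI impI)
      fix D c r assume D: "is_vfunctor J C D" and g: "Kan_colimit v C D c r"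
      note r = coneD(1)[OF Kan_colimitD(2)[OF g]]
      have "is_weighted_colimit J (Kan_weight j v) E (F \<circ>\<^sub>V D) (F c)
        (\<lambda>b. ihom_map ((Kan_weight j v) b) (far F (D b) c) \<cdot> name (r b))"
        using L D weighted_colimit_name[OF C D v g] unfolding preserves_colimits_def by simp
      then have "Kan_colimit v E (F \<circ>\<^sub>V D) (F c) (\<lambda>b. far F (D b) c \<cdot> unname (W v b) (C (D b) c) (name (r b)))"
        using key[OF D Kan_colimitD(1)[OF g] name_Hom(1)[OF r]] by simp
      then show "Kan_colimit v E (F \<circ>\<^sub>V D) (F c) (\<lambda>b. far F (D b) c \<cdot> r b)"
        by (subst Kan_colimit_cong[where r' = "\<lambda>b. far F (D b) c \<cdot> unname (W v b) (C (D b) c) (name (r b))"])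
          (simp_all add: unname_name[OF r])
    qed
  next
    assume R: ?R
    show ?L unfolding preserves_colimits_def
    proof (intro allI impI, elim conjE)
      fix D c u assume D: "is_vfunctor J C D" and w: "is_weighted_colimit J (Kan_weight j v) C D c u"
      have u: "\<And>b. b \<in> VOb J \<Longrightarrow> u b \<in> Hom V \<I> (IHom V (W v b) (C (D b) c))"
        and g: "Kan_colimit v C D c (\<lambda>b. unname (W v b) (C (D b) c) (u b))"
        using w unfolding weighted_colimit_iff[OF C D v] by auto
      show "is_weighted_colimit J (Kan_weight j v) E (F \<circ>\<^sub>V D) (F c)
        (\<lambda>b. ihom_map ((Kan_weight j v) b) (far F (D b) c) \<cdot> u b)"
        using R D g key[OF D Kan_colimitD(1)[OF g] u] by blast
    qed
  qed
qed

section \<open>Density\<close>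

text \<open>With \<open>i : I \<rightarrow> jU\<close> invertible, evaluation at \<open>i\<close> identifies the elements of \<open>V(jU,v)\<close> with those of
  \<open>v\<close>, naturally in the context; \<open>n\<close> is the inverse of this evaluation.\<close>

lemma unit_probe:
  obtains U i n where "U \<in> VOb J" "i \<in> Hom V \<I> (j U)"
    "\<And>v. v \<in> Ob V \<Longrightarrow> n v \<in> Hom V v (W v U)"
    "\<And>v z. z \<in> El v \<Longrightarrow> ap (j U) v (lin (n v) z) ([], i) = z"
    "\<And>v \<phi> \<psi>. v \<in> Ob V \<Longrightarrow> \<phi> \<in> El (W v U) \<Longrightarrow> \<psi> \<in> El (W v U) \<Longrightarrow>
      ap (j U) v \<phi> ([], i) = ap (j U) v \<psi> ([], i) \<Longrightarrow> \<phi> = \<psi>"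
proof -
  obtain U i where U: "U \<in> VOb J" and i: "i \<in> Hom V \<I> (j U)" "iso_arr V i"
    using unit_arity by blast
  have u [simp]: "j U \<in> Ob V" using U by simp
  note [simp] = i(1)[unfolded in_Hom] i(2)
  let ?p = "\<lambda>v. RUn V v \<cdot> (\<one> v \<oslash> inv i)"
  let ?n = "\<lambda>v. Curry v (j U) (?p v)"
  have p: "?p v \<in> Hom V (v \<otimes> j U) v" if "v \<in> Ob V" for v
    using that by (simp add: in_Hom)
  show thesis
  proof (rule that[OF U i(1)])
    show "v \<in> Ob V \<Longrightarrow> ?n v \<in> Hom V v (W v U)" for v using Curry_Hom(1)[OF p] by simp
    fix v z assume z: "z \<in> El v"
    then have v: "v \<in> Ob V" by (rule El_ob)
    show "ap (j U) v (lin (?n v) z) ([], i) = z"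
      using ap_Curry[OF p[OF v] z point_El[OF i(1)]] bil_point_right[OF p[OF v] i(1) z] v z
      by (simp add: lin_one)
  next
    fix v \<phi> \<psi> assume v: "v \<in> Ob V" and \<phi>: "\<phi> \<in> El (W v U)" and \<psi>: "\<psi> \<in> El (W v U)"
      and e: "ap (j U) v \<phi> ([], i) = ap (j U) v \<psi> ([], i)"
    obtain ks f where f: "\<phi> = (ks, f)" "f \<in> Hom V (ctx_ob ks) (W v U)" and ks [simp]: "set ks \<subseteq> Ob V"
      using \<phi> by (auto simp: El_def)
    have "fst \<psi> = ks" using arg_cong[OF e, of fst] f by simp
    then obtain g where g: "\<psi> = (ks, g)" "g \<in> Hom V (ctx_ob ks) (W v U)"
      using \<psi> by (auto simp: El_def)
    note [simp] = f(2)[unfolded in_Hom] g(2)[unfolded in_Hom] v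
    let ?e = "(\<one> (ctx_ob ks) \<oslash> i) \<cdot> inv (RUn V (ctx_ob ks))"
    have "(Ev V (j U) v \<cdot> (f \<oslash> \<one> (j U))) \<cdot> ?e = (Ev V (j U) v \<cdot> (g \<oslash> \<one> (j U))) \<cdot> ?e"
      using arg_cong[OF e, of snd] by (simp add: ap_def bil_def f(1) g(1) ctx_join_Nil)
    then have "Ev V (j U) v \<cdot> (f \<oslash> \<one> (j U)) = Ev V (j U) v \<cdot> (g \<oslash> \<one> (j U))"
      by (rule iso_epi[rotated -1]) simp_all
    then have "f = g" using Curry_unique[OF f(2) g(2) u v] by simp
    then show "\<phi> = \<psi>" using f g by simp
  qed
qed

lemma j_full:
  assumes "a \<in> VOb J" "b \<in> VOb J" "w \<in> El (IHom V (j a) (j b))"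
  shows "inv (far j a b) \<in> Hom V (IHom V (j a) (j b)) (J a b)"
    "lin (inv (far j a b)) w \<in> El (J a b)"
    "lin (far j a b) (lin (inv (far j a b)) w) = w"
proof -
  have f: "far j a b \<in> Hom V (J a b) (IHom V (j a) (j b))"
    using vfunctor_far[OF j assms(1,2)] by simp
  have i: "iso_arr V (far j a b)" using ff assms by (simp add: fully_faithful_def)
  show h: "inv (far j a b) \<in> Hom V (IHom V (j a) (j b)) (J a b)"
    using i f by (simp add: in_Hom)
  show "lin (inv (far j a b)) w \<in> El (J a b)" by (rule lin_El[OF h assms(3)])
  show "lin (far j a b) (lin (inv (far j a b)) w) = w"
    unfolding lin_lin[OF h f assms(3)] using i f assms by (simp add: in_Hom lin_one)
qed

text \<open>The factorization \<open>h\<close> of a cocone \<open>T\<close> sends \<open>z\<close> to \<open>T\<^sub>U z'\<close> evaluated at \<open>i\<close>, where \<open>z'\<close> is the element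
  of \<open>V(jU,v)\<close> corresponding to \<open>z\<close>. For \<open>w : jb \<rightarrow> v\<close> and an element \<open>y\<close> of \<open>jb\<close>, the element
  \<open>y'\<close> of \<open>V(jU,jb)\<close> comes from \<open>J(U,b)\<close> as \<open>j\<close> is full, and \<open>(w y)' = w \<cdot> y'\<close>; so naturality of \<open>T\<close> in
  \<open>y'\<close> gives \<open>h (w y) = T\<^sub>b w y\<close>.\<close>

lemma density:
  assumes v [simp]: "v \<in> Ob V"
  shows "Kan_colimit v \<V> j v (\<lambda>b. \<one> (W v b))"
proof -
  obtain U i n where U [simp]: "U \<in> VOb J" and i: "i \<in> Hom V \<I> (j U)"
    and n: "\<And>v. v \<in> Ob V \<Longrightarrow> n v \<in> Hom V v (W v U)"
    and n1: "\<And>v z. z \<in> El v \<Longrightarrow> ap (j U) v (lin (n v) z) ([], i) = z"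
    and n2: "\<And>v \<phi> \<psi>. v \<in> Ob V \<Longrightarrow> \<phi> \<in> El (W v U) \<Longrightarrow> \<psi> \<in> El (W v U) \<Longrightarrow>
      ap (j U) v \<phi> ([], i) = ap (j U) v \<psi> ([], i) \<Longrightarrow> \<phi> = \<psi>"
    by (rule unit_probe) blast
  have iE: "([], i) \<in> El (j U)" using i by (rule point_El)
  have nE: "lin (n x) z \<in> El (W x U)" if "z \<in> El x" for x z using lin_El[OF n that] that El_ob by auto
  show ?thesis
  proof (rule Kan_colimitI)
    show "cone v \<V> j v (\<lambda>b. \<one> (W v b))"
      unfolding cone_def by (auto simp: in_Hom lin_one self_cmp_el_El)
  next
    fix x k T assume "x \<in> VOb \<V>" and k [simp]: "k \<in> Ob V" and T: "indexed_cone v \<V> j x k T"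
    then have x [simp]: "x \<in> Ob V" by simp
    let ?r = "at_point (Ev V (j U) x) (W x U) i"
    \<comment> \<open>The uncurried factorization: \<open>z \<mapsto> T\<^sub>U z'\<close> evaluated at \<open>i\<close>.\<close>
    let ?p = "?r \<cdot> T U \<cdot> (\<one> k \<oslash> n v)"
    have TU: "T U \<in> Hom V (k \<otimes> W v U) (W x U)" using indexed_coneD(1)[OF T U] by simp
    note r = at_point_lin[OF ev i]
    have m: "T U \<cdot> (\<one> k \<oslash> n v) \<in> Hom V (k \<otimes> v) (W x U)" using TU n[OF v] by (simp add: in_Hom)
    have p: "?p \<in> Hom V (k \<otimes> v) x" by (rule cmp[OF m r(1)]) simp_all
    have bp: "bil ?p \<kappa> z = ap (j U) x (bil (T U) \<kappa> (lin (n v) z)) ([], i)"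
      if "\<kappa> \<in> El k" "z \<in> El v" for \<kappa> z
    proof -
      have "bil ?p \<kappa> z = lin ?r (bil (T U \<cdot> (\<one> k \<oslash> n v)) \<kappa> z)"
        by (rule lin_bil[symmetric, OF m r(1) that]) simp_all
      also have "bil (T U \<cdot> (\<one> k \<oslash> n v)) \<kappa> z = bil (T U) \<kappa> (lin (n v) z)"
        by (rule bil_lin_right[symmetric, OF TU n[OF v] that])
      also have "lin ?r \<dots> = ap (j U) x (bil (T U) \<kappa> (lin (n v) z)) ([], i)"
        unfolding ap_def by (rule r(2)) (use bil_El[OF TU that(1) nE[OF that(2)]] in simp_all)
      finally show ?thesis .
    qed
    show "\<exists>h\<in>Hom V k (\<V> v x). \<forall>b\<in>VOb J. \<forall>\<kappa>\<in>El k. \<forall>w\<in>El (W v b).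
      cmp_el \<V> (j b) v x (lin h \<kappa>) (lin (\<one> (W v b)) w) = bil (T b) \<kappa> w"
    proof (intro bexI ballI)
      show h: "Curry k v ?p \<in> Hom V k (\<V> v x)" using Curry_Hom(1)[OF p] by simp
      fix b \<kappa> w assume b [simp]: "b \<in> VOb J" and \<kappa>: "\<kappa> \<in> El k" and w: "w \<in> El (W v b)"
      have hE: "lin (Curry k v ?p) \<kappa> \<in> El (IHom V v x)" using lin_El[OF h \<kappa>] by simp
      have TE: "bil (T b) \<kappa> w \<in> El (IHom V (j b) x)" using indexed_coneD(3)[OF T b \<kappa> w] by simp
      have "cmp_el \<V> (j b) v x (lin (Curry k v ?p) \<kappa>) w = bil (T b) \<kappa> w"
      proof (rule ap_ext)
        fix y assume y: "y \<in> El (j b)"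
        let ?f = "lin (inv (far j U b)) (lin (n (j b)) y)"
        note f = j_full[OF U b nE[OF y]]
        have wy: "ap (j b) v w y \<in> El v" using w y by auto
        have "lin (n v) (ap (j b) v w y) = act U b v w ?f"
          unfolding f(3)
          by (rule n2[OF v nE[OF wy] self_cmp_el_El]) (use w y nE[OF y] iE in \<open>simp_all add: n1 wy ap_self_cmp\<close>)
        then have "ap (j b) x (cmp_el \<V> (j b) v x (lin (Curry k v ?p) \<kappa>) w) y =
          ap (j U) x (bil (T U) \<kappa> (act U b v w ?f)) ([], i)"
          using ap_self_cmp[OF _ v x hE w y] ap_Curry[OF p \<kappa> wy] bp[OF \<kappa> wy] by simp
        also have "\<dots> = ap (j U) x (cmp_el \<V> (j U) (j b) x (bil (T b) \<kappa> w) (lin (n (j b)) y)) ([], i)"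
          using indexed_coneD(2)[OF T U b \<kappa> w f(2)] f(3) by simp
        also have "\<dots> = ap (j b) x (bil (T b) \<kappa> w) y"
          using TE nE[OF y] iE y by (simp add: ap_self_cmp n1)
        finally show "ap (j b) x (cmp_el \<V> (j b) v x (lin (Curry k v ?p) \<kappa>) w) y = ap (j b) x (bil (T b) \<kappa> w) y" .
      qed (use self_cmp_el_El[OF _ v x hE w] TE in simp_all)
      then show "cmp_el \<V> (j b) v x (lin (Curry k v ?p) \<kappa>) (lin (\<one> (W v b)) w) = bil (T b) \<kappa> w"
        using w by (simp add: lin_one)
    qed
  next
    fix x h h' assume "x \<in> VOb \<V>" "h \<in> El (\<V> v x)" "h' \<in> El (\<V> v x)" and f: "fst h = fst h'"
      and e: "\<And>b w. b \<in> VOb J \<Longrightarrow> w \<in> El (W v b) \<Longrightarrow>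
        cmp_el \<V> (j b) v x h (lin (\<one> (W v b)) w) = cmp_el \<V> (j b) v x h' (lin (\<one> (W v b)) w)"
    then have x [simp]: "x \<in> Ob V" and h: "h \<in> El (IHom V v x)" "h' \<in> El (IHom V v x)" by auto
    show "h = h'"
    proof (rule ap_ext[OF h v x f])
      fix z assume z: "z \<in> El v"
      have "ap v x g z = ap (j U) x (cmp_el \<V> (j U) v x g (lin (n v) z)) ([], i)"
        if "g \<in> El (IHom V v x)" for g using that nE[OF z] iE by (simp add: ap_self_cmp n1[OF z])
      then show "ap v x h z = ap v x h' z"
        using e[OF U nE[OF z]] h nE[OF z] by (simp add: lin_one)
    qed
  qed simp_all
qed

text \<open>Preservation of the colimits of \<open>density\<close>, whose cocones are identities; their images are the arrows
  of \<open>F\<close> alone.\<close>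

definition dense_cocontinuous :: "('y, 'o, 'a) vcat \<Rightarrow> ('o, 'y, 'a) vfunctor \<Rightarrow> bool" where
  "dense_cocontinuous C F \<longleftrightarrow> (\<forall>v\<in>Ob V. Kan_colimit v C (F \<circ>\<^sub>V j) (F v) (\<lambda>b. far F (j b) v))"

definition Kan_preserving :: "('y, 'o, 'a) vcat \<Rightarrow> ('z, 'o, 'a) vcat \<Rightarrow> ('y, 'z, 'a) vfunctor \<Rightarrow> bool" where
  "Kan_preserving C E F \<longleftrightarrow> (\<forall>v\<in>Ob V. \<forall>D c r. is_vfunctor J C D \<longrightarrow> Kan_colimit v C D c r \<longrightarrow>
      Kan_colimit v E (F \<circ>\<^sub>V D) (F c) (\<lambda>b. far F (D b) c \<cdot> r b))"

lemma cocontinuous_iff: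
  assumes "is_vcat C" "is_vcat E" "is_vfunctor C E F"
  shows "cocontinuous (Kan_weights J j) C E F \<longleftrightarrow> Kan_preserving C E F"
proof -
  have "cocontinuous (Kan_weights J j) C E F \<longleftrightarrow> (\<forall>v\<in>Ob V. preserves_colimits J (Kan_weight j v) C E F)"
    unfolding cocontinuous_def Kan_weights_def by auto
  then show ?thesis unfolding Kan_preserving_def using preserves_iff[OF assms] by simp
qed

lemma Kan_preserving_dense:
  assumes C: "is_vcat C" and F: "is_vfunctor \<V> C F" and p: "Kan_preserving \<V> C F"
  shows "dense_cocontinuous C F"
  unfolding dense_cocontinuous_def
proof
  fix v assume v: "v \<in> Ob V"
  have e: "far F (j b) v \<cdot> \<one> (W v b) = far F (j b) v" if "b \<in> VOb J" for b
    using vfunctor_far[OF F, of "j b" v] v that by (simp add: in_Hom)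
  have "Kan_colimit v C (F \<circ>\<^sub>V j) (F v) (\<lambda>b. far F (j b) v \<cdot> \<one> (W v b))"
    using p density[OF v] v j unfolding Kan_preserving_def by blast
  moreover have "Kan_colimit v C (F \<circ>\<^sub>V j) (F v) (\<lambda>b. far F (j b) v \<cdot> \<one> (W v b)) =
    Kan_colimit v C (F \<circ>\<^sub>V j) (F v) (\<lambda>b. far F (j b) v)"
    by (rule Kan_colimit_cong) (rule e)
  ultimately show "Kan_colimit v C (F \<circ>\<^sub>V j) (F v) (\<lambda>b. far F (j b) v)" by simp
qed

text \<open>For an element \<open>w\<close> of \<open>V(jb,v)\<close>, naturality forces \<open>t\<^sub>v \<cdot> F w = G w \<cdot> \<tau>\<^sub>b\<close>. The right hand sides form a
  cocone on the presentation of \<open>F v\<close>, so that there is exactly one such \<open>t\<^sub>v\<close>.\<close>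

lemma restriction_full:
  assumes C: "is_vcat C" and F: "is_vfunctor \<V> C F" and G: "is_vfunctor \<V> C G"
    and d: "dense_cocontinuous C F" and \<tau>: "is_vnat J C (F \<circ>\<^sub>V j) (G \<circ>\<^sub>V j) \<tau>"
  obtains t where "is_vnat \<V> C F G t" "\<And>b. b \<in> VOb J \<Longrightarrow> t (j b) = \<tau> b"
proof -
  note Fj = vfunctor_comp[OF J is_vcat_self C j F] and Gj = vfunctor_comp[OF J is_vcat_self C j G]
  note t\<tau> = vnatD[OF J C Fj Gj \<tau>, simplified]
  note [simp] = C vfunctor_simps[OF F, simplified] vfunctor_simps[OF G, simplified]
  note Fc = vfunctor_cmp_el[OF is_vcat_self C F, simplified] and Gc = vfunctor_cmp_el[OF is_vcat_self C G, simplified]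
  note FjE = lin_comp[OF j F] and GjE = lin_comp[OF j G]
  have "\<exists>t. t \<in> Hom V \<I> (C (F v) (G v)) \<and> (\<forall>b\<in>VOb J. \<forall>w\<in>El (W v b).
     cmp_el C (F (j b)) (F v) (G v) ([], t) (lin (far F (j b) v) w) =
     cmp_el C (F (j b)) (G (j b)) (G v) (lin (far G (j b) v) w) ([], \<tau> b))"
    if v [simp]: "v \<in> Ob V" for v
  proof -
    have g: "Kan_colimit v C (F \<circ>\<^sub>V j) (F v) (\<lambda>b. far F (j b) v)"
      using d unfolding dense_cocontinuous_def by simp
    let ?T = "\<lambda>b. at_point (VCmp C (F (j b)) (G (j b)) (G v)) (C (G (j b)) (G v)) (\<tau> b) \<cdot> far G (j b) v"
    have T: "?T b \<in> Hom V (W v b) (C (F (j b)) (G v))"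
      "\<And>w. w \<in> El (W v b) \<Longrightarrow> lin (?T b) w =
        cmp_el C (F (j b)) (G (j b)) (G v) (lin (far G (j b) v) w) ([], \<tau> b)"
      if b [simp]: "b \<in> VOb J" for b
    proof -
      have "VCmp C (F (j b)) (G (j b)) (G v) \<in>
        Hom V (C (G (j b)) (G v) \<otimes> C (F (j b)) (G (j b))) (C (F (j b)) (G v))"
        by (rule vcat_cmp[OF C]) simp_all
      note S = at_point_lin[OF this t\<tau>(1)[OF b]]
      have Gf: "far G (j b) v \<in> Hom V (W v b) (C (G (j b)) (G v))"
        using vfunctor_far[OF G, of "j b" v] by simp
      show "?T b \<in> Hom V (W v b) (C (F (j b)) (G v))"
        by (rule cmp[OF Gf S(1)]) simp_all
      show "lin (?T b) w =
        cmp_el C (F (j b)) (G (j b)) (G v) (lin (far G (j b) v) w) ([], \<tau> b)" if w: "w \<in> El (W v b)" for w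
        using S lin_lin[OF Gf S(1) w] lin_El[OF Gf w] unfolding cmp_el_def by simp
    qed
    have "cone v C (F \<circ>\<^sub>V j) (G v) ?T"
      unfolding cone_def
    proof (intro conjI ballI)
      fix a b w f assume [simp]: "a \<in> VOb J" "b \<in> VOb J" and w [simp]: "w \<in> El (W v b)" and f [simp]: "f \<in> El (J a b)"
      have "lin (?T a) (act a b v w f) =
        cmp_el C (F (j a)) (G (j a)) (G v) (cmp_el C (G (j a)) (G (j b)) (G v)
          (lin (far G (j b) v) w) (lin (far G (j a) (j b)) (lin (far j a b) f))) ([], \<tau> a)"
        by (simp add: T(2) Gc)
      also have "\<dots> = cmp_el C (F (j a)) (G (j b)) (G v) (lin (far G (j b) v) w)
        (cmp_el C (F (j a)) (F (j b)) (G (j b)) ([], \<tau> b) (lin (far F (j a) (j b)) (lin (far j a b) f)))"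
        using t\<tau>(2,3) by (simp add: C cmp_el_assoc FjE GjE)
      also have "\<dots> = cmp_el C (F (j a)) (F (j b)) (G v) (lin (?T b) w) (lin (far F (j a) (j b)) (lin (far j a b) f))"
        using t\<tau>(2) by (simp add: C cmp_el_assoc T(2))
      finally show "lin (?T a) (act a b v w f) = cmp_el C ((F \<circ>\<^sub>V j) a) ((F \<circ>\<^sub>V j) b) (G v) (lin (?T b) w)
          (lin (far (F \<circ>\<^sub>V j) a b) f)"
        by (simp add: FjE)
    qed (use T(1) in simp)
    then show ?thesis
      by (rule Kan_colimit_point[OF C Fj v g vfunctor_ob[OF G, simplified, OF v]]) (use T(2) in auto)
  qed
  then obtain t where t: "\<And>v. v \<in> Ob V \<Longrightarrow> t v \<in> Hom V \<I> (C (F v) (G v))"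
    "\<And>v b w. v \<in> Ob V \<Longrightarrow> b \<in> VOb J \<Longrightarrow> w \<in> El (W v b) \<Longrightarrow>
     cmp_el C (F (j b)) (F v) (G v) ([], t v) (lin (far F (j b) v) w) =
     cmp_el C (F (j b)) (G (j b)) (G v) (lin (far G (j b) v) w) ([], \<tau> b)"
    by metis
  have tE [simp]: "([], t v) \<in> El (C (F v) (G v))" if "v \<in> Ob V" for v
    using t(1)[OF that] by (rule point_El)
  show thesis
  proof (rule that)
    show "is_vnat \<V> C F G t"
      unfolding is_vnat_iff[OF is_vcat_self C F G]
    proof (intro conjI ballI)
      fix x y f assume "x \<in> VOb \<V>" "y \<in> VOb \<V>" "f \<in> El (\<V> x y)"
      then have o [simp]: "x \<in> Ob V" "y \<in> Ob V" "f \<in> El (IHom V x y)" by simp_all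
      have g: "Kan_colimit x C (F \<circ>\<^sub>V j) (F x) (\<lambda>b. far F (j b) x)"
        using d unfolding dense_cocontinuous_def by simp
      show "cmp_el C (F x) (F y) (G y) ([], t y) (lin (far F x y) f) =
        cmp_el C (F x) (G x) (G y) (lin (far G x y) f) ([], t x)"
      proof (rule Kan_colimit_ext[OF C Fj o(1) g])
        fix b w assume b [simp]: "b \<in> VOb J" and w [simp]: "w \<in> El (W x b)"
        have fw [simp]: "cmp_el \<V> (j b) x y f w \<in> El (W y b)" by (rule self_cmp_el_El) simp_all
        have "cmp_el C (F (j b)) (F x) (G y) (cmp_el C (F x) (F y) (G y) ([], t y) (lin (far F x y) f)) (lin (far F (j b) x) w)
          = cmp_el C (F (j b)) (F y) (G y) ([], t y) (lin (far F (j b) y) (cmp_el \<V> (j b) x y f w))"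
          using C by (simp add: cmp_el_assoc Fc)
        also have "\<dots> = cmp_el C (F (j b)) (G x) (G y) (lin (far G x y) f)
          (cmp_el C (F (j b)) (G (j b)) (G x) (lin (far G (j b) x) w) ([], \<tau> b))"
          using C t\<tau>(2) by (simp add: t(2) Gc cmp_el_assoc)
        also have "\<dots> = cmp_el C (F (j b)) (F x) (G y) (cmp_el C (F x) (G x) (G y) (lin (far G x y) f) ([], t x)) (lin (far F (j b) x) w)"
          using C by (simp add: t(2)[symmetric] cmp_el_assoc)
        finally show "cmp_el C ((F \<circ>\<^sub>V j) b) (F x) (G y) (cmp_el C (F x) (F y) (G y) ([], t y) (lin (far F x y) f)) (lin (far F (j b) x) w)
          = cmp_el C ((F \<circ>\<^sub>V j) b) (F x) (G y) (cmp_el C (F x) (G x) (G y) (lin (far G x y) f) ([], t x)) (lin (far F (j b) x) w)"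
          by simp
      qed (use C in simp_all)
    qed (use t in simp)
    fix b assume b [simp]: "b \<in> VOb J"
    have "cmp_el C (F (j b)) (F (j b)) (G (j b)) ([], t (j b)) (lin (far F (j b) (j b)) (one_el \<V> (j b))) =
      cmp_el C (F (j b)) (G (j b)) (G (j b)) (lin (far G (j b) (j b)) (one_el \<V> (j b))) ([], \<tau> b)"
      by (rule t(2)) (simp_all add: self_one_el_El)
    then have "([] :: 'o list, t (j b)) = ([], \<tau> b)"
      using C F G t\<tau>(2) by simp
    then show "t (j b) = \<tau> b" by simp
  qed
qed

lemma restriction_faithful:
  assumes C: "is_vcat C" and F: "is_vfunctor \<V> C F" and G: "is_vfunctor \<V> C G"
    and d: "dense_cocontinuous C F" and s: "is_vnat \<V> C F G s" and t: "is_vnat \<V> C F G t"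
    and st: "\<And>b. b \<in> VOb J \<Longrightarrow> s (j b) = t (j b)" and v: "v \<in> Ob V"
  shows "s v = t v"
proof -
  note Fj = vfunctor_comp[OF J is_vcat_self C j F]
  note s' = vnatD[OF is_vcat_self C F G s, simplified] and t' = vnatD[OF is_vcat_self C F G t, simplified]
  have g: "Kan_colimit v C (F \<circ>\<^sub>V j) (F v) (\<lambda>b. far F (j b) v)"
    using d v unfolding dense_cocontinuous_def by simp
  have "([] :: 'o list, s v) = ([], t v)"
  proof (rule Kan_colimit_ext[OF C Fj v g])
    show "cmp_el C ((F \<circ>\<^sub>V j) b) (F v) (G v) ([], s v) (lin (far F (j b) v) w) =
      cmp_el C ((F \<circ>\<^sub>V j) b) (F v) (G v) ([], t v) (lin (far F (j b) v) w)"
      if "b \<in> VOb J" "w \<in> El (W v b)" for b w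
      using s'(3)[of "j b" v w] t'(3)[of "j b" v w] that v st[of b] by simp
  qed (use s'(2) t'(2) v G in simp_all)
  then show ?thesis by simp
qed

end

context smcc begin

section \<open>Composites and inverses of transformations\<close>

definition vcomp :: "('y, 'o, 'a) vcat \<Rightarrow> ('x, 'y, 'a) vfunctor \<Rightarrow> ('x, 'y, 'a) vfunctor \<Rightarrow> ('x, 'y, 'a) vfunctor \<Rightarrow>
    ('x \<Rightarrow> 'a) \<Rightarrow> ('x \<Rightarrow> 'a) \<Rightarrow> 'x \<Rightarrow> 'a" where
  "vcomp B F G H s t x = VCmp B (F x) (G x) (H x) \<cdot> (s x \<oslash> t x) \<cdot> inv (LUn V \<I>)"

lemma vcomp_point: "([], vcomp B F G H s t x) = cmp_el B (F x) (G x) (H x) ([], s x) ([], t x)"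
  by (simp add: vcomp_def cmp_el_def bil_def)

lemma vnat_pointI:
  assumes "is_vcat A" "is_vcat B" "is_vfunctor A B F" "is_vfunctor A B G"
    and "\<And>x. x \<in> VOb A \<Longrightarrow> ([], t x) \<in> El (B (F x) (G x))"
    and "\<And>x y f. x \<in> VOb A \<Longrightarrow> y \<in> VOb A \<Longrightarrow> f \<in> El (A x y) \<Longrightarrow>
      cmp_el B (F x) (F y) (G y) ([], t y) (lin (far F x y) f) =
      cmp_el B (F x) (G x) (G y) (lin (far G x y) f) ([], t x)"
  shows "is_vnat A B F G t"
proof -
  have "t x \<in> Hom V \<I> (B (F x) (G x))" if "x \<in> VOb A" for x
    using assms(5)[OF that] by (simp add: El_iff in_Hom)
  then show ?thesis unfolding is_vnat_iff[OF assms(1-4)] using assms(6) by blast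
qed

lemma vnat_comp:
  assumes A: "is_vcat A" and B: "is_vcat B" and F: "is_vfunctor A B F" and G: "is_vfunctor A B G" and H: "is_vfunctor A B H"
    and t: "is_vnat A B F G t" and s: "is_vnat A B G H s"
  shows "is_vnat A B F H (vcomp B F G H s t)"
proof (rule vnat_pointI[OF A B F H])
  note t' = vnatD[OF A B F G t] and s' = vnatD[OF A B G H s]
  show "x \<in> VOb A \<Longrightarrow> ([], vcomp B F G H s t x) \<in> El (B (F x) (H x))" for x
    unfolding vcomp_point using t' s' B F G H by simp
  fix x y f assume x: "x \<in> VOb A" "y \<in> VOb A" "f \<in> El (A x y)"
  have "cmp_el B (F x) (F y) (H y) ([], vcomp B F G H s t y) (lin (far F x y) f) =
    cmp_el B (F x) (G y) (H y) ([], s y) (cmp_el B (F x) (G x) (G y) (lin (far G x y) f) ([], t x))"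
    unfolding vcomp_point using x t' s' A B F G H by (simp add: cmp_el_assoc)
  also have "\<dots> = cmp_el B (F x) (G x) (H y) (cmp_el B (G x) (G y) (H y) ([], s y) (lin (far G x y) f)) ([], t x)"
    using x t'(2) s'(2) A B F G H by (simp add: cmp_el_assoc)
  also have "\<dots> = cmp_el B (F x) (H x) (H y) (lin (far H x y) f) ([], vcomp B F G H s t x)"
    unfolding vcomp_point using x t'(2) s' A B F G H by (simp add: cmp_el_assoc)
  finally show "cmp_el B (F x) (F y) (H y) ([], vcomp B F G H s t y) (lin (far F x y) f) =
    cmp_el B (F x) (H x) (H y) (lin (far H x y) f) ([], vcomp B F G H s t x)" .
qed

lemma vnat_id:
  assumes "is_vcat A" "is_vcat B" "is_vfunctor A B F"
  shows "is_vnat A B F F (\<lambda>x. VId B (F x))"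
  by (rule vnat_pointI) (use assms in \<open>simp_all add: one_el_def[symmetric]\<close>)

text \<open>Only the objectwise equations are required of \<open>s\<close>; naturality follows (\<open>inverse_nat\<close>).\<close>

definition vinverse :: "('x, 'o, 'a) vcat \<Rightarrow> ('y, 'o, 'a) vcat \<Rightarrow> ('x, 'y, 'a) vfunctor \<Rightarrow> ('x, 'y, 'a) vfunctor \<Rightarrow>
    ('x \<Rightarrow> 'a) \<Rightarrow> ('x \<Rightarrow> 'a) \<Rightarrow> bool" where
  "vinverse A B F G t s \<longleftrightarrow> (\<forall>x\<in>VOb A. ([], s x) \<in> El (B (G x) (F x)) \<and>
     cmp_el B (F x) (G x) (F x) ([], s x) ([], t x) = one_el B (F x) \<and>
     cmp_el B (G x) (F x) (G x) ([], t x) ([], s x) = one_el B (G x))"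

lemma inverse_nat:
  assumes A: "is_vcat A" and B: "is_vcat B" and F: "is_vfunctor A B F" and G: "is_vfunctor A B G"
    and t: "is_vnat A B F G t" and s: "vinverse A B F G t s"
  shows "is_vnat A B G F s"
proof (rule vnat_pointI[OF A B G F])
  note t' = vnatD[OF A B F G t]
  have s': "([], s x) \<in> El (B (G x) (F x))"
     "cmp_el B (F x) (G x) (F x) ([], s x) ([], t x) = one_el B (F x)"
     "cmp_el B (G x) (F x) (G x) ([], t x) ([], s x) = one_el B (G x)" if "x \<in> VOb A" for x
    using s that unfolding vinverse_def by auto
  then show "x \<in> VOb A \<Longrightarrow> ([], s x) \<in> El (B (G x) (F x))" for x by simp
  fix x y f assume x: "x \<in> VOb A" "y \<in> VOb A" "f \<in> El (A x y)"
  note [simp] = A B x t'(2) s'(1)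
  have [simp]: "F x \<in> VOb B" "F y \<in> VOb B" "G x \<in> VOb B" "G y \<in> VOb B"
    "lin (far F x y) f \<in> El (B (F x) (F y))" "lin (far G x y) f \<in> El (B (G x) (G y))"
    using F G x by simp_all
  have "cmp_el B (G x) (G y) (F y) ([], s y) (lin (far G x y) f) =
    cmp_el B (G x) (G y) (F y) ([], s y) (cmp_el B (G x) (G x) (G y) (lin (far G x y) f)
      (cmp_el B (G x) (F x) (G x) ([], t x) ([], s x)))"
    by (simp add: s')
  also have "\<dots> = cmp_el B (G x) (G y) (F y) ([], s y) (cmp_el B (G x) (F x) (G y)
      (cmp_el B (F x) (G x) (G y) (lin (far G x y) f) ([], t x)) ([], s x))"
    by (simp add: cmp_el_assoc)
  also have "\<dots> = cmp_el B (G x) (G y) (F y) ([], s y) (cmp_el B (G x) (F x) (G y)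
      (cmp_el B (F x) (F y) (G y) ([], t y) (lin (far F x y) f)) ([], s x))"
    by (simp add: t'(3))
  also have "\<dots> = cmp_el B (G x) (F x) (F y)
     (cmp_el B (F x) (F y) (F y) (cmp_el B (F y) (G y) (F y) ([], s y) ([], t y)) (lin (far F x y) f)) ([], s x)"
    by (simp add: cmp_el_assoc)
  finally show "cmp_el B (G x) (G y) (F y) ([], s y) (lin (far G x y) f) =
    cmp_el B (G x) (F x) (F y) (lin (far F x y) f) ([], s x)"
    by (simp add: s')
qed

lemma ap_bil_Curry:
  assumes m: "m \<in> Hom V (X \<otimes> Y) Z" and n: "n \<in> Hom V (K \<otimes> M) X" and s: "s \<in> Hom V Y' Y"
    and e: "\<kappa> \<in> El K" "w \<in> El M" "y \<in> El Y'"
  shows "Curry (K \<otimes> M) Y' (m \<cdot> (n \<oslash> s)) \<in> Hom V (K \<otimes> M) (IHom V Y' Z)"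
    "ap Y' Z (bil (Curry (K \<otimes> M) Y' (m \<cdot> (n \<oslash> s))) \<kappa> w) y = bil m (bil n \<kappa> w) (lin s y)"
proof -
  have o: "K \<in> Ob V" "M \<in> Ob V" "Y' \<in> Ob V" using e El_ob by auto
  have p: "m \<cdot> (n \<oslash> s) \<in> Hom V ((K \<otimes> M) \<otimes> Y') Z" using m n s by (simp add: in_Hom)
  have i: "\<one> (K \<otimes> M) \<in> Hom V (K \<otimes> M) (K \<otimes> M)" using o by (simp add: in_Hom)
  note E = bil_El[OF i e(1,2)]
  show c: "Curry (K \<otimes> M) Y' (m \<cdot> (n \<oslash> s)) \<in> Hom V (K \<otimes> M) (IHom V Y' Z)"
    using Curry_Hom(1)[OF p] o by simp
  have "bil (Curry (K \<otimes> M) Y' (m \<cdot> (n \<oslash> s))) \<kappa> w = lin (Curry (K \<otimes> M) Y' (m \<cdot> (n \<oslash> s))) (bil (\<one> (K \<otimes> M)) \<kappa> w)"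
    unfolding lin_bil[OF i c e(1,2)] using c by (simp add: in_Hom)
  then show "ap Y' Z (bil (Curry (K \<otimes> M) Y' (m \<cdot> (n \<oslash> s))) \<kappa> w) y = bil m (bil n \<kappa> w) (lin s y)"
    using ap_Curry[OF p E e(3)] bil_lin_lin[OF m n s E e(3)] lin_bil[OF i n e(1,2)] n by (simp add: in_Hom)
qed

text \<open>A map of three variables, transposed twice; used to compare two such maps by means of a universal
  property in which only the middle variable is universal.\<close>

lemma double_transpose:
  assumes p: "p \<in> Hom V ((K \<otimes> M) \<otimes> Y) Z" and o: "K \<in> Ob V" "M \<in> Ob V" "Y \<in> Ob V" "Z \<in> Ob V"
  obtains A where "A \<in> Hom V K (IHom V M (IHom V Y Z))"
    "\<And>\<kappa> z y. \<kappa> \<in> El K \<Longrightarrow> z \<in> El M \<Longrightarrow> y \<in> El Y \<Longrightarrow>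
      ap Y Z (ap M (IHom V Y Z) (lin A \<kappa>) z) y = bil p (bil (\<one> (K \<otimes> M)) \<kappa> z) y"
proof -
  have i: "\<one> (K \<otimes> M) \<in> Hom V (K \<otimes> M) (K \<otimes> M)" and iy: "\<one> Y \<in> Hom V Y Y" using o by (simp_all add: in_Hom)
  let ?C = "Curry (K \<otimes> M) Y (p \<cdot> (\<one> (K \<otimes> M) \<oslash> \<one> Y))"
  note c = ap_bil_Curry[OF p i iy]
  have cH: "?C \<in> Hom V (K \<otimes> M) (IHom V Y Z)" using c(1)[OF gen_El gen_El gen_El] o by simp
  show thesis
  proof (rule that)
    show "Curry K M ?C \<in> Hom V K (IHom V M (IHom V Y Z))" by (rule Curry_Hom(1)[OF cH o(1,2)])
    fix \<kappa> z y assume e: "\<kappa> \<in> El K" "z \<in> El M" "y \<in> El Y"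
    show "ap Y Z (ap M (IHom V Y Z) (lin (Curry K M ?C) \<kappa>) z) y = bil p (bil (\<one> (K \<otimes> M)) \<kappa> z) y"
      unfolding ap_Curry[OF cH e(1,2)] c(2)[OF e] lin_one[OF e(3)] ..
  qed
qed

end

context arity_system begin

section \<open>Left Kan extensions\<close>

text \<open>The arrow \<open>L f\<close> is the factorization of the cocone \<open>w \<mapsto> r (f \<cdot> w)\<close>, and functoriality is
  uniqueness of factorizations.\<close>

lemma Lan_functor:
  assumes C: "is_vcat C" and P: "is_vfunctor J C P"
    and cocomplete: "\<And>v. v \<in> Ob V \<Longrightarrow> \<exists>c r. Kan_colimit v C P c r"
  obtains L r where "is_vfunctor \<V> C L"
    "\<And>v. v \<in> Ob V \<Longrightarrow> Kan_colimit v C P (L v) (r v)"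
    "\<And>v v' b f w. \<lbrakk>v \<in> Ob V; v' \<in> Ob V; b \<in> VOb J; f \<in> El (IHom V v v'); w \<in> El (W v b)\<rbrakk> \<Longrightarrow>
      cmp_el C (P b) (L v) (L v') (lin (far L v v') f) (lin (r v b) w) =
      lin (r v' b) (cmp_el \<V> (j b) v v' f w)"
proof -
  obtain Lo r where g: "\<And>v. v \<in> Ob V \<Longrightarrow> Kan_colimit v C P (Lo v) (r v)"
    using cocomplete by metis
  have Lo [simp]: "Lo v \<in> VOb C" if "v \<in> Ob V" for v using Kan_colimitD(1)[OF g[OF that]] .
  note [simp] = C vfunctor_ob[OF P] coneD(3)[OF Kan_colimitD(2)[OF g]]
  have "\<exists>h\<in>Hom V (IHom V v v') (C (Lo v) (Lo v')). \<forall>b\<in>VOb J. \<forall>f\<in>El (IHom V v v'). \<forall>w\<in>El (W v b).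
      cmp_el C (P b) (Lo v) (Lo v') (lin h f) (lin (r v b) w) = lin (r v' b) (cmp_el \<V> (j b) v v' f w)"
    if v [simp]: "v \<in> Ob V" "v' \<in> Ob V" for v v'
  proof -
    note r' = Kan_colimitD(2)[OF g[OF v(2)]]
    let ?T = "\<lambda>b. r v' b \<cdot> VCmp \<V> (j b) v v'"
    have T: "?T b \<in> Hom V (IHom V v v' \<otimes> W v b) (C (P b) (Lo v'))"
      "\<And>f w. f \<in> El (IHom V v v') \<Longrightarrow> w \<in> El (W v b) \<Longrightarrow> bil (?T b) f w = lin (r v' b) (cmp_el \<V> (j b) v v' f w)"
      if b [simp]: "b \<in> VOb J" for b
    proof -
      have m: "VCmp \<V> (j b) v v' \<in> Hom V (IHom V v v' \<otimes> W v b) (W v' b)" by (rule self_cmp) simp_all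
      note rb = coneD(1)[OF r' b]
      show "?T b \<in> Hom V (IHom V v v' \<otimes> W v b) (C (P b) (Lo v'))" using m rb by (simp add: in_Hom)
      show "bil (?T b) f w = lin (r v' b) (cmp_el \<V> (j b) v v' f w)" if "f \<in> El (IHom V v v')" "w \<in> El (W v b)" for f w
        unfolding cmp_el_def by (rule lin_bil[symmetric, OF m rb that])
    qed
    have "indexed_cone v C P (Lo v') (IHom V v v') ?T"
      unfolding indexed_cone_def
    proof (intro conjI ballI)
      fix a b \<kappa> w f assume [simp]: "a \<in> VOb J" "b \<in> VOb J" "\<kappa> \<in> El (IHom V v v')" "w \<in> El (W v b)" "f \<in> El (J a b)"
      have "bil (?T a) \<kappa> (act a b v w f) = lin (r v' a) (act a b v' (cmp_el \<V> (j b) v v' \<kappa> w) f)"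
        by (simp add: T(2) cmp_el_assoc)
      also have "\<dots> = cmp_el C (P a) (P b) (Lo v') (bil (?T b) \<kappa> w) (lin (far P a b) f)"
        by (simp add: T(2) coneD(2)[OF r'])
      finally show "bil (?T a) \<kappa> (act a b v w f) = cmp_el C (P a) (P b) (Lo v') (bil (?T b) \<kappa> w) (lin (far P a b) f)" .
    qed (use T in simp)
    then obtain h where "h \<in> Hom V (IHom V v v') (C (Lo v) (Lo v'))"
      "\<And>b \<kappa> w. b \<in> VOb J \<Longrightarrow> \<kappa> \<in> El (IHom V v v') \<Longrightarrow> w \<in> El (W v b) \<Longrightarrow>
        cmp_el C (P b) (Lo v) (Lo v') (lin h \<kappa>) (lin (r v b) w) = bil (?T b) \<kappa> w"
      using Kan_colimit_factor[OF C P v(1) g[OF v(1)] Lo[OF v(2)] ihom_ob[OF v]] by blast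
    then show ?thesis using T(2) by (intro bexI[of _ h]) auto
  qed
  then obtain La where La: "\<And>v v'. v \<in> Ob V \<Longrightarrow> v' \<in> Ob V \<Longrightarrow> La v v' \<in> Hom V (IHom V v v') (C (Lo v) (Lo v'))"
    and Lr: "\<And>v v' b f w. \<lbrakk>v \<in> Ob V; v' \<in> Ob V; b \<in> VOb J; f \<in> El (IHom V v v'); w \<in> El (W v b)\<rbrakk> \<Longrightarrow>
      cmp_el C (P b) (Lo v) (Lo v') (lin (La v v') f) (lin (r v b) w) =
      lin (r v' b) (cmp_el \<V> (j b) v v' f w)"
    by metis
  define L where "L = \<lparr>fob = Lo, far = La\<rparr>"
  have [simp]: "fob L = Lo" "far L = La" by (simp_all add: L_def)
  have LaE [simp]: "lin (La v v') f \<in> El (C (Lo v) (Lo v'))" if "v \<in> Ob V" "v' \<in> Ob V" "f \<in> El (IHom V v v')" for v v' f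
    by (rule lin_El[OF La]) (use that in simp_all)
  show thesis
  proof (rule that)
    show "is_vfunctor \<V> C L"
    proof (rule is_vfunctorI[OF is_vcat_self C])
      fix v assume "v \<in> VOb \<V>"
      then have v [simp]: "v \<in> Ob V" by simp
      have "lin (La v v) (one_el \<V> v) = one_el C (Lo v)"
      proof (rule Kan_colimit_ext[OF C P v g[OF v]])
        fix b w assume [simp]: "b \<in> VOb J" "w \<in> El (W v b)"
        show "cmp_el C (P b) (Lo v) (Lo v) (lin (La v v) (one_el \<V> v)) (lin (r v b) w)
          = cmp_el C (P b) (Lo v) (Lo v) (one_el C (Lo v)) (lin (r v b) w)"
          by (simp add: Lr)
      qed simp_all
      then show "lin (far L v v) (one_el \<V> v) = one_el C (L v)" by simp
    next
      fix x y z g' f assume "x \<in> VOb \<V>" "y \<in> VOb \<V>" "z \<in> VOb \<V>" "g' \<in> El (\<V> y z)" "f \<in> El (\<V> x y)"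
      then have o [simp]: "x \<in> Ob V" "y \<in> Ob V" "z \<in> Ob V" "g' \<in> El (IHom V y z)" "f \<in> El (IHom V x y)" by simp_all
      have "lin (La x z) (cmp_el \<V> x y z g' f) = cmp_el C (Lo x) (Lo y) (Lo z) (lin (La y z) g') (lin (La x y) f)"
      proof (rule Kan_colimit_ext[OF C P o(1) g[OF o(1)]])
        fix b w assume [simp]: "b \<in> VOb J" "w \<in> El (W x b)"
        show "cmp_el C (P b) (Lo x) (Lo z) (lin (La x z) (cmp_el \<V> x y z g' f)) (lin (r x b) w) =
          cmp_el C (P b) (Lo x) (Lo z) (cmp_el C (Lo x) (Lo y) (Lo z) (lin (La y z) g') (lin (La x y) f)) (lin (r x b) w)"
          using C by (simp add: Lr cmp_el_assoc)
      qed (use C in simp_all)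
      then show "lin (far L x z) (cmp_el \<V> x y z g' f) = cmp_el C (L x) (L y) (L z) (lin (far L y z) g') (lin (far L x y) f)"
        by simp
    qed (use La in simp_all)
  qed (use g Lr in simp_all)
qed

text \<open>Let \<open>q\<close> be the colimit cocone of \<open>d\<close> and \<open>T\<close> a cocone on \<open>L D\<close>. An arrow \<open>h\<close> out of
  \<open>L d\<close> amounts to a natural family of maps \<open>S\<^sub>a\<close> from \<open>V(ja,d)\<close> to \<open>C(Pa,x)\<close>, and \<open>h \<cdot> L (q w) = T w\<close> amounts to
  \<open>S\<^sub>a (q w \<cdot> y) = T w \<cdot> r y\<close> for all \<open>y : ja \<rightarrow> Db\<close>. By flatness \<open>V(ja,d)\<close> is a colimit of the
  \<open>V(ja,Db)\<close>, so that \<open>S\<^sub>a\<close> exists and is determined by this equation.\<close>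

lemma Lan_preserving:
  assumes C: "is_vcat C" and P: "is_vfunctor J C P" and L: "is_vfunctor \<V> C L"
    and g: "\<And>v. v \<in> Ob V \<Longrightarrow> Kan_colimit v C P (L v) (r v)"
    and Lr: "\<And>v v' b f w. \<lbrakk>v \<in> Ob V; v' \<in> Ob V; b \<in> VOb J; f \<in> El (IHom V v v'); w \<in> El (W v b)\<rbrakk> \<Longrightarrow>
      cmp_el C (P b) (L v) (L v') (lin (far L v v') f) (lin (r v b) w) =
      lin (r v' b) (cmp_el \<V> (j b) v v' f w)"
    and flat: "\<And>a. a \<in> VOb J \<Longrightarrow> Kan_preserving \<V> \<V> (covariant_hom \<V> (j a))"
  shows "Kan_preserving \<V> C L"
  unfolding Kan_preserving_def
proof (intro ballI allI impI)
  fix v D d q assume v [simp]: "v \<in> Ob V" and D: "is_vfunctor J \<V> D" and q: "Kan_colimit v \<V> D d q"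
  note [simp] = C
  have d [simp]: "d \<in> Ob V" using Kan_colimitD(1)[OF q] by simp
  note qc = Kan_colimitD(2)[OF q] and rc = Kan_colimitD(2)[OF g]
  note [simp] = vfunctor_simps[OF L, simplified] vfunctor_simps[OF P] vfunctor_simps[OF D, simplified]
    coneD(3)[OF qc, simplified] coneD(3)[OF rc]
  note Do = vfunctor_ob[OF D, simplified] and Lo = vfunctor_ob[OF L, simplified]
  have LD: "is_vfunctor J C (L \<circ>\<^sub>V D)" by (rule vfunctor_comp[OF J is_vcat_self C D L])
  have Lq: "lin (far L (D b) d \<cdot> q b) w = lin (far L (D b) d) (lin (q b) w)" if "b \<in> VOb J" "w \<in> El (W v b)" for b w
    using lin_lin[OF coneD(1)[OF qc that(1)] vfunctor_far[OF L] that(2)] that by simp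
  note LDE = lin_comp[OF D L]
  define H where "H = (\<lambda>a. covariant_hom \<V> (j a))"
  have H: "is_vfunctor \<V> \<V> (H a)" if "a \<in> VOb J" for a
    unfolding H_def using that by (intro vfunctor_covariant) simp_all
  have Hf [simp]: "(H a) x = W x a" for a x by (simp add: H_def)
  have HD: "is_vfunctor J \<V> (H a \<circ>\<^sub>V D)" if "a \<in> VOb J" for a
    by (rule vfunctor_comp[OF J is_vcat_self is_vcat_self D H[OF that]])
  have Hap: "ap (W x a) (W y a) (lin (far (H a) x y) f) w = cmp_el \<V> (j a) x y f w"
    if "a \<in> VOb J" "x \<in> Ob V" "y \<in> Ob V" "f \<in> El (IHom V x y)" "w \<in> El (W x a)" for a x y f w
    using ap_covariant[OF is_vcat_self, of "j a" x y f w] that by (simp add: H_def)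
  note [simp] = vfunctor_El[OF H, simplified]
  have Hq: "lin (far (H a) (D b) d \<cdot> q b) w = lin (far (H a) (D b) d) (lin (q b) w)"
    if "a \<in> VOb J" "b \<in> VOb J" "w \<in> El (W v b)" for a b w
    using lin_lin[OF coneD(1)[OF qc that(2)] vfunctor_far[OF H[OF that(1)]] that(3)] that by simp
  note HDE = lin_comp[OF D H]
  have HC: "Kan_colimit v \<V> (H a \<circ>\<^sub>V D) (W d a) (\<lambda>b. far (H a) (D b) d \<cdot> q b)" if "a \<in> VOb J" for a
    using flat[OF that] v D q unfolding Kan_preserving_def by (simp add: H_def)
  \<comment> \<open>Uniqueness in the colimit \<open>V(ja,d)\<close>: its elements are generated by the composites \<open>q w \<cdot> y\<close>.\<close>
  have flat_ext: "S = S'"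
    if a: "a \<in> VOb J" and Z: "Z \<in> Ob V" and S: "S \<in> El (IHom V (W d a) Z)" "S' \<in> El (IHom V (W d a) Z)" "fst S = fst S'"
      and e: "\<And>b w y. b \<in> VOb J \<Longrightarrow> w \<in> El (W v b) \<Longrightarrow> y \<in> El (W (D b) a) \<Longrightarrow>
        ap (W d a) Z S (cmp_el \<V> (j a) (D b) d (lin (q b) w) y) = ap (W d a) Z S' (cmp_el \<V> (j a) (D b) d (lin (q b) w) y)"
    for a Z S S'
  proof (rule Kan_colimit_ext[OF is_vcat_self HD[OF a] v HC[OF a], of Z])
    fix b w assume b: "b \<in> VOb J" "w \<in> El (W v b)"
    have "cmp_el \<V> (W (D b) a) (W d a) Z S (lin (far (H a) (D b) d) (lin (q b) w)) =
      cmp_el \<V> (W (D b) a) (W d a) Z S' (lin (far (H a) (D b) d) (lin (q b) w))"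
      by (rule ap_ext[of _ "W (D b) a" Z]) (use a Z S b e[OF b] in \<open>simp_all add: ap_self_cmp Hap\<close>)
    then show "cmp_el \<V> ((H a \<circ>\<^sub>V D) b) (W d a) Z S (lin (far (H a) (D b) d \<cdot> q b) w) =
      cmp_el \<V> ((H a \<circ>\<^sub>V D) b) (W d a) Z S' (lin (far (H a) (D b) d \<cdot> q b) w)"
      using a b by (simp add: Hq)
  qed (use Z S in simp_all)
  show "Kan_colimit v C (L \<circ>\<^sub>V D) (L d) (\<lambda>b. far L (D b) d \<cdot> q b)"
  proof (rule Kan_colimitI[OF C LD v Lo[OF d]])
    show "cone v C (L \<circ>\<^sub>V D) (L d) (\<lambda>b. far L (D b) d \<cdot> q b)"
      unfolding cone_def
    proof (intro conjI ballI)
      fix b assume b: "b \<in> VOb J"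
      show "far L (D b) d \<cdot> q b \<in> Hom V (W v b) (C ((L \<circ>\<^sub>V D) b) (L d))"
        using coneD(1)[OF qc b] vfunctor_far[OF L, of "D b" d] b by (simp add: in_Hom)
    next
      fix a b w f assume [simp]: "a \<in> VOb J" "b \<in> VOb J" "w \<in> El (W v b)" "f \<in> El (J a b)"
      show "lin (far L (D a) d \<cdot> q a) (act a b v w f) =
        cmp_el C ((L \<circ>\<^sub>V D) a) ((L \<circ>\<^sub>V D) b) (L d) (lin (far L (D b) d \<cdot> q b) w) (lin (far (L \<circ>\<^sub>V D) a b) f)"
        using vfunctor_cmp_el[OF is_vcat_self C L, of "D a" "D b" d "lin (q b) w" "lin (far D a b) f"]
        by (simp add: Lq LDE coneD(2)[OF qc])
    qed
  next
    fix x k T assume x [simp]: "x \<in> VOb C" and k [simp]: "k \<in> Ob V" and T: "indexed_cone v C (L \<circ>\<^sub>V D) x k T"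
    note [simp] = indexed_coneD(3)[OF T, simplified]
    have "\<exists>S. S \<in> Hom V k (IHom V (W d a) (C (P a) x)) \<and>
      (\<forall>b\<in>VOb J. \<forall>\<kappa>\<in>El k. \<forall>w\<in>El (W v b). \<forall>y\<in>El (W (D b) a).
        ap (W d a) (C (P a) x) (lin S \<kappa>) (cmp_el \<V> (j a) (D b) d (lin (q b) w) y) =
        cmp_el C (P a) (L (D b)) x (bil (T b) \<kappa> w) (lin (r (D b) a) y))"
      if a [simp]: "a \<in> VOb J" for a
    proof -
      let ?Z = "C (P a) x"
      have Z: "?Z \<in> VOb \<V>" by simp
      let ?R = "\<lambda>b. Curry (k \<otimes> W v b) (W (D b) a) (VCmp C (P a) (L (D b)) x \<cdot> (T b \<oslash> r (D b) a))"
      have R: "?R b \<in> Hom V (k \<otimes> W v b) (IHom V (W (D b) a) ?Z)"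
        "\<And>\<kappa> w y. \<kappa> \<in> El k \<Longrightarrow> w \<in> El (W v b) \<Longrightarrow> y \<in> El (W (D b) a) \<Longrightarrow>
          ap (W (D b) a) ?Z (bil (?R b) \<kappa> w) y = cmp_el C (P a) (L (D b)) x (bil (T b) \<kappa> w) (lin (r (D b) a) y)"
        if b [simp]: "b \<in> VOb J" for b
      proof -
        have m: "VCmp C (P a) (L (D b)) x \<in>
          Hom V (C (L (D b)) x \<otimes> C (P a) (L (D b))) ?Z"
          by (rule vcat_cmp) simp_all
        have n: "T b \<in> Hom V (k \<otimes> W v b) (C (L (D b)) x)" using indexed_coneD(1)[OF T b] by simp
        have s: "r (D b) a \<in> Hom V (W (D b) a) (C (P a) (L (D b)))"
          by (rule coneD(1)[OF rc]) simp_all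
        note c = ap_bil_Curry[OF m n s]
        show "?R b \<in> Hom V (k \<otimes> W v b) (IHom V (W (D b) a) ?Z)"
          by (rule c(1)[OF gen_El gen_El gen_El]) simp_all
        show "ap (W (D b) a) ?Z (bil (?R b) \<kappa> w) y = cmp_el C (P a) (L (D b)) x (bil (T b) \<kappa> w) (lin (r (D b) a) y)"
          if "\<kappa> \<in> El k" "w \<in> El (W v b)" "y \<in> El (W (D b) a)" for \<kappa> w y
          unfolding cmp_el_def by (rule c(2)[OF that])
      qed
      have RE [simp]: "bil (?R b) \<kappa> w \<in> El (IHom V (W (D b) a) ?Z)" if "b \<in> VOb J" "\<kappa> \<in> El k" "w \<in> El (W v b)" for b \<kappa> w
        using bil_El[OF R(1)[OF that(1)] that(2,3)] .
      have K: "indexed_cone v \<V> (H a \<circ>\<^sub>V D) ?Z k ?R"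
        unfolding indexed_cone_def
      proof (intro conjI ballI)
        fix b' b \<kappa> w f assume [simp]: "b' \<in> VOb J" "b \<in> VOb J" "\<kappa> \<in> El k" "w \<in> El (W v b)" "f \<in> El (J b' b)"
        have "bil (?R b') \<kappa> (act b' b v w f) =
          cmp_el \<V> (W (D b') a) (W (D b) a) ?Z (bil (?R b) \<kappa> w) (lin (far (H a) (D b') (D b)) (lin (far D b' b) f))"
        proof (rule ap_ext)
          fix y assume y [simp]: "y \<in> El (W (D b') a)"
          have "ap (W (D b') a) ?Z (bil (?R b') \<kappa> (act b' b v w f)) y =
            cmp_el C (P a) (L (D b)) x (bil (T b) \<kappa> w) (cmp_el C (P a) (L (D b')) (L (D b))
               (lin (far L (D b') (D b)) (lin (far D b' b) f)) (lin (r (D b') a) y))"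
            using indexed_coneD(2)[OF T] by (simp add: R(2) LDE cmp_el_assoc)
          also have "\<dots> = ap (W (D b) a) ?Z (bil (?R b) \<kappa> w) (cmp_el \<V> (j a) (D b') (D b) (lin (far D b' b) f) y)"
            by (simp add: Lr R(2))
          finally show "ap (W (D b') a) ?Z (bil (?R b') \<kappa> (act b' b v w f)) y =
            ap (W (D b') a) ?Z (cmp_el \<V> (W (D b') a) (W (D b) a) ?Z (bil (?R b) \<kappa> w) (lin (far (H a) (D b') (D b)) (lin (far D b' b) f))) y"
            by (simp add: ap_self_cmp Hap)
        qed simp_all
        then show "bil (?R b') \<kappa> (act b' b v w f) =
          cmp_el \<V> ((H a \<circ>\<^sub>V D) b') ((H a \<circ>\<^sub>V D) b) ?Z (bil (?R b) \<kappa> w) (lin (far (H a \<circ>\<^sub>V D) b' b) f)"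
          by (simp add: HDE)
      qed (use R(1) in simp)
      obtain S where S: "S \<in> Hom V k (\<V> (W d a) ?Z)"
        "\<And>b \<kappa> w. b \<in> VOb J \<Longrightarrow> \<kappa> \<in> El k \<Longrightarrow> w \<in> El (W v b) \<Longrightarrow>
          cmp_el \<V> ((H a \<circ>\<^sub>V D) b) (W d a) ?Z (lin S \<kappa>) (lin (far (H a) (D b) d \<cdot> q b) w) = bil (?R b) \<kappa> w"
        using Kan_colimit_factor[OF is_vcat_self HD[OF a] v HC[OF a] Z k K] by blast
      have SE [simp]: "lin S \<kappa> \<in> El (IHom V (W d a) ?Z)" if "\<kappa> \<in> El k" for \<kappa> using lin_El[OF S(1) that] by simp
      show ?thesis
      proof (intro exI[of _ S] conjI ballI)
        fix b \<kappa> w y assume [simp]: "b \<in> VOb J" "\<kappa> \<in> El k" "w \<in> El (W v b)" "y \<in> El (W (D b) a)"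
        have "ap (W d a) ?Z (lin S \<kappa>) (cmp_el \<V> (j a) (D b) d (lin (q b) w) y) =
          ap (W (D b) a) ?Z (cmp_el \<V> (W (D b) a) (W d a) ?Z (lin S \<kappa>) (lin (far (H a) (D b) d) (lin (q b) w))) y"
          by (simp add: ap_self_cmp Hap)
        also have "\<dots> = ap (W (D b) a) ?Z (bil (?R b) \<kappa> w) y"
          using S(2)[of b \<kappa> w] by (simp add: Hq)
        finally show "ap (W d a) ?Z (lin S \<kappa>) (cmp_el \<V> (j a) (D b) d (lin (q b) w) y) =
          cmp_el C (P a) (L (D b)) x (bil (T b) \<kappa> w) (lin (r (D b) a) y)"
          by (simp add: R(2))
      qed (use S in simp)
    qed
    then obtain S where S: "\<And>a. a \<in> VOb J \<Longrightarrow> S a \<in> Hom V k (IHom V (W d a) (C (P a) x))"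
      and S2: "\<And>a b \<kappa> w y. \<lbrakk>a \<in> VOb J; b \<in> VOb J; \<kappa> \<in> El k; w \<in> El (W v b); y \<in> El (W (D b) a)\<rbrakk> \<Longrightarrow>
        ap (W d a) (C (P a) x) (lin (S a) \<kappa>) (cmp_el \<V> (j a) (D b) d (lin (q b) w) y) =
        cmp_el C (P a) (L (D b)) x (bil (T b) \<kappa> w) (lin (r (D b) a) y)"
      by metis
    have SE [simp]: "lin (S a) \<kappa> \<in> El (IHom V (W d a) (C (P a) x))" if "a \<in> VOb J" "\<kappa> \<in> El k" for a \<kappa>
      by (rule lin_El[OF S that(2)]) (use that in simp)
    let ?s = "\<lambda>a. uncurry (W d a) (C (P a) x) (S a)"
    have s: "?s a \<in> Hom V (k \<otimes> W d a) (C (P a) x)"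
      "\<And>\<kappa> z. \<kappa> \<in> El k \<Longrightarrow> z \<in> El (W d a) \<Longrightarrow> bil (?s a) \<kappa> z = ap (W d a) (C (P a) x) (lin (S a) \<kappa>) z"
      if [simp]: "a \<in> VOb J" for a
      by (rule uncurry_Hom[OF S]; simp) (rule bil_uncurry[OF S]; simp)
    have "indexed_cone d C P x k ?s"
      unfolding indexed_cone_def
    proof (intro conjI ballI)
      fix a' a \<kappa> z f assume [simp]: "a' \<in> VOb J" "a \<in> VOb J" "\<kappa> \<in> El k" "z \<in> El (W d a)" "f \<in> El (J a' a)"
      let ?Y = "J a' a" and ?Z = "C (P a') x"
      let ?i = "\<one> (k \<otimes> W d a)"
      let ?act = "VCmp \<V> (j a') (j a) d \<cdot> (\<one> (W d a) \<oslash> far j a' a)"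
      \<comment> \<open>The two sides of naturality, as maps of the three variables \<open>\<kappa>\<close>, \<open>z\<close>, \<open>f\<close>. They agree when \<open>z\<close> is of the
        form \<open>q w \<cdot> y\<close>, and \<open>flat_ext\<close> applies once \<open>f\<close> is transposed into the target.\<close>
      let ?pA = "?s a' \<cdot> (\<one> k \<oslash> ?act) \<cdot> Asc V k (W d a) ?Y"
      let ?pB = "VCmp C (P a') (P a) x \<cdot> (?s a \<oslash> far P a' a)"
      have i: "?i \<in> Hom V (k \<otimes> W d a) (k \<otimes> W d a)" by (simp add: in_Hom)
      have act: "?act \<in> Hom V (W d a \<otimes> ?Y) (W d a')"
        using self_cmp(1)[of "j a'" "j a" d] vfunctor_far[OF j, of a' a] by (simp add: in_Hom)
      have pA: "?pA \<in> Hom V ((k \<otimes> W d a) \<otimes> ?Y) ?Z"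
        using s(1)[of a'] act by (simp add: in_Hom)
      have Pf: "far P a' a \<in> Hom V ?Y (C (P a') (P a))" using vfunctor_far[OF P] by simp
      have m: "VCmp C (P a') (P a) x \<in> Hom V (C (P a) x \<otimes> C (P a') (P a)) ?Z"
        by (rule vcat_cmp) simp_all
      have pB: "?pB \<in> Hom V ((k \<otimes> W d a) \<otimes> ?Y) ?Z"
        using s(1)[of a] m Pf by (simp add: in_Hom)
      have eA: "bil ?pA (bil ?i \<kappa> z) f = ap (W d a') ?Z (lin (S a') \<kappa>) (act a' a d z f)"
        if [simp]: "\<kappa> \<in> El k" "z \<in> El (W d a)" "f \<in> El ?Y" for \<kappa> z f
      proof -
        have "bil ?pA (bil ?i \<kappa> z) f = bil (?s a') \<kappa> (bil ?act z f)"
          by (rule bil_assoc[OF _ pA i s(1) act]) (use pA in \<open>simp_all add: in_Hom\<close>)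
        also have "bil ?act z f = act a' a d z f" by (rule act_arrow[symmetric]) simp_all
        finally show ?thesis by (simp add: s(2))
      qed
      have eB: "bil ?pB (bil ?i \<kappa> z) f = cmp_el C (P a') (P a) x (ap (W d a) (C (P a) x) (lin (S a) \<kappa>) z) (lin (far P a' a) f)"
        if [simp]: "\<kappa> \<in> El k" "z \<in> El (W d a)" "f \<in> El ?Y" for \<kappa> z f
      proof -
        have "bil ?pB (bil ?i \<kappa> z) f = bil (VCmp C (P a') (P a) x) (lin (?s a) (bil ?i \<kappa> z)) (lin (far P a' a) f)"
          by (rule bil_lin_lin[symmetric, OF m s(1) Pf bil_El[OF i]]) simp_all
        also have "lin (?s a) (bil ?i \<kappa> z) = bil (?s a) \<kappa> z"
          using lin_bil[OF i s(1)[of a], of \<kappa> z] s(1)[of a] by (simp add: in_Hom)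
        finally show ?thesis by (simp add: s(2) cmp_el_def)
      qed
      obtain A where A: "A \<in> Hom V k (IHom V (W d a) (IHom V ?Y ?Z))"
        and A2: "\<And>\<kappa> z y. \<kappa> \<in> El k \<Longrightarrow> z \<in> El (W d a) \<Longrightarrow> y \<in> El ?Y \<Longrightarrow>
          ap ?Y ?Z (ap (W d a) (IHom V ?Y ?Z) (lin A \<kappa>) z) y = bil ?pA (bil ?i \<kappa> z) y"
        by (rule double_transpose[OF pA]) simp_all
      obtain B where B: "B \<in> Hom V k (IHom V (W d a) (IHom V ?Y ?Z))"
        and B2: "\<And>\<kappa> z y. \<kappa> \<in> El k \<Longrightarrow> z \<in> El (W d a) \<Longrightarrow> y \<in> El ?Y \<Longrightarrow>
          ap ?Y ?Z (ap (W d a) (IHom V ?Y ?Z) (lin B \<kappa>) z) y = bil ?pB (bil ?i \<kappa> z) y"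
        by (rule double_transpose[OF pB]) simp_all
      have AE [simp]: "lin A \<kappa> \<in> El (IHom V (W d a) (IHom V ?Y ?Z))" and BE [simp]: "lin B \<kappa> \<in> El (IHom V (W d a) (IHom V ?Y ?Z))"
        using lin_El[OF A] lin_El[OF B] by simp_all
      have "lin A \<kappa> = lin B \<kappa>"
      proof (rule flat_ext[of a "IHom V ?Y ?Z"])
        fix b w y assume [simp]: "b \<in> VOb J" "w \<in> El (W v b)" "y \<in> El (W (D b) a)"
        let ?z = "cmp_el \<V> (j a) (D b) d (lin (q b) w) y"
        show "ap (W d a) (IHom V ?Y ?Z) (lin A \<kappa>) ?z = ap (W d a) (IHom V ?Y ?Z) (lin B \<kappa>) ?z"
        proof (rule ap_ext)
          fix f assume f [simp]: "f \<in> El ?Y"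
          have "act a' a d ?z f = cmp_el \<V> (j a') (D b) d (lin (q b) w) (act a' a (D b) y f)"
            by (rule cmp_el_assoc) simp_all
          then have "ap ?Y ?Z (ap (W d a) (IHom V ?Y ?Z) (lin A \<kappa>) ?z) f =
            cmp_el C (P a') (L (D b)) x (bil (T b) \<kappa> w) (lin (r (D b) a') (act a' a (D b) y f))"
            by (simp add: A2 eA S2)
          also have "lin (r (D b) a') (act a' a (D b) y f) =
            cmp_el C (P a') (P a) (L (D b)) (lin (r (D b) a) y) (lin (far P a' a) f)"
            by (rule coneD(2)[OF rc]) simp_all
          also have "cmp_el C (P a') (L (D b)) x (bil (T b) \<kappa> w) \<dots> = ap ?Y ?Z (ap (W d a) (IHom V ?Y ?Z) (lin B \<kappa>) ?z) f"
            by (simp add: B2 eB S2 cmp_el_assoc)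
          finally show "ap ?Y ?Z (ap (W d a) (IHom V ?Y ?Z) (lin A \<kappa>) ?z) f = ap ?Y ?Z (ap (W d a) (IHom V ?Y ?Z) (lin B \<kappa>) ?z) f" .
        qed simp_all
      qed simp_all
      then have "bil ?pA (bil ?i \<kappa> z) f = bil ?pB (bil ?i \<kappa> z) f"
        using A2[of \<kappa> z f] B2[of \<kappa> z f] by simp
      then show "bil (?s a') \<kappa> (act a' a d z f) = cmp_el C (P a') (P a) x (bil (?s a) \<kappa> z) (lin (far P a' a) f)"
        by (simp add: eA eB s(2))
    qed (use s in simp)
    then obtain h where h: "h \<in> Hom V k (C (L d) x)"
      and h2: "\<And>a \<kappa> z. a \<in> VOb J \<Longrightarrow> \<kappa> \<in> El k \<Longrightarrow> z \<in> El (W d a) \<Longrightarrow>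
        cmp_el C (P a) (L d) x (lin h \<kappa>) (lin (r d a) z) = bil (?s a) \<kappa> z"
      using Kan_colimit_factor[OF C P d g[OF d] x k] by blast
    have hE [simp]: "lin h \<kappa> \<in> El (C (L d) x)" if "\<kappa> \<in> El k" for \<kappa> using lin_El[OF h that] .
    show "\<exists>h\<in>Hom V k (C (L d) x). \<forall>b\<in>VOb J. \<forall>\<kappa>\<in>El k. \<forall>w\<in>El (W v b).
      cmp_el C ((L \<circ>\<^sub>V D) b) (L d) x (lin h \<kappa>) (lin (far L (D b) d \<cdot> q b) w) = bil (T b) \<kappa> w"
    proof (intro bexI[OF _ h] ballI)
      fix b \<kappa> w assume [simp]: "b \<in> VOb J" "\<kappa> \<in> El k" "w \<in> El (W v b)"
      have "cmp_el C (L (D b)) (L d) x (lin h \<kappa>) (lin (far L (D b) d) (lin (q b) w)) = bil (T b) \<kappa> w"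
      proof (rule Kan_colimit_ext[OF C P Do g[OF Do] x])
        fix a y assume [simp]: "a \<in> VOb J" "y \<in> El (W (D b) a)"
        show "cmp_el C (P a) (L (D b)) x (cmp_el C (L (D b)) (L d) x (lin h \<kappa>) (lin (far L (D b) d) (lin (q b) w)))
          (lin (r (D b) a) y) = cmp_el C (P a) (L (D b)) x (bil (T b) \<kappa> w) (lin (r (D b) a) y)"
          by (simp add: cmp_el_assoc Lr h2 s(2) S2)
      qed simp_all
      then show "cmp_el C ((L \<circ>\<^sub>V D) b) (L d) x (lin h \<kappa>) (lin (far L (D b) d \<cdot> q b) w) = bil (T b) \<kappa> w"
        by (simp add: Lq)
    qed
  next
    fix x h h' assume x [simp]: "x \<in> VOb C" and h [simp]: "h \<in> El (C (L d) x)" "h' \<in> El (C (L d) x)"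
      and f: "fst h = fst h'"
      and e: "\<And>b w. b \<in> VOb J \<Longrightarrow> w \<in> El (W v b) \<Longrightarrow>
        cmp_el C ((L \<circ>\<^sub>V D) b) (L d) x h (lin (far L (D b) d \<cdot> q b) w) =
        cmp_el C ((L \<circ>\<^sub>V D) b) (L d) x h' (lin (far L (D b) d \<cdot> q b) w)"
    show "h = h'"
    proof (rule Kan_colimit_ext[OF C P d g[OF d] x h f])
      fix a z assume a [simp]: "a \<in> VOb J" and z [simp]: "z \<in> El (W d a)"
      let ?X = "C (P a) (L d)" and ?Z = "C (P a) x"
      note rd = coneD(1)[OF Kan_colimitD(2)[OF g[OF d]] a]
      \<comment> \<open>The map \<open>z \<mapsto> h \<cdot> r z\<close>, to which \<open>flat_ext\<close> applies.\<close>
      let ?c = "\<lambda>h. cmp_el \<V> (W d a) ?X ?Z (lin (far (covariant_hom C (P a)) (L d) x) h) ([], name (r d a))"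
      have cov [simp]: "lin (far (covariant_hom C (P a)) (L d) x) h \<in> El (IHom V ?X ?Z)"
        if "h \<in> El (C (L d) x)" for h
        by (rule lin_El[OF covariant_far]) (use that in simp_all)
      have nE [simp]: "([], name (r d a)) \<in> El (IHom V (W d a) ?X)" by (rule point_El[OF name_Hom(1)[OF rd]])
      have apc: "ap (W d a) ?Z (?c h) z = cmp_el C (P a) (L d) x h (lin (r d a) z)"
        if [simp]: "h \<in> El (C (L d) x)" "z \<in> El (W d a)" for h z
      proof -
        have "ap (W d a) ?Z (?c h) z = ap ?X ?Z (lin (far (covariant_hom C (P a)) (L d) x) h) (lin (r d a) z)"
          by (subst ap_self_cmp) (simp_all add: name_Hom(2)[OF rd])
        also have "\<dots> = cmp_el C (P a) (L d) x h (lin (r d a) z)"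
          by (rule ap_covariant) simp_all
        finally show ?thesis .
      qed
      have "?c h = ?c h'"
      proof (rule flat_ext[of a ?Z])
        fix b w y assume [simp]: "b \<in> VOb J" "w \<in> El (W v b)" "y \<in> El (W (D b) a)"
        have *: "cmp_el C (P a) (L d) x h'' (lin (r d a) (cmp_el \<V> (j a) (D b) d (lin (q b) w) y)) =
          cmp_el C (P a) (L (D b)) x (cmp_el C (L (D b)) (L d) x h'' (lin (far L (D b) d \<cdot> q b) w)) (lin (r (D b) a) y)"
          if [simp]: "h'' \<in> El (C (L d) x)" for h''
          by (simp add: Lr[symmetric] cmp_el_assoc Lq)
        show "ap (W d a) ?Z (?c h) (cmp_el \<V> (j a) (D b) d (lin (q b) w) y) =
          ap (W d a) ?Z (?c h') (cmp_el \<V> (j a) (D b) d (lin (q b) w) y)"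
          using *[of h] *[of h'] e[of b w] by (simp add: apc)
      qed (use f in simp_all)
      then show "cmp_el C (P a) (L d) x h (lin (r d a) z) = cmp_el C (P a) (L d) x h' (lin (r d a) z)"
        using apc[of h z] apc[of h' z] by simp
    qed
  qed
qed

text \<open>The unit is \<open>r\<close> at the identity of \<open>jb\<close>. An element of the weight of \<open>ja\<close> has the form
  \<open>jf\<close>, so that \<open>jf \<mapsto> P f\<close> is a cocone, and the arrow that it induces is inverse to the unit.\<close>

lemma Lan_unit:
  assumes C: "is_vcat C" and P: "is_vfunctor J C P" and L: "is_vfunctor \<V> C L"
    and g: "\<And>v. v \<in> Ob V \<Longrightarrow> Kan_colimit v C P (L v) (r v)"
    and Lr: "\<And>v v' b f w. \<lbrakk>v \<in> Ob V; v' \<in> Ob V; b \<in> VOb J; f \<in> El (IHom V v v'); w \<in> El (W v b)\<rbrakk> \<Longrightarrow>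
      cmp_el C (P b) (L v) (L v') (lin (far L v v') f) (lin (r v b) w) =
      lin (r v' b) (cmp_el \<V> (j b) v v' f w)"
  obtains \<eta> \<epsilon> where "is_vnat J C P (L \<circ>\<^sub>V j) \<eta>" "vinverse J C P (L \<circ>\<^sub>V j) \<eta> \<epsilon>"
proof -
  note [simp] = C
  note rc = Kan_colimitD(2)[OF g]
  note [simp] = vfunctor_simps[OF L, simplified] vfunctor_simps[OF P] coneD(3)[OF rc]
  note Po = vfunctor_ob[OF P] and LjE = lin_comp[OF j L]
  have Lj: "is_vfunctor J C (L \<circ>\<^sub>V j)" by (rule vfunctor_comp[OF J is_vcat_self C j L])
  define \<eta> where "\<eta> b = snd (lin (r (j b) b) (one_el \<V> (j b)))" for b
  have \<eta>: "([], \<eta> b) = lin (r (j b) b) (one_el \<V> (j b))" for b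
    by (simp add: \<eta>_def lin_def)
  have \<eta>r: "lin (r (j a) b) (lin (far j b a) f) = cmp_el C (P b) (P a) (L (j a)) ([], \<eta> a) (lin (far P b a) f)"
    if "a \<in> VOb J" "b \<in> VOb J" "f \<in> El (J b a)" for a b f
    unfolding \<eta> using coneD(2)[OF rc, of "j a" b a "one_el \<V> (j a)" f] that by simp
  have "\<exists>\<epsilon>. \<epsilon> \<in> Hom V \<I> (C (L (j a)) (P a)) \<and>
     (\<forall>b\<in>VOb J. \<forall>f\<in>El (J b a). cmp_el C (P b) (L (j a)) (P a) ([], \<epsilon>) (lin (r (j a) b) (lin (far j b a) f)) = lin (far P b a) f)"
    if a [simp]: "a \<in> VOb J" for a
  proof -
    let ?T = "\<lambda>b. far P b a \<cdot> inv (far j b a)"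
    have iso: "iso_arr V (far j b a)" if "b \<in> VOb J" for b using ff that by (simp add: fully_faithful_def)
    have jf: "far j b a \<in> Hom V (J b a) (W (j a) b)" if "b \<in> VOb J" for b
      using vfunctor_far[OF j that a] by simp
    have TH: "?T b \<in> Hom V (W (j a) b) (C (P b) (P a))" if "b \<in> VOb J" for b
      using vfunctor_far[OF P that a] jf[OF that] iso[OF that] by (simp add: in_Hom)
    have Tj: "lin (?T b) (lin (far j b a) f) = lin (far P b a) f" if "b \<in> VOb J" "f \<in> El (J b a)" for b f
      using lin_lin[OF jf[OF that(1)] TH[OF that(1)] that(2)] vfunctor_far[OF P that(1) a] jf[OF that(1)] iso[OF that(1)] by (simp add: in_Hom)
    have "cone (j a) C P (P a) ?T"
      unfolding cone_def
    proof (intro conjI ballI)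
      fix b' b w f assume [simp]: "b' \<in> VOb J" "b \<in> VOb J" "w \<in> El (W (j a) b)" "f \<in> El (J b' b)"
      let ?g = "lin (inv (far j b a)) w"
      note w = j_full[OF \<open>b \<in> VOb J\<close> a \<open>w \<in> El (W (j a) b)\<close>]
      have gf: "cmp_el J b' b a ?g f \<in> El (J b' a)" using w(2) by simp
      have "lin (far j b' a) (cmp_el J b' b a ?g f) = act b' b (j a) w f"
        using vfunctor_cmp_el[OF J is_vcat_self j, of b' b a ?g f] w by simp
      then have "lin (?T b') (act b' b (j a) w f) = lin (far P b' a) (cmp_el J b' b a ?g f)"
        using Tj[OF _ gf] by simp
      also have "\<dots> = cmp_el C (P b') (P b) (P a) (lin (far P b a) ?g) (lin (far P b' b) f)"
        using w(2) by (intro vfunctor_cmp_el[OF J C P]) simp_all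
      also have "lin (far P b a) ?g = lin (?T b) w" using Tj[OF _ w(2)] w(3) by simp
      finally show "lin (?T b') (act b' b (j a) w f) =
        cmp_el C (P b') (P b) (P a) (lin (?T b) w) (lin (far P b' b) f)" .
    qed (use TH in simp)
    then obtain t where "t \<in> Hom V \<I> (C (L (j a)) (P a))"
      "\<And>b w. b \<in> VOb J \<Longrightarrow> w \<in> El (W (j a) b) \<Longrightarrow>
        cmp_el C (P b) (L (j a)) (P a) ([], t) (lin (r (j a) b) w) = lin (?T b) w"
      using Kan_colimit_point[OF C P j_ob[OF a] g[OF j_ob[OF a]] Po[OF a]] by blast
    then show ?thesis using Tj by (intro exI[of _ t]) auto
  qed
  then obtain \<epsilon> where \<epsilon>: "\<And>a. a \<in> VOb J \<Longrightarrow> \<epsilon> a \<in> Hom V \<I> (C (L (j a)) (P a))"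
    and \<epsilon>r: "\<And>a b f. \<lbrakk>a \<in> VOb J; b \<in> VOb J; f \<in> El (J b a)\<rbrakk> \<Longrightarrow>
      cmp_el C (P b) (L (j a)) (P a) ([], \<epsilon> a) (lin (r (j a) b) (lin (far j b a) f)) = lin (far P b a) f"
    by metis
  have \<eta>E [simp]: "([], \<eta> b) \<in> El (C (P b) (L (j b)))" if "b \<in> VOb J" for b
    unfolding \<eta> using that by simp
  have \<epsilon>E [simp]: "([], \<epsilon> b) \<in> El (C (L (j b)) (P b))" if "b \<in> VOb J" for b
    by (rule point_El[OF \<epsilon>[OF that]])
  show thesis
  proof (rule that)
    show "is_vnat J C P (L \<circ>\<^sub>V j) \<eta>"
    proof (rule vnat_pointI[OF J C P Lj])
      fix a b f assume [simp]: "a \<in> VOb J" "b \<in> VOb J" "f \<in> El (J a b)"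
      have "cmp_el C (P a) (L (j a)) (L (j b)) (lin (far L (j a) (j b)) (lin (far j a b) f)) ([], \<eta> a) =
        lin (r (j b) a) (lin (far j a b) f)"
        unfolding \<eta> by (simp add: Lr)
      then show "cmp_el C (P a) (P b) ((L \<circ>\<^sub>V j) b) ([], \<eta> b) (lin (far P a b) f) =
        cmp_el C (P a) ((L \<circ>\<^sub>V j) a) ((L \<circ>\<^sub>V j) b) (lin (far (L \<circ>\<^sub>V j) a b) f) ([], \<eta> a)"
        by (simp add: \<eta>r LjE)
    qed simp
    show "vinverse J C P (L \<circ>\<^sub>V j) \<eta> \<epsilon>"
      unfolding vinverse_def
    proof (intro ballI conjI)
      fix a assume a [simp]: "a \<in> VOb J"
      show "([], \<epsilon> a) \<in> El (C ((L \<circ>\<^sub>V j) a) (P a))" by simp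
      have g1: "one_el J a \<in> El (J a a)" by simp
      have "cmp_el C (P a) (L (j a)) (P a) ([], \<epsilon> a) ([], \<eta> a) = one_el C (P a)"
        using \<epsilon>r[OF a a g1] j P by (simp add: \<eta>)
      then show "cmp_el C (P a) ((L \<circ>\<^sub>V j) a) (P a) ([], \<epsilon> a) ([], \<eta> a) = one_el C (P a)" by simp
      have "cmp_el C (L (j a)) (P a) (L (j a)) ([], \<eta> a) ([], \<epsilon> a) = one_el C (L (j a))"
      proof (rule Kan_colimit_ext[OF C P j_ob g])
        fix b w assume [simp]: "b \<in> VOb J" "w \<in> El (W (j a) b)"
        note w = j_full[OF \<open>b \<in> VOb J\<close> a \<open>w \<in> El (W (j a) b)\<close>]
        have "cmp_el C (P b) (L (j a)) (L (j a)) (cmp_el C (L (j a)) (P a) (L (j a)) ([], \<eta> a) ([], \<epsilon> a)) (lin (r (j a) b) w)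
          = cmp_el C (P b) (P a) (L (j a)) ([], \<eta> a) (cmp_el C (P b) (L (j a)) (P a) ([], \<epsilon> a) (lin (r (j a) b) w))"
          by (simp add: cmp_el_assoc)
        also have "\<dots> = lin (r (j a) b) w"
          using \<epsilon>r[OF a \<open>b \<in> VOb J\<close> w(2)] \<eta>r[OF a \<open>b \<in> VOb J\<close> w(2)] w(3) by simp
        finally show "cmp_el C (P b) (L (j a)) (L (j a)) (cmp_el C (L (j a)) (P a) (L (j a)) ([], \<eta> a) ([], \<epsilon> a)) (lin (r (j a) b) w)
          = cmp_el C (P b) (L (j a)) (L (j a)) (one_el C (L (j a))) (lin (r (j a) b) w)"
          by simp
      qed simp_all
      then show "cmp_el C ((L \<circ>\<^sub>V j) a) (P a) ((L \<circ>\<^sub>V j) a) ([], \<eta> a) ([], \<epsilon> a) = one_el C ((L \<circ>\<^sub>V j) a)" by simp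
    qed
  qed
qed

end

section \<open>Ordinary categories of enriched functors\<close>

lemma HomI: "f \<in> Ar C \<Longrightarrow> Dom C f = x \<Longrightarrow> Cod C f = y \<Longrightarrow> f \<in> Hom C x y"
  by (simp add: Hom_def)

lemma (in ord_category) Hom_obs: "f \<in> Hom C x y \<Longrightarrow> x \<in> Ob C \<and> y \<in> Ob C"
  using dom_cod by (auto simp: Hom_def)

lemma iso_arr_iff:
  assumes "f \<in> Hom C x y"
  shows "iso_arr C f \<longleftrightarrow> (\<exists>g\<in>Hom C y x. Cmp C g f = Idn C x \<and> Cmp C f g = Idn C y)"
  using assms by (auto simp: iso_arr_def inverse_arrows_def Hom_def)

text \<open>The inverse is chosen on objects, and then full faithfulness determines it on arrows.\<close>

lemma equivalence_criterion:
  fixes C :: "('o, 'a, 'm) category_scheme" and D :: "('p, 'b, 'n) category_scheme"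
  assumes C: "ord_category C" and D: "ord_category D" and F: "is_ord_functor C D F"
    and ff: "\<And>x y. x \<in> Ob C \<Longrightarrow> y \<in> Ob C \<Longrightarrow> bij_betw (FAr F) (Hom C x y) (Hom D (FOb F x) (FOb F y))"
    and es: "\<And>d. d \<in> Ob D \<Longrightarrow> \<exists>c\<in>Ob C. \<exists>f\<in>Hom D (FOb F c) d. iso_arr D f"
  shows "is_equivalence C D F"
proof -
  interpret C: ord_category C by (rule C)
  interpret D: ord_category D by (rule D)
  have Fo: "FOb F x \<in> Ob D" if "x \<in> Ob C" for x using F that by (simp add: is_ord_functor_def)
  have Fa: "FAr F f \<in> Hom D (FOb F x) (FOb F y)" if "f \<in> Hom C x y" for f x y
    using F that C.Hom_obs[OF that] by (simp add: is_ord_functor_def)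
  have Fi: "FAr F (Idn C x) = Idn D (FOb F x)" if "x \<in> Ob C" for x using F that by (simp add: is_ord_functor_def)
  have Fc: "FAr F (Cmp C g f) = Cmp D (FAr F g) (FAr F f)" if "f \<in> Hom C x y" "g \<in> Hom C y z" for f g x y z
    using F that C.Hom_obs[OF that(1)] C.Hom_obs[OF that(2)] unfolding is_ord_functor_def by blast
  have Finj: "f = g" if "f \<in> Hom C x y" "g \<in> Hom C x y" "FAr F f = FAr F g" for f g x y
    using ff[of x y] C.Hom_obs[OF that(1)] that unfolding bij_betw_def inj_on_def by blast
  have Fsur: "\<exists>f\<in>Hom C x y. FAr F f = g" if "x \<in> Ob C" "y \<in> Ob C" "g \<in> Hom D (FOb F x) (FOb F y)" for x y g
  proof -
    have "g \<in> FAr F ` Hom C x y" using ff[OF that(1,2)] that(3) unfolding bij_betw_def by simp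
    then show ?thesis by blast
  qed
  have "\<forall>d\<in>Ob D. \<exists>c e e'. c \<in> Ob C \<and> e \<in> Hom D (FOb F c) d \<and> e' \<in> Hom D d (FOb F c) \<and>
    Cmp D e' e = Idn D (FOb F c) \<and> Cmp D e e' = Idn D d"
    using es iso_arr_iff by metis
  then obtain G e e' where G: "\<And>d. d \<in> Ob D \<Longrightarrow> G d \<in> Ob C"
    and e: "\<And>d. d \<in> Ob D \<Longrightarrow> e d \<in> Hom D (FOb F (G d)) d" "\<And>d. d \<in> Ob D \<Longrightarrow> e' d \<in> Hom D d (FOb F (G d))"
    "\<And>d. d \<in> Ob D \<Longrightarrow> Cmp D (e' d) (e d) = Idn D (FOb F (G d))" "\<And>d. d \<in> Ob D \<Longrightarrow> Cmp D (e d) (e' d) = Idn D d"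
    by metis
  have "\<exists>f\<in>Hom C (G x) (G y). FAr F f = Cmp D (e' y) (Cmp D g (e x))" if "g \<in> Hom D x y" for g x y
    using D.Hom_obs[OF that] that G e by (intro Fsur D.cmp) auto
  then have "\<forall>g\<in>Ar D. \<exists>f\<in>Hom C (G (Dom D g)) (G (Cod D g)). FAr F f = Cmp D (e' (Cod D g)) (Cmp D g (e (Dom D g)))"
    by (auto simp: HomI)
  then obtain Ga where Ga: "\<And>g. g \<in> Ar D \<Longrightarrow> Ga g \<in> Hom C (G (Dom D g)) (G (Cod D g))"
    "\<And>g. g \<in> Ar D \<Longrightarrow> FAr F (Ga g) = Cmp D (e' (Cod D g)) (Cmp D g (e (Dom D g)))" by metis
  have GaH: "Ga g \<in> Hom C (G x) (G y)" and FGa: "FAr F (Ga g) = Cmp D (e' y) (Cmp D g (e x))"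
    if "g \<in> Hom D x y" for g x y using Ga[of g] that by (auto simp: Hom_def)
  have eF: "Cmp D (e y) (FAr F (Ga g)) = Cmp D g (e x)" if g: "g \<in> Hom D x y" for g x y
  proof -
    note o = D.Hom_obs[OF g]
    have ge: "Cmp D g (e x) \<in> Hom D (FOb F (G x)) y" using e(1) o g D.cmp by blast
    have "Cmp D (e y) (FAr F (Ga g)) = Cmp D (Cmp D (e y) (e' y)) (Cmp D g (e x))"
      unfolding FGa[OF g] using D.cmp_assoc[OF ge e(2) e(1)] o by simp
    then show ?thesis using e(4) o D.idn_left[OF ge] by simp
  qed
  have emono: "f = g" if "f \<in> Hom D x (FOb F (G d))" "g \<in> Hom D x (FOb F (G d))" "Cmp D (e d) f = Cmp D (e d) g" "d \<in> Ob D" for f g x d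
  proof -
    have "Cmp D (e' d) (Cmp D (e d) f) = Cmp D (e' d) (Cmp D (e d) g)" using that by simp
    then show ?thesis using D.cmp_assoc[OF _ e(1,2)] e(3) D.idn_left that by metis
  qed
  define G' where "G' = \<lparr>FOb = G, FAr = Ga\<rparr>"
  have [simp]: "FOb G' = G" "FAr G' = Ga" by (simp_all add: G'_def)
  have "is_ord_functor D C G'"
    unfolding is_ord_functor_def
  proof (intro conjI ballI)
    fix x assume x: "x \<in> Ob D"
    note i = D.idn[OF x]
    show "FAr G' (Idn D x) = Idn C (FOb G' x)"
    proof (simp, rule Finj[OF GaH[OF i] C.idn[OF G[OF x]]], rule emono[OF _ _ _ x])
      show "FAr F (Ga (Idn D x)) \<in> Hom D (FOb F (G x)) (FOb F (G x))" by (rule Fa[OF GaH[OF i]])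
      show "FAr F (Idn C (G x)) \<in> Hom D (FOb F (G x)) (FOb F (G x))" by (rule Fa[OF C.idn[OF G[OF x]]])
      show "Cmp D (e x) (FAr F (Ga (Idn D x))) = Cmp D (e x) (FAr F (Idn C (G x)))"
        unfolding eF[OF i] Fi[OF G[OF x]] using D.idn_left[OF e(1)[OF x]] D.idn_right[OF e(1)[OF x]] by simp
    qed
  next
    fix x y z f g assume o: "x \<in> Ob D" "y \<in> Ob D" "z \<in> Ob D" and f: "f \<in> Hom D x y" and g: "g \<in> Hom D y z"
    note gf = D.cmp[OF f g]
    note Ggf = C.cmp[OF GaH[OF f] GaH[OF g]]
    show "FAr G' (Cmp D g f) = Cmp C (FAr G' g) (FAr G' f)"
    proof (simp, rule Finj[OF GaH[OF gf] Ggf], rule emono[OF Fa[OF GaH[OF gf]] Fa[OF Ggf] _ o(3)])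
      have "Cmp D (e z) (FAr F (Cmp C (Ga g) (Ga f))) = Cmp D (Cmp D (e z) (FAr F (Ga g))) (FAr F (Ga f))"
        unfolding Fc[OF GaH[OF f] GaH[OF g]] by (rule D.cmp_assoc[symmetric, OF Fa[OF GaH[OF f]] Fa[OF GaH[OF g]] e(1)[OF o(3)]])
      also have "\<dots> = Cmp D g (Cmp D (e y) (FAr F (Ga f)))"
        unfolding eF[OF g] by (rule D.cmp_assoc[OF Fa[OF GaH[OF f]] e(1)[OF o(2)] g])
      also have "\<dots> = Cmp D (Cmp D g f) (e x)"
        unfolding eF[OF f] by (rule D.cmp_assoc[symmetric, OF e(1)[OF o(1)] f g])
      finally show "Cmp D (e z) (FAr F (Ga (Cmp D g f))) = Cmp D (e z) (FAr F (Cmp C (Ga g) (Ga f)))"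
        unfolding eF[OF gf] by simp
    qed
  qed (use G GaH in auto)
  moreover have "iso_arr D (e d)" if "d \<in> Ob D" for d
    unfolding iso_arr_iff[OF e(1)[OF that]] using e(2-4)[OF that] by blast
  then have "is_natural_iso D D (ord_functor_comp F G') ord_functor_id e"
    unfolding is_natural_iso_def ord_functor_comp_def ord_functor_id_def
    using e(1) eF by simp
  moreover have "\<exists>s. is_natural_iso C C (ord_functor_comp G' F) ord_functor_id s"
  proof -
    have "\<forall>x\<in>Ob C. \<exists>s\<in>Hom C (G (FOb F x)) x. FAr F s = e (FOb F x)"
      using Fsur G Fo e(1) by blast
    then obtain s where s: "\<And>x. x \<in> Ob C \<Longrightarrow> s x \<in> Hom C (G (FOb F x)) x" "\<And>x. x \<in> Ob C \<Longrightarrow> FAr F (s x) = e (FOb F x)"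
      by metis
    have "\<forall>x\<in>Ob C. \<exists>s\<in>Hom C x (G (FOb F x)). FAr F s = e' (FOb F x)"
      using Fsur G Fo e(2) by blast
    then obtain s' where s': "\<And>x. x \<in> Ob C \<Longrightarrow> s' x \<in> Hom C x (G (FOb F x))" "\<And>x. x \<in> Ob C \<Longrightarrow> FAr F (s' x) = e' (FOb F x)"
      by metis
    have "iso_arr C (s x)" if x: "x \<in> Ob C" for x
      unfolding iso_arr_iff[OF s(1)[OF x]]
    proof (intro bexI[of _ "s' x"] conjI)
      show "Cmp C (s' x) (s x) = Idn C (G (FOb F x))"
        using x by (intro Finj[OF C.cmp[OF s(1) s'(1)] C.idn]) (auto simp: Fc[OF s(1) s'(1)] s s' e Fo G Fi)
      show "Cmp C (s x) (s' x) = Idn C x"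
        using x by (intro Finj[OF C.cmp[OF s'(1) s(1)] C.idn]) (auto simp: Fc[OF s'(1) s(1)] s s' e Fo G Fi)
    qed (use s' x in auto)
    moreover have "Cmp C (s y) (Ga (FAr F f)) = Cmp C f (s x)" if f: "f \<in> Hom C x y" for x y f
    proof (rule Finj)
      note o = C.Hom_obs[OF f]
      note G1 = GaH[OF Fa[OF f]]
      show "Cmp C (s y) (Ga (FAr F f)) \<in> Hom C (G (FOb F x)) y" using C.cmp[OF G1 s(1)] o by simp
      show "Cmp C f (s x) \<in> Hom C (G (FOb F x)) y" using C.cmp[OF s(1) f] o by simp
      show "FAr F (Cmp C (s y) (Ga (FAr F f))) = FAr F (Cmp C f (s x))"
        using Fc[OF G1 s(1)] Fc[OF s(1) f] o s(2) eF[OF Fa[OF f]] by simp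
    qed
    ultimately show ?thesis
      using s by (intro exI[of _ s]) (auto simp: is_natural_iso_def ord_functor_comp_def ord_functor_id_def)
  qed
  ultimately show ?thesis unfolding is_equivalence_def using F by blast
qed

lemma full_subcategory_simps [simp]:
  "Ob (full_subcategory C S) = Ob C \<inter> S" "Dom (full_subcategory C S) = Dom C" "Cod (full_subcategory C S) = Cod C"
  "Idn (full_subcategory C S) = Idn C" "Cmp (full_subcategory C S) = Cmp C"
  "Ar (full_subcategory C S) = {f \<in> Ar C. Dom C f \<in> S \<and> Cod C f \<in> S}"
  by (simp_all add: full_subcategory_def)

lemma full_subcategory_Hom:
  "f \<in> Hom (full_subcategory C S) x y \<longleftrightarrow> f \<in> Hom C x y \<and> x \<in> S \<and> y \<in> S"
  by (auto simp: Hom_def)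

lemma ord_category_full_subcategory:
  assumes "ord_category C" shows "ord_category (full_subcategory C S)"
proof -
  interpret ord_category C by (rule assms)
  show ?thesis
    by unfold_locales (auto simp: full_subcategory_Hom dom_cod idn cmp cmp_assoc idn_left idn_right)
qed

context smcc begin

lemma vrestrict_simps [simp]:
  "x \<in> VOb A \<Longrightarrow> (vrestrict A F) x = F x"
  "x \<in> VOb A \<Longrightarrow> y \<in> VOb A \<Longrightarrow> far (vrestrict A F) x y = far F x y"
  by (simp_all add: vrestrict_def)

lemma vrestrict_idem [simp]: "vrestrict A (vrestrict A F) = vrestrict A F"
  by (auto simp: vrestrict_def fun_eq_iff)

lemma is_vfunctor_vrestrict [simp]: "is_vfunctor A B (vrestrict A F) = is_vfunctor A B F"
  unfolding is_vfunctor_def by simp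

lemma is_vnat_cong:
  fixes F F' G G' :: "('x, 'y, 'a) vfunctor"
  assumes "\<And>x. x \<in> VOb A \<Longrightarrow> F x = F' x" "\<And>x y. x \<in> VOb A \<Longrightarrow> y \<in> VOb A \<Longrightarrow> far F x y = far F' x y"
    "\<And>x. x \<in> VOb A \<Longrightarrow> G x = G' x" "\<And>x y. x \<in> VOb A \<Longrightarrow> y \<in> VOb A \<Longrightarrow> far G x y = far G' x y"
    "\<And>x. x \<in> VOb A \<Longrightarrow> t x = t' x"
  shows "is_vnat A B F G t = is_vnat A B F' G' t'"
  unfolding is_vnat_def using assms by simp

lemma VCAT_Ob: "F \<in> Ob (VCAT A B) \<longleftrightarrow> is_vfunctor A B F \<and> vrestrict A F = F"
  by (simp add: VCAT_def Let_def)

lemma VCAT_Hom: "f \<in> Hom (VCAT A B) F G \<longleftrightarrow> (\<exists>t. f = (F, G, t) \<and> F \<in> Ob (VCAT A B) \<and> G \<in> Ob (VCAT A B) \<and>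
    is_vnat A B F G t \<and> t \<in> extensional (VOb A))"
  by (auto simp: VCAT_def Let_def Hom_def)

lemma VCAT_Idn: "Idn (VCAT A B) F = (F, F, restrict (\<lambda>x. VId B (F x)) (VOb A))"
  by (simp add: VCAT_def Let_def)

lemma VCAT_Cmp: "Cmp (VCAT A B) (G', H, s) (F, G, t) = (F, H, restrict (vcomp B F G' H s t) (VOb A))"
  by (auto simp: VCAT_def Let_def vcomp_def restrict_def fun_eq_iff)

lemma point_inject:
  assumes "([] :: 'o list, s) = ([], t)" shows "s = t"
  using assms by simp

lemma ord_category_VCAT:
  assumes A: "is_vcat A" and B: "is_vcat B"
  shows "ord_category (VCAT A B)"
proof
  show "f \<in> Ar (VCAT A B) \<Longrightarrow> Dom (VCAT A B) f \<in> Ob (VCAT A B) \<and> Cod (VCAT A B) f \<in> Ob (VCAT A B)" for f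
    by (auto simp: VCAT_def Let_def)
  have fc: "F x \<in> VOb B" if "F \<in> Ob (VCAT A B)" "x \<in> VOb A" for F x
    using that by (auto simp: VCAT_Ob)
  have E: "([], t x) \<in> El (B (F x) (G x))" if "F \<in> Ob (VCAT A B)" "G \<in> Ob (VCAT A B)" "is_vnat A B F G t" "x \<in> VOb A" for F G t x
    using that vnatD(2)[OF A B] by (auto simp: VCAT_Ob)
  fix F assume F: "F \<in> Ob (VCAT A B)"
  then show "Idn (VCAT A B) F \<in> Hom (VCAT A B) F F"
    using is_vnat_cong[of A F F F F "restrict (\<lambda>x. VId B (F x)) (VOb A)" "\<lambda>x. VId B (F x)" B] vnat_id[OF A B, of F]
    by (simp add: VCAT_Idn VCAT_Hom VCAT_Ob)
next
  fix f F G g H assume f: "f \<in> Hom (VCAT A B) F G" and g: "g \<in> Hom (VCAT A B) G H"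
  obtain t s where "f = (F, G, t)" "g = (G, H, s)" "is_vnat A B F G t" "is_vnat A B G H s" "F \<in> Ob (VCAT A B)" "G \<in> Ob (VCAT A B)" "H \<in> Ob (VCAT A B)"
    using f g by (auto simp: VCAT_Hom)
  then show "Cmp (VCAT A B) g f \<in> Hom (VCAT A B) F H"
    using is_vnat_cong[of A F F H H "restrict (vcomp B F G H s t) (VOb A)" "vcomp B F G H s t" B] vnat_comp[OF A B, of F G H t s]
    by (simp add: VCAT_Cmp VCAT_Hom VCAT_Ob)
next
  have fc: "F x \<in> VOb B" if "F \<in> Ob (VCAT A B)" "x \<in> VOb A" for F x
    using that by (auto simp: VCAT_Ob)
  have E: "([], t x) \<in> El (B (F x) (G x))" if "F \<in> Ob (VCAT A B)" "G \<in> Ob (VCAT A B)" "is_vnat A B F G t" "x \<in> VOb A" for F G t x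
    using that vnatD(2)[OF A B] by (auto simp: VCAT_Ob)
  fix f F G g H h K assume f: "f \<in> Hom (VCAT A B) F G" and g: "g \<in> Hom (VCAT A B) G H" and h: "h \<in> Hom (VCAT A B) H K"
  obtain t s r where *: "f = (F, G, t)" "g = (G, H, s)" "h = (H, K, r)"
    and n: "is_vnat A B F G t" "is_vnat A B G H s" "is_vnat A B H K r"
    and o: "F \<in> Ob (VCAT A B)" "G \<in> Ob (VCAT A B)" "H \<in> Ob (VCAT A B)" "K \<in> Ob (VCAT A B)"
    using f g h by (auto simp: VCAT_Hom)
  have "vcomp B F G K (restrict (vcomp B G H K r s) (VOb A)) t x = vcomp B F H K r (restrict (vcomp B F G H s t) (VOb A)) x" if x: "x \<in> VOb A" for x
  proof (rule point_inject)
    show "([] :: 'o list, vcomp B F G K (restrict (vcomp B G H K r s) (VOb A)) t x) = ([], vcomp B F H K r (restrict (vcomp B F G H s t) (VOb A)) x)"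
      unfolding vcomp_point using x
      by (simp add: vcomp_point cmp_el_assoc[OF B fc[OF o(1)] fc[OF o(2)] fc[OF o(3)] fc[OF o(4)] E[OF o(3,4) n(3)] E[OF o(2,3) n(2)] E[OF o(1,2) n(1)]])
  qed
  then show "Cmp (VCAT A B) (Cmp (VCAT A B) h g) f = Cmp (VCAT A B) h (Cmp (VCAT A B) g f)"
    unfolding * by (simp add: VCAT_Cmp restrict_def fun_eq_iff)
next
  fix f F G assume "f \<in> Hom (VCAT A B) F G"
  then obtain t where f: "f = (F, G, t)" and n: "is_vnat A B F G t" and e: "t \<in> extensional (VOb A)"
    and o: "is_vfunctor A B F" "is_vfunctor A B G" by (auto simp: VCAT_Hom VCAT_Ob)
  note E = vnatD(2)[OF A B o n]
  have "vcomp B F G G (restrict (\<lambda>x. VId B (G x)) (VOb A)) t x = t x"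
    "vcomp B F F G t (restrict (\<lambda>x. VId B (F x)) (VOb A)) x = t x" if x: "x \<in> VOb A" for x
    by (rule point_inject; unfold vcomp_point; use x E o B in \<open>simp add: one_el_def[symmetric]\<close>)+
  then show "Cmp (VCAT A B) (Idn (VCAT A B) G) f = f" "Cmp (VCAT A B) f (Idn (VCAT A B) F) = f"
    unfolding f using e by (auto simp: VCAT_Cmp VCAT_Idn intro!: extensionalityI[of _ "VOb A"])
qed

lemma VCAT_iso_iff:
  assumes A: "is_vcat A" and B: "is_vcat B" and t: "(F, G, t) \<in> Hom (VCAT A B) F G"
  shows "iso_arr (VCAT A B) (F, G, t) \<longleftrightarrow> (\<exists>s. vinverse A B F G t s)"
proof
  have n: "is_vnat A B F G t" and o: "is_vfunctor A B F" "is_vfunctor A B G" and ob: "F \<in> Ob (VCAT A B)" "G \<in> Ob (VCAT A B)"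
    using t by (auto simp: VCAT_Hom VCAT_Ob)
  { assume "iso_arr (VCAT A B) (F, G, t)"
    then obtain s where s: "is_vnat A B G F s" "Cmp (VCAT A B) (G, F, s) (F, G, t) = Idn (VCAT A B) F"
       "Cmp (VCAT A B) (F, G, t) (G, F, s) = Idn (VCAT A B) G"
      unfolding iso_arr_iff[OF t] by (auto simp: VCAT_Hom)
    have "vcomp B F G F s t x = VId B (F x)" "vcomp B G F G t s x = VId B (G x)" if "x \<in> VOb A" for x
      using s(2,3) that by (auto simp: VCAT_Cmp VCAT_Idn dest!: fun_cong[where x = x])
    then have "vinverse A B F G t s"
      unfolding vinverse_def using vnatD(2)[OF A B o(2,1) s(1)] by (auto simp: vcomp_point[symmetric] one_el_def)
    then show "\<exists>s. vinverse A B F G t s" by blast }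
  { assume "\<exists>s. vinverse A B F G t s"
    then obtain s where s: "vinverse A B F G t s" ..
    have c: "vcomp B F G F s t x = VId B (F x)" "vcomp B G F G t s x = VId B (G x)" if "x \<in> VOb A" for x
      using s that vcomp_point[of B F G F s t x] vcomp_point[of B G F G t s x] unfolding vinverse_def one_el_def by auto
    let ?s = "restrict s (VOb A)"
    have "is_vnat A B G F ?s"
      using inverse_nat[OF A B o n s] is_vnat_cong[of A G G F F ?s s B] by simp
    then have "(G, F, ?s) \<in> Hom (VCAT A B) G F" using ob by (simp add: VCAT_Hom)
    moreover have "Cmp (VCAT A B) (G, F, ?s) (F, G, t) = Idn (VCAT A B) F"
       "Cmp (VCAT A B) (F, G, t) (G, F, ?s) = Idn (VCAT A B) G"
      using c by (auto simp: VCAT_Cmp VCAT_Idn vcomp_def restrict_def)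
    ultimately show "iso_arr (VCAT A B) (F, G, t)" unfolding iso_arr_iff[OF t] by blast }
qed

end

context arity_system begin

lemma Kan_colimit_diagram_cong:
  fixes D D' :: "('x, 'y, 'a) vfunctor"
  assumes "\<And>b. b \<in> VOb J \<Longrightarrow> D b = D' b" "\<And>a b. a \<in> VOb J \<Longrightarrow> b \<in> VOb J \<Longrightarrow> far D a b = far D' a b"
    and "\<And>b. b \<in> VOb J \<Longrightarrow> r b = r' b"
  shows "Kan_colimit v C D c r = Kan_colimit v C D' c r'"
proof -
  have "cone v C D c r = cone v C D' c r'" using assms unfolding cone_def by simp
  moreover have "indexed_cone v C D x k T = indexed_cone v C D' x k T" for x k T
    using assms unfolding indexed_cone_def by simp
  ultimately show ?thesis using assms unfolding Kan_colimit_def by simp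
qed

lemma Kan_preserving_vrestrict: "Kan_preserving C E (vrestrict C F) = Kan_preserving C E F"
proof -
  have "Kan_colimit v E (vrestrict C F \<circ>\<^sub>V D) ((vrestrict C F) c) (\<lambda>b. far (vrestrict C F) (D b) c \<cdot> r b) =
    Kan_colimit v E (F \<circ>\<^sub>V D) (F c) (\<lambda>b. far F (D b) c \<cdot> r b)"
    if D: "is_vfunctor J C D" and g: "Kan_colimit v C D c r" for v D c r
  proof -
    have D': "D b \<in> VOb C" if "b \<in> VOb J" for b using D that by simp
    have c: "c \<in> VOb C" using Kan_colimitD(1)[OF g] .
    show ?thesis unfolding vrestrict_simps(1)[OF c]
      by (rule Kan_colimit_diagram_cong) (use D' c in simp_all)
  qed
  then show ?thesis unfolding Kan_preserving_def by blast
qed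

lemma eleutheric_iff:
  "eleutheric J j \<longleftrightarrow> has_colimits (Kan_weights J j) \<V> \<and> (\<forall>a\<in>VOb J. Kan_preserving \<V> \<V> (covariant_hom \<V> (j a)))"
proof -
  have "(\<forall>(B, W)\<in>Kan_weights J j. flat J j B W) \<longleftrightarrow>
    (\<forall>a\<in>VOb J. cocontinuous (Kan_weights J j) \<V> \<V> (covariant_hom \<V> (j a)))"
    unfolding flat_def cocontinuous_def by blast
  also have "\<dots> \<longleftrightarrow> (\<forall>a\<in>VOb J. Kan_preserving \<V> \<V> (covariant_hom \<V> (j a)))"
    by (intro ball_cong refl cocontinuous_iff vfunctor_covariant) simp_all
  finally show ?thesis unfolding eleutheric_def by simp
qed

lemma Cocts_Ob: "is_vcat C \<Longrightarrow> F \<in> Ob (Cocts (Kan_weights J j) \<V> C) \<longleftrightarrow>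
    is_vfunctor \<V> C F \<and> vrestrict \<V> F = F \<and> Kan_preserving \<V> C F"
  unfolding Cocts_def using cocontinuous_iff[of \<V> C F] by (auto simp: VCAT_Ob)

lemma Cocts_Hom: "is_vcat C \<Longrightarrow> f \<in> Hom (Cocts (Kan_weights J j) \<V> C) F G \<longleftrightarrow>
    F \<in> Ob (Cocts (Kan_weights J j) \<V> C) \<and> G \<in> Ob (Cocts (Kan_weights J j) \<V> C) \<and>
    (\<exists>t. f = (F, G, t) \<and> is_vnat \<V> C F G t \<and> t \<in> extensional (Ob V))"
  unfolding Cocts_def full_subcategory_Hom VCAT_Hom by auto

lemma FOb_precomposition [simp]: "FOb (precomposition J j) G = vrestrict J (G \<circ>\<^sub>V j)"
  by (simp add: precomposition_def)

lemma FAr_precomposition [simp]: "FAr (precomposition J j) (G, H, t) =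
    (vrestrict J (G \<circ>\<^sub>V j), vrestrict J (H \<circ>\<^sub>V j), restrict (\<lambda>x. t (j x)) (VOb J))"
  by (simp add: precomposition_def)

lemma vnat_restrict_j:
  assumes C: "is_vcat C" and F: "is_vfunctor \<V> C F" and G: "is_vfunctor \<V> C G" and t: "is_vnat \<V> C F G t"
  shows "is_vnat J C (F \<circ>\<^sub>V j) (G \<circ>\<^sub>V j) (\<lambda>b. t (j b))"
proof (rule vnat_pointI[OF J C vfunctor_comp[OF J is_vcat_self C j F] vfunctor_comp[OF J is_vcat_self C j G]])
  note t' = vnatD[OF is_vcat_self C F G t]
  show "x \<in> VOb J \<Longrightarrow> ([], t (j x)) \<in> El (C ((F \<circ>\<^sub>V j) x) ((G \<circ>\<^sub>V j) x))" for x
    using t'(2)[of "j x"] by simp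
  fix x y f assume x: "x \<in> VOb J" "y \<in> VOb J" "f \<in> El (J x y)"
  then show "cmp_el C ((F \<circ>\<^sub>V j) x) ((F \<circ>\<^sub>V j) y) ((G \<circ>\<^sub>V j) y) ([], t (j y)) (lin (far (F \<circ>\<^sub>V j) x y) f) =
    cmp_el C ((F \<circ>\<^sub>V j) x) ((G \<circ>\<^sub>V j) x) ((G \<circ>\<^sub>V j) y) (lin (far (G \<circ>\<^sub>V j) x y) f) ([], t (j x))"
    using t'(3)[of "j x" "j y" "lin (far j x y) f"] lin_comp[OF j F x] lin_comp[OF j G x] by simp
qed

lemma is_vnat_vrestrict: "is_vnat J C (vrestrict J F) (vrestrict J G) t = is_vnat J C F G t"
  by (rule is_vnat_cong) simp_all

lemma vinverse_vrestrict: "vinverse J C (vrestrict J F) (vrestrict J G) t s = vinverse J C F G t s"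
  unfolding vinverse_def by simp

lemma precomposition_functor:
  assumes C: "is_vcat C"
  shows "is_ord_functor (Cocts (Kan_weights J j) \<V> C) (VCAT J C) (precomposition J j)"
proof -
  have ob: "vrestrict J (F \<circ>\<^sub>V j) \<in> Ob (VCAT J C)" if "is_vfunctor \<V> C F" for F
    using vfunctor_comp[OF J is_vcat_self C j that] by (simp add: VCAT_Ob)
  have c: "Cmp (Cocts (Kan_weights J j) \<V> C) = Cmp (VCAT \<V> C)" "Idn (Cocts (Kan_weights J j) \<V> C) = Idn (VCAT \<V> C)"
    by (simp_all add: Cocts_def)
  show ?thesis
    unfolding is_ord_functor_def
  proof (intro conjI ballI)
    show "F \<in> Ob (Cocts (Kan_weights J j) \<V> C) \<Longrightarrow> FOb (precomposition J j) F \<in> Ob (VCAT J C)" for F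
      using ob by (simp add: Cocts_Ob[OF C])
    show "FAr (precomposition J j) f \<in> Hom (VCAT J C) (FOb (precomposition J j) F) (FOb (precomposition J j) G)"
      if fH: "f \<in> Hom (Cocts (Kan_weights J j) \<V> C) F G" for f F G
    proof -
      obtain t where f: "f = (F, G, t)" and t: "is_vnat \<V> C F G t" and FG: "is_vfunctor \<V> C F" "is_vfunctor \<V> C G"
        using fH by (auto simp: Cocts_Hom[OF C] Cocts_Ob[OF C])
      have "is_vnat J C (vrestrict J (F \<circ>\<^sub>V j)) (vrestrict J (G \<circ>\<^sub>V j)) (restrict (\<lambda>x. t (j x)) (VOb J)) =
        is_vnat J C (F \<circ>\<^sub>V j) (G \<circ>\<^sub>V j) (\<lambda>x. t (j x))"
        by (rule is_vnat_cong) simp_all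
      then show ?thesis using ob FG vnat_restrict_j[OF C FG t] by (simp add: f VCAT_Hom)
    qed
    show "FAr (precomposition J j) (Idn (Cocts (Kan_weights J j) \<V> C) F) = Idn (VCAT J C) (FOb (precomposition J j) F)" for F
      by (auto simp: c VCAT_Idn)
    fix F G H f g assume "f \<in> Hom (Cocts (Kan_weights J j) \<V> C) F G" "g \<in> Hom (Cocts (Kan_weights J j) \<V> C) G H"
    then obtain t s where f: "f = (F, G, t)" "g = (G, H, s)" by (auto simp: Cocts_Hom[OF C])
    show "FAr (precomposition J j) (Cmp (Cocts (Kan_weights J j) \<V> C) g f) =
      Cmp (VCAT J C) (FAr (precomposition J j) g) (FAr (precomposition J j) f)"
      unfolding c f by (auto simp: VCAT_Cmp vcomp_def)
  qed
qed

text \<open>Full faithfulness is \<open>restriction_full\<close> and \<open>restriction_faithful\<close>, and essential surjectivity is the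
  existence of cocontinuous Kan extensions.\<close>

lemma free_if_eleutheric:
  assumes e: "eleutheric J j" and C: "is_vcat C" and cc: "has_colimits (Kan_weights J j) C"
  shows "is_equivalence (Cocts (Kan_weights J j) \<V> C) (VCAT J C) (precomposition J j)"
proof (rule equivalence_criterion)
  let ?C = "Cocts (Kan_weights J j) \<V> C"
  show "ord_category ?C" unfolding Cocts_def
    by (intro ord_category_full_subcategory ord_category_VCAT is_vcat_self C)
  show "ord_category (VCAT J C)" by (intro ord_category_VCAT J C)
  show "is_ord_functor ?C (VCAT J C) (precomposition J j)" by (rule precomposition_functor[OF C])
  show "bij_betw (FAr (precomposition J j)) (Hom ?C F G) (Hom (VCAT J C) (FOb (precomposition J j) F) (FOb (precomposition J j) G))"
    if FG: "F \<in> Ob ?C" "G \<in> Ob ?C" for F G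
    unfolding bij_betw_def
  proof
    have F: "is_vfunctor \<V> C F" and G: "is_vfunctor \<V> C G" and d: "dense_cocontinuous C F"
      using FG Kan_preserving_dense[OF C] by (auto simp: Cocts_Ob[OF C])
    show "inj_on (FAr (precomposition J j)) (Hom ?C F G)"
    proof (rule inj_onI)
      fix f g assume "f \<in> Hom ?C F G" "g \<in> Hom ?C F G" and e: "FAr (precomposition J j) f = FAr (precomposition J j) g"
      then obtain t s where f: "f = (F, G, t)" "g = (F, G, s)" and t: "is_vnat \<V> C F G t" "is_vnat \<V> C F G s"
        and x: "t \<in> extensional (Ob V)" "s \<in> extensional (Ob V)" by (auto simp: Cocts_Hom[OF C])
      have "t (j b) = s (j b)" if "b \<in> VOb J" for b
        using e that by (auto simp: f dest!: fun_cong[where x = b])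
      then have "t v = s v" if "v \<in> Ob V" for v using restriction_faithful[OF C F G d t] that by blast
      then show "f = g" using f x by (auto intro: extensionalityI)
    qed
    have "g \<in> FAr (precomposition J j) ` Hom ?C F G" if gH: "g \<in> Hom (VCAT J C) (vrestrict J (F \<circ>\<^sub>V j)) (vrestrict J (G \<circ>\<^sub>V j))" for g
    proof -
      obtain \<tau> where g: "g = (vrestrict J (F \<circ>\<^sub>V j), vrestrict J (G \<circ>\<^sub>V j), \<tau>)"
        and \<tau>: "is_vnat J C (F \<circ>\<^sub>V j) (G \<circ>\<^sub>V j) \<tau>" "\<tau> \<in> extensional (VOb J)"
        using gH by (auto simp: VCAT_Hom is_vnat_vrestrict)
      obtain t where t: "is_vnat \<V> C F G t" "\<And>b. b \<in> VOb J \<Longrightarrow> t (j b) = \<tau> b"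
        using restriction_full[OF C F G d \<tau>(1)] by blast
      have "is_vnat \<V> C F G (restrict t (Ob V))"
        using t(1) is_vnat_cong[of \<V> F F G G "restrict t (Ob V)" t C] by simp
      then have "(F, G, restrict t (Ob V)) \<in> Hom ?C F G" using FG by (simp add: Cocts_Hom[OF C])
      moreover have "FAr (precomposition J j) (F, G, restrict t (Ob V)) = g"
        using t(2) \<tau>(2) by (auto simp: g restrict_def extensional_def)
      ultimately show ?thesis by force
    qed
    moreover have "FAr (precomposition J j) f \<in> Hom (VCAT J C) (vrestrict J (F \<circ>\<^sub>V j)) (vrestrict J (G \<circ>\<^sub>V j))"
      if "f \<in> Hom ?C F G" for f
      using precomposition_functor[OF C] FG that unfolding is_ord_functor_def by auto
    ultimately show "FAr (precomposition J j) ` Hom ?C F G = Hom (VCAT J C) (FOb (precomposition J j) F) (FOb (precomposition J j) G)"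
      by auto
  qed
  fix P assume "P \<in> Ob (VCAT J C)"
  then have P: "is_vfunctor J C P" and PO: "P \<in> Ob (VCAT J C)" and Pr: "vrestrict J P = P" by (auto simp: VCAT_Ob)
  have cc': "\<exists>c r. Kan_colimit v C P c r" if "v \<in> Ob V" for v
    using cc P that unfolding has_colimits_iff[OF C] by blast
  obtain L r where L: "is_vfunctor \<V> C L" and Lg: "\<And>v. v \<in> Ob V \<Longrightarrow> Kan_colimit v C P (L v) (r v)"
    and Lr: "\<And>v v' b f w. \<lbrakk>v \<in> Ob V; v' \<in> Ob V; b \<in> VOb J; f \<in> El (IHom V v v'); w \<in> El (W v b)\<rbrakk> \<Longrightarrow>
      cmp_el C (P b) (L v) (L v') (lin (far L v v') f) (lin (r v b) w) =
      lin (r v' b) (cmp_el \<V> (j b) v v' f w)"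
    using Lan_functor[OF C P cc'] by blast
  have pres: "Kan_preserving \<V> C L"
    by (rule Lan_preserving[OF C P L Lg Lr]) (use e in \<open>auto simp: eleutheric_iff\<close>)
  obtain \<eta> \<epsilon> where \<eta>: "is_vnat J C P (L \<circ>\<^sub>V j) \<eta>" "vinverse J C P (L \<circ>\<^sub>V j) \<eta> \<epsilon>"
    using Lan_unit[OF C P L Lg Lr] by blast
  let ?L = "vrestrict \<V> L"
  have LO: "?L \<in> Ob ?C" using L pres by (simp add: Cocts_Ob[OF C] Kan_preserving_vrestrict)
  have Lj: "is_vfunctor J C (L \<circ>\<^sub>V j)" by (rule vfunctor_comp[OF J is_vcat_self C j L])
  have eq: "vrestrict J (?L \<circ>\<^sub>V j) = vrestrict J (L \<circ>\<^sub>V j)"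
    by (auto simp: vrestrict_def fun_eq_iff restrict_def)
  let ?\<epsilon> = "restrict \<epsilon> (VOb J)"
  have inv: "vinverse J C (L \<circ>\<^sub>V j) P \<epsilon> \<eta>"
    using \<eta> vnatD(2)[OF J C P Lj \<eta>(1)] unfolding vinverse_def by auto
  have "is_vnat J C (L \<circ>\<^sub>V j) P \<epsilon>" by (rule inverse_nat[OF J C P Lj \<eta>])
  moreover have "is_vnat J C (vrestrict J (L \<circ>\<^sub>V j)) P ?\<epsilon> = is_vnat J C (L \<circ>\<^sub>V j) P \<epsilon>"
    by (rule is_vnat_cong) simp_all
  ultimately have H: "(vrestrict J (L \<circ>\<^sub>V j), P, ?\<epsilon>) \<in> Hom (VCAT J C) (vrestrict J (L \<circ>\<^sub>V j)) P"
    using Lj PO by (simp add: VCAT_Hom VCAT_Ob)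
  have "vinverse J C (vrestrict J (L \<circ>\<^sub>V j)) P ?\<epsilon> \<eta>"
    using inv unfolding vinverse_def by simp
  then have "iso_arr (VCAT J C) (vrestrict J (L \<circ>\<^sub>V j), P, ?\<epsilon>)"
    using VCAT_iso_iff[OF J C H] by blast
  then show "\<exists>F\<in>Ob ?C. \<exists>f\<in>Hom (VCAT J C) (FOb (precomposition J j) F) P. iso_arr (VCAT J C) f"
    using LO H eq by (intro bexI[of _ ?L] bexI[of _ "(vrestrict J (L \<circ>\<^sub>V j), P, ?\<epsilon>)"]) simp_all
qed

section \<open>Flatness from the universal property\<close>

text \<open>Cocones and factorizations are transported along \<open>t\<close> and \<open>s\<close>.\<close>

lemma Kan_preserving_iso:
  assumes A: "is_vcat A" and C: "is_vcat C" and F: "is_vfunctor A C F" and G: "is_vfunctor A C G"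
    and t: "is_vnat A C F G t" and s: "vinverse A C F G t s" and p: "Kan_preserving A C F"
  shows "Kan_preserving A C G"
  unfolding Kan_preserving_def
proof (intro ballI allI impI)
  fix v D c r assume v [simp]: "v \<in> Ob V" and D: "is_vfunctor J A D" and g: "Kan_colimit v A D c r"
  have gF: "Kan_colimit v C (F \<circ>\<^sub>V D) (F c) (\<lambda>b. far F (D b) c \<cdot> r b)"
    using p v D g unfolding Kan_preserving_def by blast
  note FD = vfunctor_comp[OF J A C D F] and GD = vfunctor_comp[OF J A C D G]
  note rc = Kan_colimitD(2)[OF g]
  note [simp] = A C
  have c [simp]: "c \<in> VOb A" using Kan_colimitD(1)[OF g] .
  note [simp] = vfunctor_simps[OF D] vfunctor_simps[OF F] vfunctor_simps[OF G] coneD(3)[OF rc]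
  note Do = vfunctor_ob[OF D] and Go = vfunctor_ob[OF G]
  have tE [simp]: "([], t x) \<in> El (C (F x) (G x))" if "x \<in> VOb A" for x
    using vnatD(2)[OF A C F G t that] .
  have sE [simp]: "([], s x) \<in> El (C (G x) (F x))" if "x \<in> VOb A" for x
    using s that by (simp add: vinverse_def)
  have st [simp]: "cmp_el C (F x) (G x) (F x) ([], s x) ([], t x) = one_el C (F x)"
    and ts [simp]: "cmp_el C (G x) (F x) (G x) ([], t x) ([], s x) = one_el C (G x)" if "x \<in> VOb A" for x
    using s that by (auto simp: vinverse_def)
  note tn = vnatD(3)[OF A C F G t] and sn = vnatD(3)[OF A C G F inverse_nat[OF A C F G t s]]
  have Fr: "lin (far F (D b) c \<cdot> r b) w = lin (far F (D b) c) (lin (r b) w)"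
    and Gr: "lin (far G (D b) c \<cdot> r b) w = lin (far G (D b) c) (lin (r b) w)" if "b \<in> VOb J" "w \<in> El (W v b)" for b w
    using lin_lin[OF coneD(1)[OF rc that(1)] vfunctor_far[OF F] that(2)] lin_lin[OF coneD(1)[OF rc that(1)] vfunctor_far[OF G] that(2)] that by simp_all
  note FDE = lin_comp[OF D F] and GDE = lin_comp[OF D G]
  show "Kan_colimit v C (G \<circ>\<^sub>V D) (G c) (\<lambda>b. far G (D b) c \<cdot> r b)"
  proof (rule Kan_colimitI[OF C GD v Go[OF c]])
    show "cone v C (G \<circ>\<^sub>V D) (G c) (\<lambda>b. far G (D b) c \<cdot> r b)"
      unfolding cone_def
    proof (intro conjI ballI)
      fix b assume b: "b \<in> VOb J"
      show "far G (D b) c \<cdot> r b \<in> Hom V (W v b) (C ((G \<circ>\<^sub>V D) b) (G c))"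
        using coneD(1)[OF rc b] vfunctor_far[OF G, of "D b" c] b by (simp add: in_Hom)
    next
      fix a b w f assume [simp]: "a \<in> VOb J" "b \<in> VOb J" "w \<in> El (W v b)" "f \<in> El (J a b)"
      show "lin (far G (D a) c \<cdot> r a) (act a b v w f) =
        cmp_el C ((G \<circ>\<^sub>V D) a) ((G \<circ>\<^sub>V D) b) (G c) (lin (far G (D b) c \<cdot> r b) w) (lin (far (G \<circ>\<^sub>V D) a b) f)"
        using vfunctor_cmp_el[OF A C G, of "D a" "D b" c "lin (r b) w" "lin (far D a b) f"]
        by (simp add: Gr GDE coneD(2)[OF rc])
    qed
  next
    fix x k T assume x [simp]: "x \<in> VOb C" and k [simp]: "k \<in> Ob V" and T: "indexed_cone v C (G \<circ>\<^sub>V D) x k T"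
    note [simp] = indexed_coneD(3)[OF T, simplified]
    let ?T = "\<lambda>b. at_point (VCmp C (F (D b)) (G (D b)) x) (C (G (D b)) x) (t (D b)) \<cdot> T b"
    have T': "?T b \<in> Hom V (k \<otimes> W v b) (C (F (D b)) x)"
      "\<And>\<kappa> w. \<kappa> \<in> El k \<Longrightarrow> w \<in> El (W v b) \<Longrightarrow> bil (?T b) \<kappa> w = cmp_el C (F (D b)) (G (D b)) x (bil (T b) \<kappa> w) ([], t (D b))"
      if b [simp]: "b \<in> VOb J" for b
    proof -
      have "VCmp C (F (D b)) (G (D b)) x \<in> Hom V (C (G (D b)) x \<otimes> C (F (D b)) (G (D b))) (C (F (D b)) x)"
        by (rule vcat_cmp) simp_all
      note p = at_point_lin[OF this vnatD(1)[OF A C F G t Do[OF b]]]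
      have Tb: "T b \<in> Hom V (k \<otimes> W v b) (C (G (D b)) x)" using indexed_coneD(1)[OF T b] by simp
      show "?T b \<in> Hom V (k \<otimes> W v b) (C (F (D b)) x)"
        by (rule cmp[OF Tb p(1)]) simp_all
      show "bil (?T b) \<kappa> w = cmp_el C (F (D b)) (G (D b)) x (bil (T b) \<kappa> w) ([], t (D b))"
        if "\<kappa> \<in> El k" "w \<in> El (W v b)" for \<kappa> w
        using p lin_bil[OF Tb p(1) that] bil_El[OF Tb that] unfolding cmp_el_def by simp
    qed
    have K: "indexed_cone v C (F \<circ>\<^sub>V D) x k ?T"
      unfolding indexed_cone_def
    proof (intro conjI ballI)
      fix a b \<kappa> w f assume [simp]: "a \<in> VOb J" "b \<in> VOb J" "\<kappa> \<in> El k" "w \<in> El (W v b)" "f \<in> El (J a b)"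
      have "bil (?T a) \<kappa> (act a b v w f) = cmp_el C (F (D a)) (G (D b)) x (bil (T b) \<kappa> w)
        (cmp_el C (F (D a)) (G (D a)) (G (D b)) (lin (far G (D a) (D b)) (lin (far D a b) f)) ([], t (D a)))"
        using indexed_coneD(2)[OF T] by (simp add: T'(2) GDE cmp_el_assoc)
      also have "\<dots> = cmp_el C (F (D a)) (F (D b)) x (bil (?T b) \<kappa> w) (lin (far F (D a) (D b)) (lin (far D a b) f))"
        by (simp add: tn[symmetric] T'(2) cmp_el_assoc)
      finally show "bil (?T a) \<kappa> (act a b v w f) =
        cmp_el C ((F \<circ>\<^sub>V D) a) ((F \<circ>\<^sub>V D) b) x (bil (?T b) \<kappa> w) (lin (far (F \<circ>\<^sub>V D) a b) f)"
        by (simp add: FDE)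
    qed (use T'(1) in simp)
    obtain h where h: "h \<in> Hom V k (C (F c) x)"
      "\<And>b \<kappa> w. b \<in> VOb J \<Longrightarrow> \<kappa> \<in> El k \<Longrightarrow> w \<in> El (W v b) \<Longrightarrow>
        cmp_el C ((F \<circ>\<^sub>V D) b) (F c) x (lin h \<kappa>) (lin (far F (D b) c \<cdot> r b) w) = bil (?T b) \<kappa> w"
      using Kan_colimit_factor[OF C FD v gF x k K] by blast
    have hE [simp]: "lin h \<kappa> \<in> El (C (F c) x)" if "\<kappa> \<in> El k" for \<kappa> by (rule lin_El[OF h(1) that])
    have m: "VCmp C (G c) (F c) x \<in> Hom V (C (F c) x \<otimes> C (G c) (F c)) (C (G c) x)"
      by (rule vcat_cmp) simp_all
    have sc: "s c \<in> Hom V \<I> (C (G c) (F c))" using sE[OF c] by (simp add: El_iff in_Hom)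
    let ?q = "at_point (VCmp C (G c) (F c) x) (C (F c) x) (s c)"
    note q = at_point_lin[OF m sc vcat_ob[OF C vfunctor_ob[OF F c] x]]
    note h' = cmp[OF h(1) q(1)]
    have lh': "lin (?q \<cdot> h) \<kappa> = cmp_el C (G c) (F c) x (lin h \<kappa>) ([], s c)" if "\<kappa> \<in> El k" for \<kappa>
      using lin_lin[OF h(1) q(1) that] q(2)[OF lin_El[OF h(1) that]] unfolding cmp_el_def by simp
    show "\<exists>h\<in>Hom V k (C (G c) x). \<forall>b\<in>VOb J. \<forall>\<kappa>\<in>El k. \<forall>w\<in>El (W v b).
      cmp_el C ((G \<circ>\<^sub>V D) b) (G c) x (lin h \<kappa>) (lin (far G (D b) c \<cdot> r b) w) = bil (T b) \<kappa> w"
    proof (intro bexI[OF _ h'] ballI)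
      fix b \<kappa> w assume [simp]: "b \<in> VOb J" "\<kappa> \<in> El k" "w \<in> El (W v b)"
      have "cmp_el C (G (D b)) (G c) x (lin (?q \<cdot> h) \<kappa>) (lin (far G (D b) c) (lin (r b) w)) =
        cmp_el C (G (D b)) (F c) x (lin h \<kappa>) (cmp_el C (G (D b)) (F (D b)) (F c) (lin (far F (D b) c) (lin (r b) w)) ([], s (D b)))"
        by (simp add: lh' cmp_el_assoc sn)
      also have "\<dots> = cmp_el C (G (D b)) (F (D b)) x (bil (?T b) \<kappa> w) ([], s (D b))"
        using h(2)[of b \<kappa> w] by (simp add: cmp_el_assoc[symmetric] Fr)
      also have "\<dots> = bil (T b) \<kappa> w" by (simp add: T'(2) cmp_el_assoc)
      finally show "cmp_el C ((G \<circ>\<^sub>V D) b) (G c) x (lin (?q \<cdot> h) \<kappa>) (lin (far G (D b) c \<cdot> r b) w) = bil (T b) \<kappa> w"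
        by (simp add: Gr)
    qed
  next
    fix x h h' assume x [simp]: "x \<in> VOb C" and h [simp]: "h \<in> El (C (G c) x)" "h' \<in> El (C (G c) x)"
      and f: "fst h = fst h'"
      and e: "\<And>b w. b \<in> VOb J \<Longrightarrow> w \<in> El (W v b) \<Longrightarrow>
        cmp_el C ((G \<circ>\<^sub>V D) b) (G c) x h (lin (far G (D b) c \<cdot> r b) w) =
        cmp_el C ((G \<circ>\<^sub>V D) b) (G c) x h' (lin (far G (D b) c \<cdot> r b) w)"
    have "cmp_el C (F c) (G c) x h ([], t c) = cmp_el C (F c) (G c) x h' ([], t c)"
    proof (rule Kan_colimit_ext[OF C FD v gF x])
      fix b w assume [simp]: "b \<in> VOb J" "w \<in> El (W v b)"
      have "cmp_el C (F (D b)) (F c) x (cmp_el C (F c) (G c) x h ([], t c)) (lin (far F (D b) c) (lin (r b) w)) =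
        cmp_el C (F (D b)) (G (D b)) x (cmp_el C (G (D b)) (G c) x h (lin (far G (D b) c) (lin (r b) w))) ([], t (D b))"
        if [simp]: "h \<in> El (C (G c) x)" for h by (simp add: cmp_el_assoc tn)
      then show "cmp_el C ((F \<circ>\<^sub>V D) b) (F c) x (cmp_el C (F c) (G c) x h ([], t c)) (lin (far F (D b) c \<cdot> r b) w) =
        cmp_el C ((F \<circ>\<^sub>V D) b) (F c) x (cmp_el C (F c) (G c) x h' ([], t c)) (lin (far F (D b) c \<cdot> r b) w)"
        using e[of b w] by (simp add: Fr Gr)
    qed (use f in simp_all)
    then have "cmp_el C (G c) (F c) x (cmp_el C (F c) (G c) x h ([], t c)) ([], s c) =
       cmp_el C (G c) (F c) x (cmp_el C (F c) (G c) x h' ([], t c)) ([], s c)" by simp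
    then show "h = h'" by (simp add: cmp_el_assoc)
  qed
qed

text \<open>As \<open>F\<close> is the Kan extension of its restriction, \<open>\<tau>\<close> extends to \<open>t : F \<rightarrow> V(ja,-)\<close>. The comparison \<open>s\<close> in
  the other direction comes from the Yoneda lemma, which also gives \<open>t s = 1\<close>. On \<open>J\<close> this makes
  \<open>s\<close> the inverse of \<open>\<tau>\<close>, so that \<open>s t = 1\<close> there, and hence everywhere by \<open>restriction_faithful\<close>.\<close>

lemma flat_if_extends:
  assumes a [simp]: "a \<in> VOb J" and F: "is_vfunctor \<V> \<V> F" and p: "Kan_preserving \<V> \<V> F"
    and \<tau>: "is_vnat J \<V> (F \<circ>\<^sub>V j) (covariant_hom \<V> (j a) \<circ>\<^sub>V j) \<tau>"
    and \<sigma>: "vinverse J \<V> (F \<circ>\<^sub>V j) (covariant_hom \<V> (j a) \<circ>\<^sub>V j) \<tau> \<sigma>"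
  shows "Kan_preserving \<V> \<V> (covariant_hom \<V> (j a))"
proof -
  define H where "H = covariant_hom \<V> (j a)"
  have H: "is_vfunctor \<V> \<V> H" unfolding H_def by (rule vfunctor_covariant) simp_all
  have Hf [simp]: "H x = W x a" for x by (simp add: H_def)
  note d = Kan_preserving_dense[OF is_vcat_self F p]
  obtain t where t: "is_vnat \<V> \<V> F H t" "\<And>b. b \<in> VOb J \<Longrightarrow> t (j b) = \<tau> b"
    using restriction_full[OF is_vcat_self F H d] \<tau> unfolding H_def by blast
  note [simp] = vfunctor_simps[OF F, simplified] vfunctor_El[OF H, simplified]
  have Hap: "ap (W x a) (W y a) (lin (far H x y) f) w = cmp_el \<V> (j a) x y f w"
    if "x \<in> Ob V" "y \<in> Ob V" "f \<in> El (IHom V x y)" "w \<in> El (W x a)" for x y f w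
    using ap_covariant[OF is_vcat_self, of "j a" x y f w] that by (simp add: H_def)
  note Fc = vfunctor_cmp_el[OF is_vcat_self is_vcat_self F, simplified]
  have tE [simp]: "([], t x) \<in> El (IHom V (F x) (W x a))" if "x \<in> Ob V" for x
    using vnatD(2)[OF is_vcat_self is_vcat_self F H t(1), of x] that by simp
  note tn = vnatD(3)[OF is_vcat_self is_vcat_self F H t(1), simplified]
  have \<sigma>E [simp]: "([], \<sigma> b) \<in> El (IHom V (W (j b) a) (F (j b)))"
    and \<sigma>\<tau>: "cmp_el \<V> (F (j b)) (W (j b) a) (F (j b)) ([], \<sigma> b) ([], t (j b)) = one_el \<V> (F (j b))"
    and \<tau>\<sigma>: "cmp_el \<V> (W (j b) a) (F (j b)) (W (j b) a) ([], t (j b)) ([], \<sigma> b) = one_el \<V> (W (j b) a)"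
    if "b \<in> VOb J" for b
    using \<sigma> that t(2) by (auto simp: vinverse_def)
  \<comment> \<open>The element of \<open>F(ja)\<close> that corresponds to the identity of \<open>ja\<close>; \<open>s f\<close> is \<open>F f\<close> applied to it.\<close>
  define p where "p = ap (W (j a) a) (F (j a)) ([], \<sigma> a) (one_el \<V> (j a))"
  have pE [simp]: "p \<in> El (F (j a))" unfolding p_def by (rule ap_El) simp_all
  have tp: "ap (F (j a)) (W (j a) a) ([], t (j a)) p = one_el \<V> (j a)"
  proof -
    have "ap (F (j a)) (W (j a) a) ([], t (j a)) p =
      ap (W (j a) a) (W (j a) a) (cmp_el \<V> (W (j a) a) (F (j a)) (W (j a) a) ([], t (j a)) ([], \<sigma> a)) (one_el \<V> (j a))"
      unfolding p_def by (rule ap_self_cmp[symmetric]) simp_all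
    then show ?thesis by (simp add: \<tau>\<sigma> ap_self_one)
  qed
  have "fst p = []" by (simp add: p_def)
  then obtain p0 where p0: "p = ([], p0)" "p0 \<in> Hom V \<I> (F (j a))" using El_Nil[OF pE] by blast
  let ?e = "\<lambda>v. at_point (Ev V (F (j a)) (F v)) (IHom V (F (j a)) (F v)) p0"
  note e = at_point_lin[OF ev p0(2)]
  have FH: "far F (j a) v \<in> Hom V (W v a) (IHom V (F (j a)) (F v))" if "v \<in> Ob V" for v
    using vfunctor_far[OF F, of "j a" v] that by simp
  define s where "s v = name (?e v \<cdot> far F (j a) v)" for v
  have eF: "?e v \<cdot> far F (j a) v \<in> Hom V (W v a) (F v)" if "v \<in> Ob V" for v
    by (rule cmp[OF FH[OF that] e(1)]) (use that in simp_all)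
  have sE [simp]: "([], s v) \<in> El (IHom V (W v a) (F v))" if "v \<in> Ob V" for v
    unfolding s_def by (rule point_El[OF name_Hom(1)[OF eF[OF that]]])
  have sap: "ap (W v a) (F v) ([], s v) f = ap (F (j a)) (F v) (lin (far F (j a) v) f) p"
    if v [simp]: "v \<in> Ob V" and f: "f \<in> El (W v a)" for v f
  proof -
    have "ap (W v a) (F v) ([], s v) f = lin (?e v) (lin (far F (j a) v) f)"
      unfolding s_def name_Hom(2)[OF eF[OF v] f] by (rule lin_lin[symmetric, OF FH[OF v] e(1) f]) simp_all
    also have "\<dots> = ap (F (j a)) (F v) (lin (far F (j a) v) f) p"
      unfolding p0(1) ap_def by (rule e(2)) (use f in simp_all)
    finally show ?thesis .
  qed
  have s: "is_vnat \<V> \<V> H F s"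
  proof (rule vnat_pointI[OF is_vcat_self is_vcat_self H F])
    fix x y g assume "x \<in> VOb \<V>" "y \<in> VOb \<V>" "g \<in> El (\<V> x y)"
    then have [simp]: "x \<in> Ob V" "y \<in> Ob V" "g \<in> El (IHom V x y)" by simp_all
    have "cmp_el \<V> (W x a) (W y a) (F y) ([], s y) (lin (far H x y) g) = cmp_el \<V> (W x a) (F x) (F y) (lin (far F x y) g) ([], s x)"
    proof (rule ap_ext)
      fix f assume [simp]: "f \<in> El (W x a)"
      show "ap (W x a) (F y) (cmp_el \<V> (W x a) (W y a) (F y) ([], s y) (lin (far H x y) g)) f =
        ap (W x a) (F y) (cmp_el \<V> (W x a) (F x) (F y) (lin (far F x y) g) ([], s x)) f"
        by (simp add: ap_self_cmp Hap sap Fc)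
    qed simp_all
    then show "cmp_el \<V> (H x) (H y) (F y) ([], s y) (lin (far H x y) g) =
      cmp_el \<V> (H x) (F x) (F y) (lin (far F x y) g) ([], s x)" by simp
  qed simp
  have ts: "cmp_el \<V> (W v a) (F v) (W v a) ([], t v) ([], s v) = one_el \<V> (W v a)" if v [simp]: "v \<in> Ob V" for v
  proof (rule ap_ext)
    fix f assume f [simp]: "f \<in> El (W v a)"
    have "ap (W v a) (W v a) (cmp_el \<V> (W v a) (F v) (W v a) ([], t v) ([], s v)) f =
      ap (F (j a)) (W v a) (cmp_el \<V> (F (j a)) (F v) (W v a) ([], t v) (lin (far F (j a) v) f)) p"
      by (simp add: ap_self_cmp sap)
    also have "\<dots> = ap (W (j a) a) (W v a) (lin (far H (j a) v) f) (one_el \<V> (j a))"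
      by (simp add: tn ap_self_cmp tp)
    finally show "ap (W v a) (W v a) (cmp_el \<V> (W v a) (F v) (W v a) ([], t v) ([], s v)) f = ap (W v a) (W v a) (one_el \<V> (W v a)) f"
      by (simp add: Hap ap_self_one)
  qed simp_all
  have sj: "([] :: 'o list, s (j b)) = ([], \<sigma> b)" if b [simp]: "b \<in> VOb J" for b
  proof -
    have "([] :: 'o list, s (j b)) = cmp_el \<V> (W (j b) a) (F (j b)) (F (j b))
      (cmp_el \<V> (F (j b)) (W (j b) a) (F (j b)) ([], \<sigma> b) ([], t (j b))) ([], s (j b))"
      by (simp add: \<sigma>\<tau>)
    also have "\<dots> = cmp_el \<V> (W (j b) a) (W (j b) a) (F (j b)) ([], \<sigma> b) (one_el \<V> (W (j b) a))"
      by (subst cmp_el_assoc) (simp_all add: ts)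
    finally show ?thesis by simp
  qed
  have "vcomp \<V> F H F s t v = VId \<V> (F v)" if v: "v \<in> Ob V" for v
  proof (rule restriction_faithful[OF is_vcat_self F F d, of "vcomp \<V> F H F s t" "\<lambda>v. VId \<V> (F v)" v])
    show "is_vnat \<V> \<V> F F (vcomp \<V> F H F s t)" by (rule vnat_comp[OF is_vcat_self is_vcat_self F H F t(1) s])
    show "is_vnat \<V> \<V> F F (\<lambda>v. VId \<V> (F v))" by (rule vnat_id[OF is_vcat_self is_vcat_self F])
    show "vcomp \<V> F H F s t (j b) = VId \<V> (F (j b))" if b: "b \<in> VOb J" for b
    proof (rule point_inject)
      show "([] :: 'o list, vcomp \<V> F H F s t (j b)) = ([], VId \<V> (F (j b)))"
        unfolding vcomp_point sj[OF b] using \<sigma>\<tau>[OF b] by (simp add: one_el_def)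
    qed
  qed (rule v)
  then have st: "cmp_el \<V> (F v) (W v a) (F v) ([], s v) ([], t v) = one_el \<V> (F v)" if "v \<in> Ob V" for v
    using vcomp_point[of \<V> F H F s t v] that by (simp add: one_el_def)
  have "vinverse \<V> \<V> F H t s" unfolding vinverse_def using ts st by simp
  from Kan_preserving_iso[OF is_vcat_self is_vcat_self F H t(1) this p] show ?thesis unfolding H_def .
qed

end

context smcc begin

text \<open>The base with its objects renamed along an injection \<open>i\<close>. Only the names change, so that
  hom-objects and composition are those of the base.\<close>

definition relabelled :: "('o \<Rightarrow> 'c) \<Rightarrow> ('c, 'o, 'a) vcat" where
  "relabelled i = (let k = inv_into (Ob V) i in \<lparr>
     VOb = i ` Ob V,
     VHom = (\<lambda>x y. \<V> (k x) (k y)),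
     VId = (\<lambda>x. VId \<V> (k x)),
     VCmp = (\<lambda>x y z. VCmp \<V> (k x) (k y) (k z))\<rparr>)"

definition relabel :: "('y \<Rightarrow> 'z) \<Rightarrow> ('x, 'y, 'a) vfunctor \<Rightarrow> ('x, 'z, 'a) vfunctor" where
  "relabel k F = \<lparr>fob = (\<lambda>x. k (F x)), far = far F\<rparr>"

lemma relabel_simps [simp]: "(relabel k F) x = k (F x)" "far (relabel k F) = far F"
  by (simp_all add: relabel_def)

lemma relabel_comp: "relabel k (F \<circ>\<^sub>V D) = relabel k F \<circ>\<^sub>V D"
  by (simp add: relabel_def vfunctor_comp_def)

lemma relabelled_simps:
  "VOb (relabelled i) = i ` Ob V"
  "(relabelled i) x y = IHom V (inv_into (Ob V) i x) (inv_into (Ob V) i y)"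
  "VId (relabelled i) x = VId \<V> (inv_into (Ob V) i x)"
  "VCmp (relabelled i) x y z = VCmp \<V> (inv_into (Ob V) i x) (inv_into (Ob V) i y) (inv_into (Ob V) i z)"
  by (simp_all add: relabelled_def Let_def)

lemma is_vcat_relabelled:
  assumes i: "inj_on i (Ob V)" shows "is_vcat (relabelled i)"
  using is_vcat_self inv_into_into[of _ i "Ob V"] unfolding is_vcat_def relabelled_simps by simp

lemma relabel_into:
  assumes i: "inj_on i (Ob V)" and F: "is_vfunctor A \<V> F"
  shows "is_vfunctor A (relabelled i) (relabel i F)"
proof -
  have "inv_into (Ob V) i (i (F x)) = F x" if "x \<in> VOb A" for x
    using vfunctor_ob[OF F that] i by simp
  then show ?thesis using F unfolding is_vfunctor_def relabelled_simps by simp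
qed

lemma relabel_from:
  assumes "is_vfunctor A (relabelled i) F"
  shows "is_vfunctor A \<V> (relabel (inv_into (Ob V) i) F)"
  using assms inv_into_into[of _ i "Ob V"] unfolding is_vfunctor_def relabelled_simps by simp

end

context arity_system begin

lemma Kan_colimit_relabelled:
  assumes i: "inj_on i (Ob V)" and c: "c \<in> i ` Ob V"
  shows "Kan_colimit v (relabelled i) D c r \<longleftrightarrow>
    Kan_colimit v \<V> (relabel (inv_into (Ob V) i) D) (inv_into (Ob V) i c) r"
proof -
  let ?k = "inv_into (Ob V) i"
  have k: "?k c \<in> Ob V" using c by (rule inv_into_into)
  have cmp: "cmp_el (relabelled i) x y z = cmp_el \<V> (?k x) (?k y) (?k z)" for x y z
    by (simp add: cmp_el_def relabelled_simps fun_eq_iff)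
  have "cone v (relabelled i) D c r = cone v \<V> (relabel ?k D) (?k c) r"
    unfolding cone_def cmp relabelled_simps by simp
  moreover have "indexed_cone v (relabelled i) D x l T = indexed_cone v \<V> (relabel ?k D) (?k x) l T" for x l T
    unfolding indexed_cone_def cmp relabelled_simps by simp
  ultimately show ?thesis
    unfolding Kan_colimit_def relabelled_simps using c k by (simp add: inv_into_f_f[OF i] cong: ball_cong)
qed

lemma has_colimits_relabelled:
  assumes i: "inj_on i (Ob V)" and h: "has_colimits (Kan_weights J j) \<V>"
  shows "has_colimits (Kan_weights J j) (relabelled i)"
  unfolding has_colimits_iff[OF is_vcat_relabelled[OF i]]
proof (intro ballI allI impI)
  fix v D assume v: "v \<in> Ob V" and D: "is_vfunctor J (relabelled i) D"
  obtain c r where g: "Kan_colimit v \<V> (relabel (inv_into (Ob V) i) D) c r"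
    using h v relabel_from[OF D] unfolding has_colimits_iff[OF is_vcat_self] by blast
  have "c \<in> Ob V" using Kan_colimitD(1)[OF g] by simp
  then have "Kan_colimit v (relabelled i) D (i c) r" using Kan_colimit_relabelled[OF i, of "i c" v D r] g i by simp
  then show "\<exists>c r. Kan_colimit v (relabelled i) D c r" by blast
qed

lemma Kan_preserving_relabel_from:
  assumes i: "inj_on i (Ob V)" and F: "is_vfunctor \<V> (relabelled i) F" and p: "Kan_preserving \<V> (relabelled i) F"
  shows "Kan_preserving \<V> \<V> (relabel (inv_into (Ob V) i) F)"
  unfolding Kan_preserving_def
proof (intro ballI allI impI)
  fix v D c r assume v: "v \<in> Ob V" and D: "is_vfunctor J \<V> D" and g: "Kan_colimit v \<V> D c r"
  have "F c \<in> i ` Ob V" using vfunctor_ob[OF F] Kan_colimitD(1)[OF g] by (simp add: relabelled_simps)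
  moreover have "Kan_colimit v (relabelled i) (F \<circ>\<^sub>V D) (F c) (\<lambda>b. far F (D b) c \<cdot> r b)"
    using p v D g unfolding Kan_preserving_def by blast
  ultimately show "Kan_colimit v \<V> (relabel (inv_into (Ob V) i) F \<circ>\<^sub>V D) (fob (relabel (inv_into (Ob V) i) F) c)
    (\<lambda>b. far (relabel (inv_into (Ob V) i) F) (D b) c \<cdot> r b)"
    using Kan_colimit_relabelled[OF i] by (simp add: relabel_comp)
qed

text \<open>The cocontinuous extension of the restriction of \<open>V(ja,-)\<close>, whose existence is the essential
  surjectivity of restriction along \<open>j\<close>, is the input of \<open>flat_if_extends\<close>.\<close>

lemma eleutheric_if_free:
  assumes i: "inj_on (i :: 'o \<Rightarrow> 'c) (Ob V)"
    and free: "presents_free_cocompletion TYPE('c) (Kan_weights J j) J \<V> j"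
  shows "eleutheric J j"
  unfolding eleutheric_iff
proof (intro conjI ballI)
  show h: "has_colimits (Kan_weights J j) \<V>" using free by (simp add: presents_free_cocompletion_def)
  fix a assume a: "a \<in> VOb J"
  let ?C = "relabelled i" and ?k = "inv_into (Ob V) i"
  let ?H = "covariant_hom \<V> (j a)"
  note C = is_vcat_relabelled[OF i]
  have H: "is_vfunctor \<V> \<V> ?H" by (rule vfunctor_covariant) (use a in simp_all)
  have Hj: "is_vfunctor J \<V> (?H \<circ>\<^sub>V j)" by (rule vfunctor_comp[OF J is_vcat_self is_vcat_self j H])
  note P = relabel_into[OF i Hj]
  let ?P = "vrestrict J (relabel i (?H \<circ>\<^sub>V j))"
  have PO: "?P \<in> Ob (VCAT J ?C)" using P by (simp add: VCAT_Ob)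
  have "is_equivalence (Cocts (Kan_weights J j) \<V> ?C) (VCAT J ?C) (precomposition J j)"
    using free C has_colimits_relabelled[OF i h] by (simp add: presents_free_cocompletion_def)
  then obtain G t where G: "is_ord_functor (VCAT J ?C) (Cocts (Kan_weights J j) \<V> ?C) G"
    and t: "is_natural_iso (VCAT J ?C) (VCAT J ?C) (ord_functor_comp (precomposition J j) G) ord_functor_id t"
    unfolding is_equivalence_def by blast
  define F where "F = FOb G ?P"
  have "F \<in> Ob (Cocts (Kan_weights J j) \<V> ?C)" using G PO unfolding is_ord_functor_def F_def by blast
  then have F: "is_vfunctor \<V> ?C F" and p: "Kan_preserving \<V> ?C F" by (auto simp: Cocts_Ob[OF C])
  have "t ?P \<in> Hom (VCAT J ?C) (vrestrict J (F \<circ>\<^sub>V j)) ?P \<and> iso_arr (VCAT J ?C) (t ?P)"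
    using t PO unfolding is_natural_iso_def ord_functor_comp_def ord_functor_id_def F_def by simp
  then obtain \<tau> \<sigma> where \<tau>: "is_vnat J ?C (F \<circ>\<^sub>V j) (relabel i (?H \<circ>\<^sub>V j)) \<tau>"
    and \<sigma>: "vinverse J ?C (F \<circ>\<^sub>V j) (relabel i (?H \<circ>\<^sub>V j)) \<tau> \<sigma>"
    using VCAT_iso_iff[OF J C] by (auto simp: VCAT_Hom is_vnat_vrestrict vinverse_vrestrict)
  have ki: "?k (i ((?H \<circ>\<^sub>V j) b)) = (?H \<circ>\<^sub>V j) b" if "b \<in> VOb J" for b
    using vfunctor_ob[OF Hj that] i by simp
  let ?F = "relabel ?k F"
  show "Kan_preserving \<V> \<V> ?H"
  proof (rule flat_if_extends[OF a])
    show "is_vfunctor \<V> \<V> ?F" by (rule relabel_from[OF F])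
    show "Kan_preserving \<V> \<V> ?F" by (rule Kan_preserving_relabel_from[OF i F p])
    show "is_vnat J \<V> (?F \<circ>\<^sub>V j) (?H \<circ>\<^sub>V j) \<tau>"
      using \<tau> ki unfolding is_vnat_def relabelled_simps by simp
    show "vinverse J \<V> (?F \<circ>\<^sub>V j) (?H \<circ>\<^sub>V j) \<tau> \<sigma>"
      using \<sigma> ki unfolding vinverse_def cmp_el_def one_el_def relabelled_simps by simp
  qed
qed

theorem eleutheric_iff_free:
  assumes "inj_on (i :: 'o \<Rightarrow> 'c) (Ob V)"
  shows "eleutheric J j \<longleftrightarrow> presents_free_cocompletion TYPE('c) (Kan_weights J j) J \<V> j"
proof
  assume e: "eleutheric J j"
  then show "presents_free_cocompletion TYPE('c) (Kan_weights J j) J \<V> j"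
    unfolding presents_free_cocompletion_def using free_if_eleutheric[OF e]
    by (auto simp: eleutheric_def)
qed (rule eleutheric_if_free[OF assms])

end

text \<open>The unit comparison \<open>e\<close> is a point of \<open>[I,jU]\<close> that is invertible in the underlying category; it names
  an invertible arrow of the base.\<close>

lemma (in smcc) arity_system_of:
  assumes "system_of_arities J M j m e"
  shows "arity_system V J j"
proof
  have j: "is_vcat J" "is_vfunctor J \<V> j" "fully_faithful J j" and U: "MUnt M \<in> VOb J"
    and e: "(\<I>, j (MUnt M), e) \<in> Hom (underlying_smc \<V> self_monoidal) \<I> (j (MUnt M))"
    "iso_arr (underlying_smc \<V> self_monoidal) (\<I>, j (MUnt M), e)"
    using assms unfolding system_of_arities_def is_symmetric_monoidal_vcat_def
      is_strong_symmetric_monoidal_vfunctor_def is_strong_symmetric_monoidal_functor_def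
    by (auto simp: underlying_smc_def self_monoidal_def Let_def underlying_functor_def)
  then show "is_vcat J" "is_vfunctor J \<V> j" "fully_faithful J j" by auto
  let ?u = "j (MUnt M)"
  have u [simp]: "?u \<in> Ob V" using vfunctor_ob[OF j(2) U] by simp
  obtain e' where eH: "e \<in> Hom V \<I> (IHom V \<I> ?u)" and eH': "e' \<in> Hom V \<I> (IHom V ?u \<I>)"
    and ee: "VCmp \<V> \<I> ?u \<I> \<cdot> (e' \<oslash> e) \<cdot> inv (LUn V \<I>) = VId \<V> \<I>"
    "VCmp \<V> ?u \<I> ?u \<cdot> (e \<oslash> e') \<cdot> inv (LUn V \<I>) = VId \<V> ?u"
    using e(1,2) unfolding iso_arr_iff[OF e(1)]
    by (auto simp: underlying_smc_def Let_def underlying_def Hom_def)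
  have g: "cmp_el \<V> \<I> ?u \<I> ([], e') ([], e) = one_el \<V> \<I>" "cmp_el \<V> ?u \<I> ?u ([], e) ([], e') = one_el \<V> ?u"
    using ee by (simp_all add: cmp_el_def bil_def one_el_def)
  note i = unname_Hom[OF eH unt u] and i' = unname_Hom[OF eH' u unt]
  have "unname ?u \<I> e' \<cdot> unname \<I> ?u e = \<one> \<I>"
  proof (rule lin_ext)
    show "lin (unname ?u \<I> e' \<cdot> unname \<I> ?u e) (gen \<I>) = lin (\<one> \<I>) (gen \<I>)"
      using lin_lin[OF i(1) i'(1), of "gen \<I>"] i(2)[of "gen \<I>"] i'(2)[of "lin (unname \<I> ?u e) (gen \<I>)"] lin_El[OF i(1), of "gen \<I>"]
        ap_self_cmp[OF unt u unt point_El[OF eH'] point_El[OF eH], of "gen \<I>"] g(1)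
      by (simp add: ap_self_one lin_one)
  qed (use i(1) i'(1) in \<open>simp_all add: in_Hom\<close>)
  moreover have "unname \<I> ?u e \<cdot> unname ?u \<I> e' = \<one> ?u"
  proof (rule lin_ext)
    show "lin (unname \<I> ?u e \<cdot> unname ?u \<I> e') (gen ?u) = lin (\<one> ?u) (gen ?u)"
      using lin_lin[OF i'(1) i(1), of "gen ?u"] i'(2)[of "gen ?u"] i(2)[of "lin (unname ?u \<I> e') (gen ?u)"] lin_El[OF i'(1), of "gen ?u"]
        ap_self_cmp[OF u unt u point_El[OF eH] point_El[OF eH'], of "gen ?u"] g(2)
      by (simp add: ap_self_one lin_one)
  qed (use i(1) i'(1) in \<open>simp_all add: in_Hom\<close>)
  ultimately have "iso_arr V (unname \<I> ?u e)"
    unfolding iso_arr_iff[OF i(1)] using i'(1) by blast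
  then show "\<exists>U\<in>VOb J. \<exists>i. i \<in> Hom V \<I> (j U) \<and> iso_arr V i"
    using U i(1) by blast
qed

theorem theorem7p8:
  fixes V :: "('o, 'a) smcc"
    and J :: "('x, 'o, 'a) vcat"
    and M :: "('x, 'a) vmonoidal"
    and j :: "('x, 'o, 'a) vfunctor"
    and m :: "'x \<times> 'x \<Rightarrow> 'a"
    and e :: "'a"
  assumes "symmetric_monoidal_closed_category V"
    and "enriched_over.system_of_arities V J M j m e"
    and "\<exists>i :: 'o \<Rightarrow> 'c. inj_on i (Ob V)"
  shows "enriched_over.eleutheric V J j \<longleftrightarrow>
         enriched_over.presents_free_cocompletion V TYPE('c)
           (enriched_over.Kan_weights V J j) J (enriched_over.self V) j"
proof -
  interpret smcc V by (simp add: smcc_def assms(1))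
  interpret arity_system V J j by (rule arity_system_of[OF assms(2)])
  show ?thesis using assms(3) eleutheric_iff_free by blast
qed

end
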